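(* Assume $\mathcal L$ is countable, $T$ is NIP and $|M|=\aleph_0$. Let $\mu,\nu\in\mathfrak M^{\mathrm{inv}}_{\bar m}(\mathfrak C,M)$ and $p\in S^{\mathrm{inv}}_{\bar m}(\mathfrak C,M)$. Then $p*(\mu*\nu)=(p*\mu)*\nu$.
   Context: $\mathfrak C$ is a monster model of $T$, $\mathfrak C'\succ\mathfrak C$ a bigger monster model, $M\preceq\mathfrak C$ small with enumeration $\bar m$, $\bar x,\bar y$ tuples of variables corresponding to $\bar m$. $\mathfrak M^{\mathrm{inv}}_{\bar m}(\mathfrak C,M)$ [$S^{\mathrm{inv}}_{\bar m}(\mathfrak C,M)$] = $M$-invariant global Keisler measures [types] in $\bar y$ concentrating on $\mathrm{tp}(\bar m/\emptyset)$; types are identified with Dirac measures. In NIP every such measure $\mu$ is Borel-definable over $M$: the maps $F^{\varphi}_{\mu}(q)=\mu(\varphi(\bar b;\bar y))$, $\bar b\models q\in S_{\bar x}(M)$, are Borel. Convolution: $(\mu*\nu)(\varphi(\bar b;\bar y)):=\int_{S_{\bar x}(M)}F^{\varphi}_{\mu}\,d((h_{\bar b})_*\nu)$ for $\mathcal L$-formulas $\varphi(\bar x;\bar y)$ and $\bar b\in\mathfrak C^{\bar x}$, where $h_{\bar b}:S_{\bar m}(\mathfrak C)\to S_{\bar x}(M)$, $\mathrm{tp}(\sigma(\bar m)/\mathfrak C)\mapsto\mathrm{tp}(\sigma^{-1}(\bar b)/M)$ for $\sigma\in\mathrm{Aut}(\mathfrak C')$. *)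

theory Defs
  imports "HOL-Probability.Probability"
begin

unbundle cardinal_syntax

section \<open>First-order logic\<close>

record ('f, 'r) lang =
  fsyms :: "'f set"
  rsyms :: "'r set"
  farity :: "'f \<Rightarrow> nat"
  rarity :: "'r \<Rightarrow> nat"

definition countable_lang :: "('f, 'r) lang \<Rightarrow> bool" where
  "countable_lang L \<longleftrightarrow> countable (fsyms L) \<and> countable (rsyms L)"

text \<open>
  Terms and formulas in locally nameless style: free variables are named by an arbitrary type
  \<open>'v\<close>, bound variables are de Bruijn indices. The sets of free variables are
  \<open>fv_trm\<close> and \<open>fv\<close>; the renamings \<open>ren_trm\<close> and \<open>ren\<close> act on the free variables only
  and are therefore capture-free.
\<close>

datatype (dead 'f, fv_trm: 'v) trm =
    Free 'v
  | Bound nat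
  | App 'f "('f, 'v) trm list"
  for map: ren_trm

datatype (dead 'f, dead 'r, fv: 'v) fml =
    Eq "('f, 'v) trm" "('f, 'v) trm"
  | Rel 'r "('f, 'v) trm list"
  | Neg "('f, 'r, 'v) fml"
  | And "('f, 'r, 'v) fml" "('f, 'r, 'v) fml"
  | Ex "('f, 'r, 'v) fml"
  for map: ren

fun wf_trm :: "('f, 'r) lang \<Rightarrow> nat \<Rightarrow> ('f, 'v) trm \<Rightarrow> bool" where
  "wf_trm L n (Free v) \<longleftrightarrow> True"
| "wf_trm L n (Bound k) \<longleftrightarrow> k < n"
| "wf_trm L n (App f ts) \<longleftrightarrow>
     f \<in> fsyms L \<and> length ts = farity L f \<and> (\<forall>t\<in>set ts. wf_trm L n t)"

text \<open>The second argument is the number of enclosing quantifiers.\<close>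

fun wf_fml :: "('f, 'r) lang \<Rightarrow> nat \<Rightarrow> ('f, 'r, 'v) fml \<Rightarrow> bool" where
  "wf_fml L n (Eq s t) \<longleftrightarrow> wf_trm L n s \<and> wf_trm L n t"
| "wf_fml L n (Rel r ts) \<longleftrightarrow>
     r \<in> rsyms L \<and> length ts = rarity L r \<and> (\<forall>t\<in>set ts. wf_trm L n t)"
| "wf_fml L n (Neg \<phi>) \<longleftrightarrow> wf_fml L n \<phi>"
| "wf_fml L n (And \<phi> \<psi>) \<longleftrightarrow> wf_fml L n \<phi> \<and> wf_fml L n \<psi>"
| "wf_fml L n (Ex \<phi>) \<longleftrightarrow> wf_fml L (Suc n) \<phi>"

definition fmls :: "('f, 'r) lang \<Rightarrow> ('f, 'r, 'v) fml set" where
  "fmls L = {\<phi>. wf_fml L 0 \<phi>}"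

record ('f, 'r, 'c) struct =
  univ :: "'c set"
  fint :: "'f \<Rightarrow> 'c list \<Rightarrow> 'c"
  rint :: "'r \<Rightarrow> 'c list \<Rightarrow> bool"

definition is_struct :: "('f, 'r) lang \<Rightarrow> ('f, 'r, 'c) struct \<Rightarrow> bool" where
  "is_struct L N \<longleftrightarrow> univ N \<noteq> {} \<and>
     (\<forall>f\<in>fsyms L. \<forall>as. length as = farity L f \<longrightarrow> set as \<subseteq> univ N \<longrightarrow> fint N f as \<in> univ N)"

fun eval :: "('f, 'r, 'c) struct \<Rightarrow> ('v \<Rightarrow> 'c) \<Rightarrow> 'c list \<Rightarrow> ('f, 'v) trm \<Rightarrow> 'c" where
  "eval N e bs (Free v) = e v"
| "eval N e bs (Bound k) = bs ! k"
| "eval N e bs (App f ts) = fint N f (map (eval N e bs) ts)"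

fun sat_env :: "('f, 'r, 'c) struct \<Rightarrow> ('v \<Rightarrow> 'c) \<Rightarrow> 'c list \<Rightarrow> ('f, 'r, 'v) fml \<Rightarrow> bool" where
  "sat_env N e bs (Eq s t) \<longleftrightarrow> eval N e bs s = eval N e bs t"
| "sat_env N e bs (Rel r ts) \<longleftrightarrow> rint N r (map (eval N e bs) ts)"
| "sat_env N e bs (Neg \<phi>) \<longleftrightarrow> \<not> sat_env N e bs \<phi>"
| "sat_env N e bs (And \<phi> \<psi>) \<longleftrightarrow> sat_env N e bs \<phi> \<and> sat_env N e bs \<psi>"
| "sat_env N e bs (Ex \<phi>) \<longleftrightarrow> (\<exists>c\<in>univ N. sat_env N e (c # bs) \<phi>)"

definition sat :: "('f, 'r, 'c) struct \<Rightarrow> ('v \<Rightarrow> 'c) \<Rightarrow> ('f, 'r, 'v) fml \<Rightarrow> bool" where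
  "sat N e \<phi> \<longleftrightarrow> sat_env N e [] \<phi>"

definition sentences :: "('f, 'r) lang \<Rightarrow> ('f, 'r, nat) fml set" where
  "sentences L = {\<phi> \<in> fmls L. fv \<phi> = {}}"

definition is_model ::
  "('f, 'r) lang \<Rightarrow> ('f, 'r, nat) fml set \<Rightarrow> ('f, 'r, 'c) struct \<Rightarrow> bool" where
  "is_model L T N \<longleftrightarrow> is_struct L N \<and> (\<forall>\<phi>\<in>T. \<forall>e. sat N e \<phi>)"

definition elem_sub ::
  "('f, 'r) lang \<Rightarrow> ('f, 'r, 'c) struct \<Rightarrow> ('f, 'r, 'c) struct \<Rightarrow> bool" where
  "elem_sub L N N' \<longleftrightarrow> is_struct L N \<and> is_struct L N' \<and> univ N \<subseteq> univ N' \<and>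
     (\<forall>\<phi>\<in>fmls L. \<forall>e :: nat \<Rightarrow> 'c. range e \<subseteq> univ N \<longrightarrow> (sat N e \<phi> \<longleftrightarrow> sat N' e \<phi>))"

definition partial_elementary ::
  "('f, 'r) lang \<Rightarrow> ('f, 'r, 'c) struct \<Rightarrow> 'c set \<Rightarrow> ('c \<Rightarrow> 'c) \<Rightarrow> bool" where
  "partial_elementary L N A g \<longleftrightarrow> A \<subseteq> univ N \<and> g ` A \<subseteq> univ N \<and>
     (\<forall>\<phi>\<in>fmls L. \<forall>e :: nat \<Rightarrow> 'c. range e \<subseteq> A \<longrightarrow> (sat N e \<phi> \<longleftrightarrow> sat N (g \<circ> e) \<phi>))"

text \<open>Automorphisms; their values outside the universe are irrelevant.\<close>

definition Aut :: "('f, 'r) lang \<Rightarrow> ('f, 'r, 'c) struct \<Rightarrow> ('c \<Rightarrow> 'c) set" where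
  "Aut L N = {\<sigma>. bij_betw \<sigma> (univ N) (univ N) \<and>
     (\<forall>f\<in>fsyms L. \<forall>as. length as = farity L f \<longrightarrow> set as \<subseteq> univ N \<longrightarrow>
        \<sigma> (fint N f as) = fint N f (map \<sigma> as)) \<and>
     (\<forall>r\<in>rsyms L. \<forall>as. length as = rarity L r \<longrightarrow> set as \<subseteq> univ N \<longrightarrow>
        (rint N r as \<longleftrightarrow> rint N r (map \<sigma> as)))}"

definition Aut_over :: "('f, 'r) lang \<Rightarrow> ('f, 'r, 'c) struct \<Rightarrow> 'c set \<Rightarrow> ('c \<Rightarrow> 'c) set" where
  "Aut_over L N A = {\<sigma> \<in> Aut L N. \<forall>a\<in>A. \<sigma> a = a}"


section \<open>Formulas with parameters and types\<close>

text \<open>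
  An \<open>L(A)\<close>-formula in a tuple of variables indexed by \<open>'i\<close> is an element of
  \<^typ>\<open>('f, 'r, 'i + 'c) fml\<close>: \<open>Inl i\<close> is the \<open>i\<close>-th variable, \<open>Inr c\<close> is the parameter \<open>c\<close>.
\<close>

definition pfmls :: "('f, 'r) lang \<Rightarrow> 'c set \<Rightarrow> ('f, 'r, 'i + 'c) fml set" where
  "pfmls L A = {\<phi> \<in> fmls L. \<forall>c. Inr c \<in> fv \<phi> \<longrightarrow> c \<in> A}"

definition psat :: "('f, 'r, 'c) struct \<Rightarrow> ('i \<Rightarrow> 'c) \<Rightarrow> ('f, 'r, 'i + 'c) fml \<Rightarrow> bool" where
  "psat N a \<phi> \<longleftrightarrow> sat N (case_sum a id) \<phi>"

definition tp ::
  "('f, 'r) lang \<Rightarrow> ('f, 'r, 'c) struct \<Rightarrow> 'c set \<Rightarrow> ('i \<Rightarrow> 'c) \<Rightarrow> ('f, 'r, 'i + 'c) fml set" where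
  "tp L N A a = {\<phi> \<in> pfmls L A. psat N a \<phi>}"

text \<open>The space of complete types over \<open>A\<close> (with respect to the elementary diagram of \<open>N\<close>)
  in variables indexed by \<open>'i\<close>.\<close>

definition types ::
  "('f, 'r) lang \<Rightarrow> ('f, 'r, 'c) struct \<Rightarrow> 'c set \<Rightarrow> ('f, 'r, 'i + 'c) fml set set" where
  "types L N A = {p. p \<subseteq> pfmls L A \<and>
     (\<forall>\<Gamma>. finite \<Gamma> \<longrightarrow> \<Gamma> \<subseteq> p \<longrightarrow> (\<exists>a. range a \<subseteq> univ N \<and> (\<forall>\<phi>\<in>\<Gamma>. psat N a \<phi>))) \<and>
     (\<forall>\<phi>\<in>pfmls L A. \<phi> \<in> p \<or> Neg \<phi> \<in> p)}"

definition type_topology ::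
  "('f, 'r) lang \<Rightarrow> ('f, 'r, 'c) struct \<Rightarrow> 'c set \<Rightarrow> ('f, 'r, 'i + 'c) fml set topology" where
  "type_topology L N A =
     topology_generated_by ((\<lambda>\<phi>. {p \<in> types L N A. \<phi> \<in> p}) ` pfmls L A)"

definition saturated :: "('f, 'r) lang \<Rightarrow> 'k rel \<Rightarrow> ('f, 'r, 'c) struct \<Rightarrow> bool" where
  "saturated L \<kappa> N \<longleftrightarrow> (\<forall>A \<subseteq> univ N. |A| <o \<kappa> \<longrightarrow>
     (\<forall>p \<in> types L N A. \<exists>a :: unit \<Rightarrow> 'c. range a \<subseteq> univ N \<and> tp L N A a = p))"

definition strongly_homogeneous :: "('f, 'r) lang \<Rightarrow> 'k rel \<Rightarrow> ('f, 'r, 'c) struct \<Rightarrow> bool" where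
  "strongly_homogeneous L \<kappa> N \<longleftrightarrow> (\<forall>A g. |A| <o \<kappa> \<longrightarrow> partial_elementary L N A g \<longrightarrow>
     (\<exists>\<sigma>\<in>Aut L N. \<forall>a\<in>A. \<sigma> a = g a))"

text \<open>\<open>\<kappa>\<close> is the degree of saturation of the monster model; a set is small if it has
  cardinality less than \<open>\<kappa>\<close>.\<close>

definition monster_model ::
  "('f, 'r) lang \<Rightarrow> ('f, 'r, nat) fml set \<Rightarrow> 'k rel \<Rightarrow> ('f, 'r, 'c) struct \<Rightarrow> bool" where
  "monster_model L T \<kappa> C \<longleftrightarrow> is_model L T C \<and>
     Card_order \<kappa> \<and> natLeq <o \<kappa> \<and> |fsyms L| <o \<kappa> \<and> |rsyms L| <o \<kappa> \<and>
     saturated L \<kappa> C \<and> strongly_homogeneous L \<kappa> C"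

definition small :: "'k rel \<Rightarrow> 'a set \<Rightarrow> bool" where
  "small \<kappa> A \<longleftrightarrow> |A| <o \<kappa>"


section \<open>NIP\<close>

text \<open>\<open>\<phi>(x;y)\<close> has the independence property in \<open>N\<close>; \<open>Inl\<close> marks the \<open>x\<close>-variables and \<open>Inr\<close>
  the \<open>y\<close>-variables, of which only finitely many occur in \<open>\<phi>\<close>.\<close>

definition has_IP :: "('f, 'r, 'c) struct \<Rightarrow> ('f, 'r, nat + nat) fml \<Rightarrow> bool" where
  "has_IP N \<phi> \<longleftrightarrow> (\<exists>(a :: nat \<Rightarrow> nat \<Rightarrow> 'c) (b :: nat set \<Rightarrow> nat \<Rightarrow> 'c).
     (\<forall>k. range (a k) \<subseteq> univ N) \<and> (\<forall>S. range (b S) \<subseteq> univ N) \<and>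
     (\<forall>k S. sat N (case_sum (a k) (b S)) \<phi> \<longleftrightarrow> k \<in> S))"

text \<open>
  A theory is NIP if no formula has the independence property in a model of it. HOL cannot quantify
  over models of all types, so the universe is taken inside \<open>'c\<close>; this is the usual notion
  whenever a monster model lives in \<open>'c\<close>, since it suffices to look at that model.
\<close>

definition NIP :: "('f, 'r) lang \<Rightarrow> ('f, 'r, nat) fml set \<Rightarrow> 'c itself \<Rightarrow> bool" where
  "NIP L T _ \<longleftrightarrow> (\<forall>(N :: ('f, 'r, 'c) struct) \<phi>. is_model L T N \<longrightarrow> \<phi> \<in> fmls L \<longrightarrow> \<not> has_IP N \<phi>)"


section \<open>Invariant types and Keisler measures\<close>

text \<open>
  A formula \<open>\<phi>(x;y)\<close> without parameters, with \<open>x\<close> and \<open>y\<close> both indexed by \<open>'i\<close>, is an element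
  of \<^typ>\<open>('f, 'r, 'i + 'i) fml\<close>: \<open>Inl i\<close> is \<open>x\<^sub>i\<close> and \<open>Inr i\<close> is \<open>y\<^sub>i\<close>. Substituting \<open>b\<close> for \<open>x\<close>
  yields the formula \<open>\<phi>(b;y)\<close>, in the encoding of formulas with parameters above.
\<close>

definition inst :: "('f, 'r, 'i + 'i) fml \<Rightarrow> ('i \<Rightarrow> 'c) \<Rightarrow> ('f, 'r, 'i + 'c) fml" where
  "inst \<phi> b = ren (case_sum (\<lambda>i. Inr (b i)) Inl) \<phi>"

definition act :: "('c \<Rightarrow> 'c) \<Rightarrow> ('f, 'r, 'i + 'c) fml \<Rightarrow> ('f, 'r, 'i + 'c) fml" where
  "act \<sigma> \<phi> = ren (map_sum id \<sigma>) \<phi>"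

text \<open>The space \<open>S\<^sub>m(C)\<close> of global types extending \<open>tp(m/\<emptyset>)\<close>.\<close>

definition Sm ::
  "('f, 'r) lang \<Rightarrow> ('f, 'r, 'c) struct \<Rightarrow> ('i \<Rightarrow> 'c) \<Rightarrow> ('f, 'r, 'i + 'c) fml set set" where
  "Sm L C m = {q \<in> types L C (univ C). tp L C {} m \<subseteq> q}"

definition Sm_inv ::
  "('f, 'r) lang \<Rightarrow> ('f, 'r, 'c) struct \<Rightarrow> ('f, 'r, 'c) struct \<Rightarrow> ('i \<Rightarrow> 'c) \<Rightarrow>
     ('f, 'r, 'i + 'c) fml set set" where
  "Sm_inv L C M m = {q \<in> Sm L C m.
     \<forall>\<sigma>\<in>Aut_over L C (univ M). \<forall>\<phi>\<in>pfmls L (univ C). act \<sigma> \<phi> \<in> q \<longleftrightarrow> \<phi> \<in> q}"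

text \<open>Global Keisler measures: finitely additive probability measures on the \<open>L(C)\<close>-formulas
  modulo equivalence in \<open>C\<close>. The disjunction is written \<open>\<not> (\<not> \<phi> \<and> \<not> \<psi>)\<close>.\<close>

definition keisler_measure ::
  "('f, 'r) lang \<Rightarrow> ('f, 'r, 'c) struct \<Rightarrow> (('f, 'r, 'i + 'c) fml \<Rightarrow> real) \<Rightarrow> bool" where
  "keisler_measure L C \<mu> \<longleftrightarrow>
     (\<forall>\<phi>\<in>pfmls L (univ C). 0 \<le> \<mu> \<phi>) \<and>
     (\<forall>\<phi>\<in>pfmls L (univ C). (\<forall>a. range a \<subseteq> univ C \<longrightarrow> psat C a \<phi>) \<longrightarrow> \<mu> \<phi> = 1) \<and>
     (\<forall>\<phi>\<in>pfmls L (univ C). \<forall>\<psi>\<in>pfmls L (univ C).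
        (\<forall>a. range a \<subseteq> univ C \<longrightarrow> (psat C a \<phi> \<longleftrightarrow> psat C a \<psi>)) \<longrightarrow> \<mu> \<phi> = \<mu> \<psi>) \<and>
     (\<forall>\<phi>\<in>pfmls L (univ C). \<forall>\<psi>\<in>pfmls L (univ C).
        (\<forall>a. range a \<subseteq> univ C \<longrightarrow> \<not> (psat C a \<phi> \<and> psat C a \<psi>)) \<longrightarrow>
        \<mu> (Neg (And (Neg \<phi>) (Neg \<psi>))) = \<mu> \<phi> + \<mu> \<psi>)"

definition Mm_inv ::
  "('f, 'r) lang \<Rightarrow> ('f, 'r, 'c) struct \<Rightarrow> ('f, 'r, 'c) struct \<Rightarrow> ('i \<Rightarrow> 'c) \<Rightarrow>
     (('f, 'r, 'i + 'c) fml \<Rightarrow> real) set" where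
  "Mm_inv L C M m = {\<mu>. keisler_measure L C \<mu> \<and>
     (\<forall>\<phi>\<in>tp L C {} m. \<mu> \<phi> = 1) \<and>
     (\<forall>\<sigma>\<in>Aut_over L C (univ M). \<forall>\<phi>\<in>pfmls L (univ C). \<mu> (act \<sigma> \<phi>) = \<mu> \<phi>)}"

definition dirac :: "('f, 'r, 'i + 'c) fml set \<Rightarrow> ('f, 'r, 'i + 'c) fml \<Rightarrow> real" where
  "dirac p \<phi> = of_bool (\<phi> \<in> p)"


section \<open>Convolution\<close>

definition borel_of :: "'a topology \<Rightarrow> 'a measure" where
  "borel_of X = sigma (topspace X) {U. openin X U}"

definition regular_borel_prob :: "'a topology \<Rightarrow> 'a measure \<Rightarrow> bool" where
  "regular_borel_prob X N \<longleftrightarrow> prob_space N \<and> space N = topspace X \<and> sets N = sets (borel_of X) \<and>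
     (\<forall>B\<in>sets N. emeasure N B = (SUP K\<in>{K. compactin X K \<and> K \<subseteq> B}. emeasure N K) \<and>
                 emeasure N B = (INF U\<in>{U. openin X U \<and> B \<subseteq> U}. emeasure N U))"

definition Sm_topology ::
  "('f, 'r) lang \<Rightarrow> ('f, 'r, 'c) struct \<Rightarrow> ('i \<Rightarrow> 'c) \<Rightarrow> ('f, 'r, 'i + 'c) fml set topology" where
  "Sm_topology L C m = subtopology (type_topology L C (univ C)) (Sm L C m)"

text \<open>The regular Borel probability measure on \<open>S\<^sub>m(C)\<close> identified with a global Keisler measure
  concentrating on \<open>tp(m/\<emptyset>)\<close>.\<close>

definition borel_extension ::
  "('f, 'r) lang \<Rightarrow> ('f, 'r, 'c) struct \<Rightarrow> ('i \<Rightarrow> 'c) \<Rightarrow> (('f, 'r, 'i + 'c) fml \<Rightarrow> real) \<Rightarrow>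
     ('f, 'r, 'i + 'c) fml set measure" where
  "borel_extension L C m \<nu> = (THE N. regular_borel_prob (Sm_topology L C m) N \<and>
     (\<forall>\<phi>\<in>pfmls L (univ C). measure N {q \<in> Sm L C m. \<phi> \<in> q} = \<nu> \<phi>))"

text \<open>\<open>h b (tp(\<sigma>(m)/C)) = tp(\<sigma>\<^sup>-\<^sup>1(b)/M)\<close> for automorphisms \<open>\<sigma>\<close> of the bigger monster model \<open>C'\<close>.\<close>

definition h ::
  "('f, 'r) lang \<Rightarrow> ('f, 'r, 'c) struct \<Rightarrow> ('f, 'r, 'c) struct \<Rightarrow> ('f, 'r, 'c) struct \<Rightarrow>
     ('i \<Rightarrow> 'c) \<Rightarrow> ('i \<Rightarrow> 'c) \<Rightarrow> ('f, 'r, 'i + 'c) fml set \<Rightarrow> ('f, 'r, 'i + 'c) fml set" where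
  "h L C C' M m b q = (THE r. \<exists>\<sigma>\<in>Aut L C'.
     tp L C' (univ C) (\<sigma> \<circ> m) = q \<and> r = tp L C' (univ M) (inv_into (univ C') \<sigma> \<circ> b))"

definition F ::
  "('f, 'r) lang \<Rightarrow> ('f, 'r, 'c) struct \<Rightarrow> ('f, 'r, 'c) struct \<Rightarrow>
     (('f, 'r, 'i + 'c) fml \<Rightarrow> real) \<Rightarrow> ('f, 'r, 'i + 'i) fml \<Rightarrow>
     ('f, 'r, 'i + 'c) fml set \<Rightarrow> real" where
  "F L C M \<mu> \<phi> q = (THE r. \<exists>b. range b \<subseteq> univ C \<and> tp L C (univ M) b = q \<and> r = \<mu> (inst \<phi> b))"

text \<open>
  Every \<open>L(C)\<close>-formula in \<open>y\<close> has the form \<open>\<phi>(b;y)\<close> when the index type is infinite, but not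
  uniquely, so the convolution is given by its defining equation; off the \<open>L(C)\<close>-formulas
  its value is set to \<open>0\<close>.
\<close>

definition conv ::
  "('f, 'r) lang \<Rightarrow> ('f, 'r, 'c) struct \<Rightarrow> ('f, 'r, 'c) struct \<Rightarrow> ('f, 'r, 'c) struct \<Rightarrow>
     ('i \<Rightarrow> 'c) \<Rightarrow> (('f, 'r, 'i + 'c) fml \<Rightarrow> real) \<Rightarrow> (('f, 'r, 'i + 'c) fml \<Rightarrow> real) \<Rightarrow>
     (('f, 'r, 'i + 'c) fml \<Rightarrow> real)" where
  "conv L C C' M m \<mu> \<nu> = (THE \<rho>.
     (\<forall>\<phi>\<in>fmls L. \<forall>b. range b \<subseteq> univ C \<longrightarrow>
        \<rho> (inst \<phi> b) =
          (\<integral>q. F L C M \<mu> \<phi> q \<partial>distr (borel_extension L C m \<nu>)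
                                 (borel_of (type_topology L C (univ M))) (h L C C' M m b))) \<and>
     (\<forall>\<psi>. \<psi> \<notin> pfmls L (univ C) \<longrightarrow> \<rho> \<psi> = 0))"

end

theory Submission
  imports Defs "HOL-Real_Asymp.Real_Asymp" "HOL-Library.Countable_Set_Type"
begin

text \<open>
  Let \<open>(h\<^sub>b)\<^sub>*\<beta>\<close> be the pushforward of \<open>\<beta>\<close> to the space \<open>S\<^sub>x(M)\<close>, which has a countable clopen base. On a basic
  clopen set \<open>[\<theta>(x, m)]\<close> it has the value \<open>\<beta>(\<theta>(b, y))\<close>. Comparing on clopen sets, the pushforward of
  \<open>\<mu> * \<nu>\<close> is therefore the mixture of the measures \<open>(h\<^sub>e)\<^sub>*\<mu>\<close>, where \<open>tp(e/M)\<close> is distributed according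
  to \<open>(h\<^sub>b)\<^sub>*\<nu>\<close>, and integrating \<open>F\<^sub>p\<close> against this mixture is associativity. The point is that all the
  functions \<open>F\<close> involved are Borel. For an \<open>M\<close>-invariant type this follows by counting the alternations
  of \<open>\<phi>(b; y)\<close> along a Morley sequence. An \<open>M\<close>-invariant measure is, for each \<open>\<phi>\<close>, a uniform limit of
  averages of types in its support (a VC theorem for finite families, followed by compactness), and these
  types are \<open>M\<close>-invariant: along a Morley sequence of a coheir of \<open>tp(b/M)\<close> the formulas \<open>\<phi>(d\<^sub>i; y)\<close> pairwise
  differ by a constant measure, which the approximation forces to be zero.
\<close>

section \<open>Uniform laws of large numbers for families of finite VC dimension\<close>

text \<open>Every notion in the statement is a definite description and needs existence and
  uniqueness before it can be computed: \<open>borel_extension\<close> through regularity on a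
  compact space with a clopen base, \<open>h\<close> through saturation and homogeneity of the
  bigger monster, \<open>F\<close> through invariance, and \<open>conv\<close> because \<phi>(b; y)
  may be written with different \<phi> and b. The last point is settled for each fixed q: an
  automorphism of C turns the integrand into the value of the left factor at a moved formula, so
  identities between formulas pass under the integral. The shape of the approximation is dictated by
  compactness. Sampling works for finite sets of formulas, and n-tuples of types have an ultralimit
  only if n does not depend on the finite set. Hence the chain from counting traces to
  symmetrization, whose bound involves only \<epsilon> and the dimension. The sampled types contain
  only formulas of positive measure, so that no null symmetric difference can belong to them; this
  is how they inherit invariance.\<close>

definition shatters :: "'a set set \<Rightarrow> 'a set \<Rightarrow> bool" where
  "shatters \<F> S \<longleftrightarrow> (\<forall>T\<subseteq>S. \<exists>A\<in>\<F>. A \<inter> S = T)"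

lemma shatters_mono: "shatters \<F> S \<Longrightarrow> \<F> \<subseteq> \<G> \<Longrightarrow> shatters \<G> S"
  unfolding shatters_def by (meson subsetD)

lemma shattersD: "shatters \<F> S \<Longrightarrow> T \<subseteq> S \<Longrightarrow> \<exists>A\<in>\<F>. A \<inter> S = T"
  unfolding shatters_def by simp

lemma shatters_subset: "shatters \<F> S \<Longrightarrow> T \<subseteq> S \<Longrightarrow> shatters \<F> T"
  unfolding shatters_def
proof (intro allI impI)
  fix U assume *: "\<forall>T\<subseteq>S. \<exists>A\<in>\<F>. A \<inter> S = T" "T \<subseteq> S" "U \<subseteq> T"
  then obtain A where "A \<in> \<F>" "A \<inter> S = U" by (meson order_trans)
  then show "\<exists>A\<in>\<F>. A \<inter> T = U" using * by (intro bexI[of _ A]) auto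
qed

text \<open>Pajor's form of Sauer-Shelah, by induction on the ground set. The family splits at x
  into the members without x and the traces of those with x. A set shattered by either half is
  shattered by the family; a set shattered by both is shattered once more after x is adjoined, which
  pays for its being counted twice.\<close>

lemma card_le_shattered:
  assumes "finite X" "\<F> \<subseteq> Pow X"
  shows "card \<F> \<le> card {S. S \<subseteq> X \<and> shatters \<F> S}"
  using assms
proof (induction X arbitrary: \<F> rule: finite_induct)
  case empty
  then have "\<F> = {} \<or> \<F> = {{}}" by auto
  then show ?case
  proof
    assume "\<F> = {{}}"
    then have "{S. S \<subseteq> {} \<and> shatters \<F> S} = {{}}" by (auto simp: shatters_def)
    then show ?thesis using \<open>\<F> = {{}}\<close> by simp
  qed simp
next
  case (insert x X)
  define F0 where "F0 = {A\<in>\<F>. x \<notin> A}"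
  define F1 where "F1 = (\<lambda>A. A - {x}) ` {A\<in>\<F>. x \<in> A}"
  have F0: "F0 \<subseteq> Pow X" and F1: "F1 \<subseteq> Pow X"
    using insert.prems by (auto simp: F0_def F1_def)
  have finF: "finite \<F>" using insert.prems insert.hyps by (meson finite_Pow_iff finite_insert finite_subset)
  have "inj_on (\<lambda>A. A - {x}) {A\<in>\<F>. x \<in> A}"
    by (rule inj_onI) blast
  then have c1: "card F1 = card {A\<in>\<F>. x \<in> A}" unfolding F1_def by (rule card_image)
  have "\<F> = F0 \<union> {A\<in>\<F>. x \<in> A}" by (auto simp: F0_def)
  then have "card \<F> = card (F0 \<union> {A\<in>\<F>. x \<in> A})" by (rule arg_cong)
  also have "\<dots> = card F0 + card {A\<in>\<F>. x \<in> A}"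
    using finF by (intro card_Un_disjoint) (auto simp: F0_def)
  finally have c: "card \<F> = card F0 + card F1" using c1 by simp
  define S0 where "S0 = {S. S \<subseteq> X \<and> shatters F0 S}"
  define S1 where "S1 = {S. S \<subseteq> X \<and> shatters F1 S}"
  have fin: "finite S0" "finite S1" using insert.hyps by (auto simp: S0_def S1_def)
  define R where "R = {S. S \<subseteq> insert x X \<and> shatters \<F> S}"
  have finR: "finite R" using insert.hyps by (auto simp: R_def)
  have sub1: "S0 \<union> S1 \<subseteq> R"
  proof
    fix S assume "S \<in> S0 \<union> S1"
    then show "S \<in> R"
    proof
      assume "S \<in> S0" then show ?thesis
        by (auto simp: S0_def R_def F0_def intro: shatters_mono)
    next
      assume S: "S \<in> S1"
      have "shatters \<F> S" unfolding shatters_def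
      proof (intro allI impI)
        fix T assume "T \<subseteq> S"
        then obtain B where "B \<in> F1" "B \<inter> S = T" using S shattersD[of F1 S T] by (auto simp: S1_def)
        then obtain A where "A \<in> \<F>" "B = A - {x}" by (auto simp: F1_def)
        moreover have "x \<notin> S" using S insert.hyps by (auto simp: S1_def)
        ultimately have "A \<inter> S = T" using \<open>B \<inter> S = T\<close> by blast
        then show "\<exists>A\<in>\<F>. A \<inter> S = T" using \<open>A \<in> \<F>\<close> by blast
      qed
      then show ?thesis using S by (auto simp: S1_def R_def)
    qed
  qed
  have sub2: "insert x ` (S0 \<inter> S1) \<subseteq> R"
  proof
    fix S' assume "S' \<in> insert x ` (S0 \<inter> S1)"
    then obtain S where S: "S \<in> S0" "S \<in> S1" "S' = insert x S" by auto
    have xS: "x \<notin> S" "S \<subseteq> X" using S insert.hyps by (auto simp: S1_def)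
    have "shatters \<F> S'" unfolding shatters_def
    proof (intro allI impI)
      fix T assume T: "T \<subseteq> S'"
      show "\<exists>A\<in>\<F>. A \<inter> S' = T"
      proof (cases "x \<in> T")
        case True
        have "T - {x} \<subseteq> S" using T S(3) by blast
        then obtain B where "B \<in> F1" "B \<inter> S = T - {x}" using S(2) shattersD[of F1 S "T - {x}"] by (auto simp: S1_def)
        then obtain A where "A \<in> \<F>" "x \<in> A" "B = A - {x}" by (auto simp: F1_def)
        then have "A \<inter> insert x S = insert x (B \<inter> S)" using xS by blast
        also have "\<dots> = T" using True \<open>B \<inter> S = T - {x}\<close> by blast
        finally show ?thesis using \<open>A \<in> \<F>\<close> S(3) by blast
      next
        case False
        then have "T \<subseteq> S" using T S(3) by blast
        then obtain A where "A \<in> F0" "A \<inter> S = T" using S(1) shattersD[of F0 S T] by (auto simp: S0_def)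
        then have "A \<in> \<F>" "x \<notin> A" by (auto simp: F0_def)
        then have "A \<inter> S' = T" using \<open>A \<inter> S = T\<close> S(3) by blast
        then show ?thesis using \<open>A \<in> \<F>\<close> by blast
      qed
    qed
    then show "S' \<in> R" using S by (auto simp: S1_def R_def)
  qed
  have disj: "(S0 \<union> S1) \<inter> insert x ` (S0 \<inter> S1) = {}"
    using insert.hyps by (auto simp: S0_def S1_def)
  have inj: "inj_on (insert x) (S0 \<inter> S1)"
  proof (rule inj_onI)
    fix S T assume "S \<in> S0 \<inter> S1" "T \<in> S0 \<inter> S1" and eq: "insert x S = insert x T"
    then have "x \<notin> S" "x \<notin> T" using insert.hyps by (auto simp: S0_def)
    then show "S = T" using eq by (simp add: insert_ident)
  qed
  have "card \<F> \<le> card S0 + card S1"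
    using c insert.IH[OF F0] insert.IH[OF F1] by (simp add: S0_def S1_def)
  also have "\<dots> = card (S0 \<union> S1) + card (S0 \<inter> S1)" using fin by (rule card_Un_Int)
  also have "\<dots> = card (S0 \<union> S1) + card (insert x ` (S0 \<inter> S1))" using inj by (simp add: card_image)
  also have "\<dots> = card ((S0 \<union> S1) \<union> insert x ` (S0 \<inter> S1))"
    using fin disj by (subst card_Un_disjoint) auto
  also have "\<dots> \<le> card R" using finR sub1 sub2 by (intro card_mono) auto
  finally show ?case by (simp add: R_def)
qed

text \<open>A set of fewer than d elements is read off from a map of {..<d} into X together with a
  padding value \<open>None\<close>. The crude polynomial is enough, as only its logarithm
  matters.\<close>

lemma card_small_subsets:
  assumes "finite X"
  shows "card {S. S \<subseteq> X \<and> card S < d} \<le> (card X + 1) ^ d"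
proof -
  define G where "G = PiE {..<d} (\<lambda>_. insert None (Some ` X))"
  have finG: "finite G" using assms by (auto simp: G_def intro!: finite_PiE)
  have "{S. S \<subseteq> X \<and> card S < d} \<subseteq> (\<lambda>f. {x. Some x \<in> f ` {..<d}}) ` G"
  proof
    fix S assume "S \<in> {S. S \<subseteq> X \<and> card S < d}"
    then have S: "S \<subseteq> X" "card S < d" by auto
    have "finite S" using S assms finite_subset by blast
    then obtain g where g: "bij_betw g {0..<card S} S" using ex_bij_betw_nat_finite by blast
    define f where "f = (\<lambda>i\<in>{..<d}. if i < card S then Some (g i) else None)"
    have gi: "g i \<in> S" if "i < card S" for i using g that by (auto simp: bij_betw_def)
    have "f \<in> G" using S gi by (simp add: G_def f_def PiE_iff extensional_def) (metis imageI subsetD)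
    moreover have "S = {x. Some x \<in> f ` {..<d}}"
    proof (rule set_eqI)
      fix x show "x \<in> S \<longleftrightarrow> x \<in> {x. Some x \<in> f ` {..<d}}"
      proof
        assume "x \<in> S"
        then obtain i where "i < card S" "x = g i" using g by (metis (no_types, lifting) atLeastLessThan_iff bij_betw_def imageE)
        then have "Some x = f i" "i < d" using S by (auto simp: f_def)
        then show "x \<in> {x. Some x \<in> f ` {..<d}}" by auto
      next
        assume "x \<in> {x. Some x \<in> f ` {..<d}}"
        then show "x \<in> S" by (auto simp: f_def gi split: if_splits)
      qed
    qed
    ultimately show "S \<in> (\<lambda>f. {x. Some x \<in> f ` {..<d}}) ` G" by blast
  qed
  then have "card {S. S \<subseteq> X \<and> card S < d} \<le> card G"
    using finG by (meson card_image_le card_mono finite_imageI le_trans)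
  also have "card G = (card X + 1) ^ d"
    using assms by (simp add: G_def card_PiE card_image card_insert_if image_iff)
  finally show ?thesis .
qed

text \<open>What the traces on Y shatter is shattered by the family itself, hence has fewer than d
  elements; Pajor's inequality bounds the number of traces by the number of such sets.\<close>

lemma sauer_shelah:
  assumes "finite Y" and no: "\<And>S. S \<subseteq> Y \<Longrightarrow> card S = d \<Longrightarrow> \<not> shatters \<F> S"
  shows "card ((\<lambda>A. A \<inter> Y) ` \<F>) \<le> (card Y + 1) ^ d"
proof -
  define \<G> where "\<G> = (\<lambda>A. A \<inter> Y) ` \<F>"
  have "card \<G> \<le> card {S. S \<subseteq> Y \<and> shatters \<G> S}"
    using assms by (intro card_le_shattered) (auto simp: \<G>_def)
  also have "\<dots> \<le> card {S. S \<subseteq> Y \<and> card S < d}"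
  proof (rule card_mono)
    show "{S. S \<subseteq> Y \<and> shatters \<G> S} \<subseteq> {S. S \<subseteq> Y \<and> card S < d}"
    proof clarify
      fix S assume S: "S \<subseteq> Y" "shatters \<G> S"
      have "shatters \<F> S" unfolding shatters_def
      proof (intro allI impI)
        fix T assume "T \<subseteq> S"
        then obtain B where B: "B \<in> \<G>" "B \<inter> S = T" using shattersD[OF S(2)] by metis
        then obtain A where A: "A \<in> \<F>" "B = A \<inter> Y" by (auto simp: \<G>_def)
        then have "A \<inter> S = T" using B S(1) by blast
        then show "\<exists>A\<in>\<F>. A \<inter> S = T" using A by blast
      qed
      show "card S < d"
      proof (rule ccontr)
        assume "\<not> card S < d"
        then obtain T where "T \<subseteq> S" "card T = d" by (meson not_less obtain_subset_with_card_n)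
        then show False using no[of T] shatters_subset[OF \<open>shatters \<F> S\<close>] S by auto
      qed
    qed
  qed (use assms in auto)
  also have "\<dots> \<le> (card Y + 1) ^ d" using assms by (intro card_small_subsets)
  finally show ?thesis by (simp add: \<G>_def)
qed

section \<open>Rademacher averages and symmetrization\<close>

lemma exp_add_exp_minus_le:
  fixes x :: real
  assumes "\<bar>x\<bar> \<le> 1"
  shows "exp x + exp (-x) \<le> 2 * exp (x\<^sup>2)"
proof -
  \<comment> \<open>The exponent y^2 in place of the sharp y^2/2 leaves room for bounding both
    exponentials by quadratics.\<close>
  have *: "exp y + exp (-y) \<le> 2 * exp (y\<^sup>2)" if "0 \<le> y" "y \<le> 1" for y :: real
  proof -
    have "exp y \<le> 1 + y + y\<^sup>2" using that by (intro exp_bound) auto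
    moreover have "exp (-y) \<le> 1 - y + y\<^sup>2"
    proof -
      have "exp (-y) = 1 / exp y" by (simp add: exp_minus inverse_eq_divide)
      also have "\<dots> \<le> 1 / (1 + y)" using that exp_ge_add_one_self[of y] by (intro divide_left_mono) auto
      also have "\<dots> \<le> 1 - y + y\<^sup>2"
      proof -
        have "(1 - y + y\<^sup>2) * (1 + y) = 1 + y^3" by (simp add: algebra_simps power2_eq_square power3_eq_cube)
        then have "1 \<le> (1 - y + y\<^sup>2) * (1 + y)" using that by simp
        then show ?thesis using that by (simp add: divide_le_eq)
      qed
      finally show ?thesis .
    qed
    moreover have "1 + y\<^sup>2 \<le> exp (y\<^sup>2)" by simp
    ultimately show ?thesis by linarith
  qed
  show ?thesis using *[of x] *[of "-x"] assms by (cases "x \<ge> 0") auto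
qed

text \<open>The logarithm is linearised through \<open>t \<le> (ln K + exp (l * t) / K - 1) / l\<close>,
  so that no convexity is needed to bound the mean of the maximum.\<close>

lemma massart:
  fixes V :: "(nat \<Rightarrow> real) set" and l :: real
  assumes V: "finite V" "V \<noteq> {}" and bd: "\<And>v i. v \<in> V \<Longrightarrow> i < n \<Longrightarrow> \<bar>v i\<bar> \<le> 1"
    and l: "0 < l" "l \<le> 1"
  shows "(\<Sum>s\<in>PiE {..<n} (\<lambda>_. {-1,1}). Max ((\<lambda>v. \<bar>\<Sum>i<n. s i * v i\<bar>) ` V))
           \<le> 2 ^ n * ((ln (2 * card V) + n * l\<^sup>2) / l)"
proof -
  define \<Sigma> where "\<Sigma> = PiE {..<n} (\<lambda>_. {-1,1::real})"
  have fin: "finite \<Sigma>" by (auto simp: \<Sigma>_def intro!: finite_PiE)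
  have card: "card \<Sigma> = 2 ^ n" by (simp add: \<Sigma>_def card_PiE numeral_2_eq_2)
  \<comment> \<open>K bounds the mean over all signs of the sum of exp (l * u) over the signed sums
    u and their negatives: 2 * \<open>card V\<close> terms, each of mean at most exp (n *
    l^2).\<close>
  define K where "K = 2 * card V * exp (n * l\<^sup>2)"
  have cV: "card V > 0" using V by (simp add: card_gt_0_iff)
  have K: "K > 0" using cV by (simp add: K_def)
  define G where "G s = Max ((\<lambda>v. \<bar>\<Sum>i<n. s i * v i\<bar>) ` V)" for s :: "nat \<Rightarrow> real"
  have Gpt: "G s \<le> (ln K + exp (l * G s) / K - 1) / l" for s
  proof -
    have "ln (exp (l * G s) / K) \<le> exp (l * G s) / K - 1" using K by (intro ln_le_minus_one) auto
    then have "l * G s - ln K \<le> exp (l * G s) / K - 1" using K by (simp add: ln_div)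
    then show ?thesis using l by (simp add: pos_le_divide_eq mult.commute)
  qed
  have lin: "(\<Sum>s\<in>\<Sigma>. exp (\<Sum>i<n. s i * (c * v i))) \<le> (2 * exp (l\<^sup>2)) ^ n" 
    if v: "v \<in> V" and c: "c = l \<or> c = -l" for v c
  proof -
    have "(\<Sum>s\<in>\<Sigma>. exp (\<Sum>i<n. s i * (c * v i))) = (\<Sum>s\<in>\<Sigma>. \<Prod>i<n. exp (s i * (c * v i)))"
      by (simp add: exp_sum)
    \<comment> \<open>Independence of the signs: the sum over the cube of a product of
      one-coordinate functions factorizes.\<close>
    also have "\<dots> = (\<Prod>i<n. \<Sum>t\<in>{-1,1}. exp (t * (c * v i)))"
      unfolding \<Sigma>_def by (rule prod_sum_PiE[symmetric]) auto
    also have "\<dots> \<le> (\<Prod>i<n. 2 * exp (l\<^sup>2))"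
    proof (rule prod_mono, safe)
      fix i assume "i < n"
      then have b: "\<bar>v i\<bar> \<le> 1" using bd v by auto
      have "\<bar>c * v i\<bar> \<le> l" using b c l by (auto simp: abs_mult intro: mult_left_le)
      then have "\<bar>c * v i\<bar> \<le> 1" and sq: "(c * v i)\<^sup>2 \<le> l\<^sup>2"
        using l by (linarith, metis abs_le_square_iff abs_of_pos)
      then have "exp (c * v i) + exp (-(c * v i)) \<le> 2 * exp ((c * v i)\<^sup>2)"
        by (intro exp_add_exp_minus_le)
      also have "\<dots> \<le> 2 * exp (l\<^sup>2)" using sq by simp
      finally show "(\<Sum>t\<in>{-1,1}. exp (t * (c * v i))) \<le> 2 * exp (l\<^sup>2)" by simp
    qed (auto intro: sum_nonneg)
    finally show ?thesis by simp
  qed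
  have "(\<Sum>s\<in>\<Sigma>. exp (l * G s)) \<le> (\<Sum>s\<in>\<Sigma>. \<Sum>v\<in>V. exp (\<Sum>i<n. s i * (l * v i)) + exp (\<Sum>i<n. s i * (-l * v i)))"
  proof (rule sum_mono)
    fix s
    have "G s \<in> (\<lambda>v. \<bar>\<Sum>i<n. s i * v i\<bar>) ` V" unfolding G_def using V by (intro Max_in) auto
    then obtain v where v: "v \<in> V" "G s = \<bar>\<Sum>i<n. s i * v i\<bar>" by auto
    define u where "u = (\<Sum>i<n. s i * v i)"
    have "exp (l * \<bar>u\<bar>) \<le> exp (l * u) + exp (-l * u)"
      by (cases "u \<ge> 0") (auto simp: abs_if)
    also have "\<dots> = exp (\<Sum>i<n. s i * (l * v i)) + exp (\<Sum>i<n. s i * (-l * v i))"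
      by (simp add: u_def sum_distrib_left mult.left_commute sum_negf)
    also have "exp (\<Sum>i<n. s i * (l * v i)) + exp (\<Sum>i<n. s i * (-l * v i)) \<le>
       (\<Sum>v\<in>V. exp (\<Sum>i<n. s i * (l * v i)) + exp (\<Sum>i<n. s i * (-l * v i)))"
      using V v by (intro member_le_sum[where f="\<lambda>v. exp (\<Sum>i<n. s i * (l * v i)) + exp (\<Sum>i<n. s i * (-l * v i))"]) (auto intro: add_nonneg_nonneg)
    finally show "exp (l * G s) \<le> (\<Sum>v\<in>V. exp (\<Sum>i<n. s i * (l * v i)) + exp (\<Sum>i<n. s i * (-l * v i)))"
      by (simp add: v u_def)
  qed
  also have "\<dots> = (\<Sum>v\<in>V. (\<Sum>s\<in>\<Sigma>. exp (\<Sum>i<n. s i * (l * v i))) + (\<Sum>s\<in>\<Sigma>. exp (\<Sum>i<n. s i * (-l * v i))))"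
    by (subst sum.swap) (simp add: sum.distrib)
  also have "\<dots> \<le> (\<Sum>v\<in>V. (2 * exp (l\<^sup>2)) ^ n + (2 * exp (l\<^sup>2)) ^ n)"
    by (intro sum_mono add_mono lin) auto
  also have "\<dots> = 2 ^ n * K"
    by (simp add: K_def power_mult_distrib exp_of_nat_mult)
  finally have E: "(\<Sum>s\<in>\<Sigma>. exp (l * G s)) \<le> 2 ^ n * K" .
  have "(\<Sum>s\<in>\<Sigma>. G s) \<le> (\<Sum>s\<in>\<Sigma>. (ln K + exp (l * G s) / K - 1) / l)"
    using Gpt by (intro sum_mono)
  also have "\<dots> = ((ln K - 1) * 2 ^ n + (\<Sum>s\<in>\<Sigma>. exp (l * G s)) / K) / l"
    by (simp add: sum_divide_distrib[symmetric] sum.distrib sum_subtractf card algebra_simps)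
  also have "\<dots> \<le> ((ln K - 1) * 2 ^ n + 2 ^ n) / l"
  proof -
    have "(\<Sum>s\<in>\<Sigma>. exp (l * G s)) / K \<le> 2 ^ n" using E K by (simp add: divide_le_eq)
    then show ?thesis using l by (intro divide_right_mono) auto
  qed
  also have "\<dots> = 2 ^ n * (ln K / l)" using l by (simp add: field_simps)
  also have "ln K = ln (2 * card V) + n * l\<^sup>2"
    using cV by (simp add: K_def ln_mult)
  finally show ?thesis by (simp add: \<Sigma>_def G_def)
qed

text \<open>The exact mean is replaced by the count in an independent second sample. Exchanging the
  two samples at the coordinates of negative sign preserves the product weight, so signs may be
  inserted without changing the mean. For each fixed pair of samples there remains an average over
  signs, which is what the last hypothesis controls. A mean of at most c forces some sample with
  deviation at most c.\<close>

lemma symmetrization: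
  fixes w :: "'a \<Rightarrow> real" and n :: nat
  assumes \<Omega>: "finite \<Omega>" and w: "\<And>x. x \<in> \<Omega> \<Longrightarrow> 0 \<le> w x" "sum w \<Omega> = 1"
    and \<F>: "finite \<F>" "\<F> \<noteq> {}"
  defines "X \<equiv> PiE {..<n} (\<lambda>_. \<Omega>)"
    and "W \<equiv> \<lambda>x. \<Prod>i<n. w (x i)"
  assumes bound: "\<And>x x'. x \<in> X \<Longrightarrow> x' \<in> X \<Longrightarrow>
     (\<Sum>s\<in>PiE {..<n} (\<lambda>_. {-1,1}). Max ((\<lambda>A. \<bar>\<Sum>i<n. s i * (indicator A (x i) - indicator A (x' i))\<bar>) ` \<F>)) \<le> 2 ^ n * c"
  shows "\<exists>x\<in>X. \<forall>A\<in>\<F>. \<bar>(\<Sum>i<n. indicator A (x i)) - n * sum w (A \<inter> \<Omega>)\<bar> \<le> c"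
proof -
  define \<Sigma> where "\<Sigma> = PiE {..<n} (\<lambda>_. {-1,1::real})"
  have cardS: "card \<Sigma> = 2 ^ n" by (simp add: \<Sigma>_def card_PiE numeral_2_eq_2)
  have finX: "finite X" using \<Omega> by (auto simp: X_def intro!: finite_PiE)
  have W0: "W x \<ge> 0" if "x \<in> X" for x
    unfolding W_def using that w by (intro prod_nonneg) (auto simp: X_def)
  have W1: "sum W X = 1"
    unfolding W_def X_def using \<Omega> w by (subst prod_sum_PiE[symmetric]) auto
  have mean1: "(\<Sum>x\<in>X. W x * indicator A (x j)) = sum w (A \<inter> \<Omega>)" if "j < n" for A j
  proof -
    have "(\<Sum>x\<in>X. W x * indicator A (x j)) = (\<Sum>x\<in>X. \<Prod>i<n. w (x i) * (if i = j then indicator A (x i) else 1))"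
      using that by (simp add: W_def prod.distrib)
    also have "\<dots> = (\<Prod>i<n. \<Sum>y\<in>\<Omega>. w y * (if i = j then indicator A y else 1))"
      unfolding X_def using \<Omega> by (intro prod_sum_PiE[symmetric]) auto
    also have "\<dots> = (\<Prod>i<n. if i = j then sum w (A \<inter> \<Omega>) else 1)"
      using w by (intro prod.cong refl) (auto simp: indicator_def sum.inter_restrict[OF \<Omega>] Int_commute[of A] intro!: sum.cong)
    also have "\<dots> = sum w (A \<inter> \<Omega>)" using that by simp
    finally show ?thesis .
  qed
  have mean: "(\<Sum>x\<in>X. W x * (\<Sum>i<n. indicator A (x i))) = n * sum w (A \<inter> \<Omega>)" for A
  proof -
    have "(\<Sum>x\<in>X. W x * (\<Sum>i<n. indicator A (x i))) = (\<Sum>i<n. \<Sum>x\<in>X. W x * indicator A (x i))"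
      by (subst sum.swap) (simp add: sum_distrib_left)
    then show ?thesis by (simp add: mean1)
  qed
  define D where "D x = Max ((\<lambda>A. \<bar>(\<Sum>i<n. indicator A (x i)) - n * sum w (A \<inter> \<Omega>)\<bar>) ` \<F>)" for x
  define G where "G s x x' = Max ((\<lambda>A. \<bar>\<Sum>i<n. s i * (indicator A (x i) - indicator A (x' i))\<bar>) ` \<F>)"
    for s :: "nat \<Rightarrow> real" and x x' :: "nat \<Rightarrow> 'a"
  \<comment> \<open>The counts in the second sample average to the exact mean, so the deviation is
    an average of differences of two counts, and the maximum over the family may be taken
    inside.\<close>
  have D_le: "D x \<le> (\<Sum>x'\<in>X. W x' * G (\<lambda>_. 1) x x')" for x
  proof -
    have "\<bar>(\<Sum>i<n. indicator A (x i)) - n * sum w (A \<inter> \<Omega>)\<bar> \<le> (\<Sum>x'\<in>X. W x' * G (\<lambda>_. 1) x x')" if A: "A \<in> \<F>" for A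
    proof -
      have "(\<Sum>i<n. indicator A (x i)) - n * sum w (A \<inter> \<Omega>) = 
            (\<Sum>x'\<in>X. W x' * (\<Sum>i<n. 1 * (indicator A (x i) - indicator A (x' i))))"
        unfolding mean[symmetric]
        by (simp add: sum_subtractf right_diff_distrib sum_distrib_right[symmetric] W1)
      also have "\<bar>\<dots>\<bar> \<le> (\<Sum>x'\<in>X. W x' * \<bar>\<Sum>i<n. 1 * (indicator A (x i) - indicator A (x' i))\<bar>)"
        using W0 by (intro order_trans[OF sum_abs] sum_mono) (auto simp: abs_mult)
      also have "\<dots> \<le> (\<Sum>x'\<in>X. W x' * G (\<lambda>_. 1) x x')"
        unfolding G_def using W0 \<F> A by (intro sum_mono mult_left_mono Max_ge) auto
      finally show ?thesis .
    qed
    then show ?thesis unfolding D_def using \<F> by (intro Max.boundedI) auto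
  qed
  have swap: "(\<Sum>(x,x')\<in>X \<times> X. W x * W x' * G (\<lambda>_. 1) x x') = (\<Sum>(x,x')\<in>X \<times> X. W x * W x' * G s x x')"
    if s: "s \<in> \<Sigma>" for s
  proof -
    \<comment> \<open>Exchanges the coordinates at which s differs from 1. This is an involution on
      pairs of samples, and it turns signed differences into plain ones.\<close>
    define f where "f = (\<lambda>(x::nat \<Rightarrow> 'a, x'). ((\<lambda>i. if s i = 1 then x i else x' i), (\<lambda>i. if s i = 1 then x' i else x i)))"
    have ff: "f (f p) = p" for p by (cases p) (auto simp: f_def)
    have fX: "f p \<in> X \<times> X" if "p \<in> X \<times> X" for p
      using that by (cases p) (auto simp: f_def X_def PiE_def Pi_def extensional_def)
    have sg: "s i = 1 \<or> s i = -1" if "i < n" for i using s that by (auto simp: \<Sigma>_def dest: PiE_mem)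
    show ?thesis
    proof (rule sum.reindex_bij_witness[where i = f and j = f])
      fix p assume "p \<in> X \<times> X"
      show "f (f p) = p" "f p \<in> X \<times> X" using ff fX \<open>p \<in> X \<times> X\<close> by auto
      show "f (f p) = p" "f p \<in> X \<times> X" using ff fX \<open>p \<in> X \<times> X\<close> by auto
      obtain x x' where p: "p = (x,x')" by (cases p)
      define y y' where y: "y = fst (f p)" "y' = snd (f p)"
      have "W y * W y' = W x * W x'"
        unfolding W_def prod.distrib[symmetric] by (intro prod.cong refl) (auto simp: y f_def p)
      moreover have "(\<Sum>i<n. s i * (indicator A (y i) - indicator A (y' i))) = 
          (\<Sum>i<n. 1 * (indicator A (x i) - indicator A (x' i)))" for A
        by (intro sum.cong refl) (use sg in \<open>force simp: y f_def p\<close>)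
      ultimately show "(case f p of (x, x') \<Rightarrow> W x * W x' * G s x x') = (case p of (x, x') \<Rightarrow> W x * W x' * G (\<lambda>_. 1) x x')"
        by (simp add: y case_prod_beta p G_def)
    qed
  qed
  have WW: "(\<Sum>(x,x')\<in>X \<times> X. W x * W x') = 1"
    using W1 by (simp add: sum.cartesian_product[symmetric] sum_distrib_left[symmetric])
  have "(\<Sum>x\<in>X. W x * D x) \<le> (\<Sum>x\<in>X. W x * (\<Sum>x'\<in>X. W x' * G (\<lambda>_. 1) x x'))"
    using W0 D_le by (intro sum_mono mult_left_mono) auto
  also have "\<dots> = (\<Sum>(x,x')\<in>X \<times> X. W x * W x' * G (\<lambda>_. 1) x x')" (is "_ = ?S")
    by (simp add: sum_distrib_left sum.cartesian_product mult.assoc)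
  finally have 1: "(\<Sum>x\<in>X. W x * D x) \<le> ?S" .
  have "2 ^ n * ?S = (\<Sum>s\<in>\<Sigma>. ?S)" by (simp add: cardS)
  also have "\<dots> = (\<Sum>s\<in>\<Sigma>. (\<Sum>(x,x')\<in>X \<times> X. W x * W x' * G s x x'))"
    by (intro sum.cong refl swap)
  also have "\<dots> = (\<Sum>(x,x')\<in>X \<times> X. W x * W x' * (\<Sum>s\<in>\<Sigma>. G s x x'))"
    by (subst sum.swap) (simp add: sum_distrib_left case_prod_beta)
  also have "\<dots> \<le> (\<Sum>(x,x')\<in>X \<times> X. W x * W x' * (2 ^ n * c))"
    using bound W0 by (intro sum_mono) (auto simp: G_def \<Sigma>_def intro!: mult_left_mono)
  also have "\<dots> = 2 ^ n * c"
    using WW by (simp add: sum_distrib_right[symmetric] case_prod_beta)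
  finally have "?S \<le> c" by simp
  with 1 have 2: "(\<Sum>x\<in>X. W x * D x) \<le> c" by simp
  have "\<exists>x\<in>X. D x \<le> c"
  proof (rule ccontr)
    assume "\<not> ?thesis"
    then have gt: "D x > c" if "x \<in> X" for x using that by (auto simp: not_le)
    have "c = (\<Sum>x\<in>X. W x * c)" by (simp add: sum_distrib_right[symmetric] W1)
    also have "\<dots> < (\<Sum>x\<in>X. W x * D x)"
    proof (rule sum_strict_mono_ex1[OF finX])
      show "\<forall>x\<in>X. W x * c \<le> W x * D x" using gt W0 by (intro ballI mult_left_mono) (auto simp: less_imp_le)
      \<comment> \<open>Strictness needs a sample of nonzero weight, which exists since the weights
        sum to 1.\<close>
      have "\<exists>x\<in>X. W x \<noteq> 0" using W1 by (metis sum.neutral zero_neq_one)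
      then show "\<exists>x\<in>X. W x * c < W x * D x" using gt W0 by (metis less_eq_real_def mult_strict_left_mono)
    qed
    finally show False using 2 by simp
  qed
  then obtain x where x: "x \<in> X" "D x \<le> c" by auto
  have "\<bar>(\<Sum>i<n. indicator A (x i)) - n * sum w (A \<inter> \<Omega>)\<bar> \<le> c" if "A \<in> \<F>" for A
  proof -
    have "\<bar>(\<Sum>i<n. indicator A (x i)) - n * sum w (A \<inter> \<Omega>)\<bar> \<le> D x"
      unfolding D_def using that \<F> by (intro Max_ge) auto
    then show ?thesis using x by simp
  qed
  then show ?thesis using x by blast
qed

lemma log_polynomial_small:
  assumes "0 < (\<epsilon>::real)"
  shows "\<exists>n>0. ln (2 * (2 * real n + 1) ^ d) \<le> n * \<epsilon>\<^sup>2"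
proof -
  have "(\<lambda>n. ln (2 * (2 * real n + 1) ^ d) / n) \<longlonglongrightarrow> 0" by real_asymp
  then have "eventually (\<lambda>n. ln (2 * (2 * real n + 1) ^ d) / n < \<epsilon>\<^sup>2) sequentially"
    using assms by (intro order_tendstoD) auto
  with eventually_gt_at_top[of 0] have "eventually (\<lambda>n. n > 0 \<and> ln (2 * (2 * real n + 1) ^ d) / n < \<epsilon>\<^sup>2) sequentially"
    by eventually_elim auto
  then obtain n where "n > 0" "ln (2 * (2 * real n + 1) ^ d) / n < \<epsilon>\<^sup>2"
    using eventually_happens'[OF sequentially_bot] by blast
  then show ?thesis by (intro exI[of _ n]) (auto simp: divide_less_eq mult.commute)
qed

text \<open>The number n is chosen from \<epsilon> and d alone, before the finite probability space
  and the family. This uniformity is what later permits a limit over finite sets of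
  formulas.\<close>

theorem vc_approximation:
  assumes \<epsilon>: "0 < (\<epsilon>::real)"
  shows "\<exists>n::nat. n > 0 \<and> (\<forall>(\<Omega>::'a set) w \<F>. finite \<Omega> \<longrightarrow> (\<forall>x\<in>\<Omega>. 0 \<le> w x) \<longrightarrow> sum w \<Omega> = 1 \<longrightarrow> \<F> \<subseteq> Pow \<Omega> \<longrightarrow>
     (\<forall>S\<subseteq>\<Omega>. card S = d \<longrightarrow> \<not> shatters \<F> S) \<longrightarrow>
     (\<exists>x::nat \<Rightarrow> 'a. (\<forall>i<n. x i \<in> \<Omega>) \<and> (\<forall>A\<in>\<F>. \<bar>(\<Sum>i<n. of_bool (x i \<in> A)) / real n - sum w A\<bar> \<le> \<epsilon>)))"
proof -
  \<comment> \<open>\<open>massart\<close> needs l at most 1. Its two terms are each at most n * l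
    after division by l, and their sum 2 * n * l has to stay below n * \<epsilon>.\<close>
  define l where "l = min 1 (\<epsilon> / 2)"
  have l: "0 < l" "l \<le> 1" "l \<le> \<epsilon> / 2" using \<epsilon> by (auto simp: l_def)
  obtain n where n: "n > 0" "ln (2 * (2 * real n + 1) ^ d) \<le> n * l\<^sup>2" using log_polynomial_small[OF l(1)] by blast
  have "\<forall>(\<Omega>::'a set) w \<F>. finite \<Omega> \<longrightarrow> (\<forall>x\<in>\<Omega>. 0 \<le> w x) \<longrightarrow> sum w \<Omega> = 1 \<longrightarrow> \<F> \<subseteq> Pow \<Omega> \<longrightarrow>
     (\<forall>S\<subseteq>\<Omega>. card S = d \<longrightarrow> \<not> shatters \<F> S) \<longrightarrow>
     (\<exists>x::nat \<Rightarrow> 'a. (\<forall>i<n. x i \<in> \<Omega>) \<and> (\<forall>A\<in>\<F>. \<bar>(\<Sum>i<n. of_bool (x i \<in> A)) / real n - sum w A\<bar> \<le> \<epsilon>))"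
  proof (intro allI impI)
    fix \<Omega> :: "'a set" and w :: "'a \<Rightarrow> real" and \<F>
    assume \<Omega>: "finite \<Omega>" and w: "\<forall>x\<in>\<Omega>. 0 \<le> w x" "sum w \<Omega> = 1" and \<F>: "\<F> \<subseteq> Pow \<Omega>"
      and no: "\<forall>S\<subseteq>\<Omega>. card S = d \<longrightarrow> \<not> shatters \<F> S"
    have \<Omega>ne: "\<Omega> \<noteq> {}" using w by auto
    show "\<exists>x. (\<forall>i<n. x i \<in> \<Omega>) \<and> (\<forall>A\<in>\<F>. \<bar>(\<Sum>i<n. of_bool (x i \<in> A)) / n - sum w A\<bar> \<le> \<epsilon>)"
    proof (cases "\<F> = {}")
      case True
      then show ?thesis using \<Omega>ne by (intro exI[of _ "\<lambda>_. SOME x. x \<in> \<Omega>"]) (auto simp: some_in_eq)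
    next
      case False
      have fF: "finite \<F>" using \<F> \<Omega> by (meson finite_Pow_iff finite_subset)
      have bound: "(\<Sum>s\<in>PiE {..<n} (\<lambda>_. {-1,1}). Max ((\<lambda>A. \<bar>\<Sum>i<n. s i * (indicator A (x i) - indicator A (x' i))\<bar>) ` \<F>)) \<le> 2 ^ n * (n * \<epsilon>)"
        if x: "x \<in> PiE {..<n} (\<lambda>_. \<Omega>)" "x' \<in> PiE {..<n} (\<lambda>_. \<Omega>)" for x x'
      proof -
        define Y where "Y = x ` {..<n} \<union> x' ` {..<n}"
        have Y: "finite Y" "Y \<subseteq> \<Omega>" using x by (auto simp: Y_def)
        have cY: "card Y \<le> 2 * n"
          unfolding Y_def using card_image_le[of "{..<n}" x] card_image_le[of "{..<n}" x'] 
          by (intro order_trans[OF card_Un_le]) simp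
        define vec where "vec A = (\<lambda>i. if i < n then indicator A (x i) - indicator A (x' i) else (0::real))" for A
        define V where "V = vec ` \<F>"
        \<comment> \<open>Only the traces on the at most 2 * n points of both samples matter, and
          their number is polynomial in n.\<close>
        have "vec A = vec (A \<inter> Y)" for A by (auto simp: vec_def indicator_def Y_def fun_eq_iff)
        then have "V = vec ` ((\<lambda>A. A \<inter> Y) ` \<F>)" by (auto simp: V_def image_iff)
        then have "card V \<le> card ((\<lambda>A. A \<inter> Y) ` \<F>)" using fF by (simp add: card_image_le)
        also have "\<dots> \<le> (card Y + 1) ^ d" using Y no by (intro sauer_shelah) auto
        also have "\<dots> \<le> (2 * n + 1) ^ d" using cY by (intro power_mono) auto
        finally have "card V \<le> (2 * n + 1) ^ d" .
        then have cV: "real (card V) \<le> (2 * real n + 1) ^ d"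
          by (metis (mono_tags, lifting) of_nat_1 of_nat_add of_nat_le_iff of_nat_mult of_nat_numeral of_nat_power)
        have V: "finite V" "V \<noteq> {}" using fF False by (auto simp: V_def)
        have cV0: "card V > 0" using V by (simp add: card_gt_0_iff)
        have "(\<Sum>s\<in>PiE {..<n} (\<lambda>_. {-1,1}). Max ((\<lambda>A. \<bar>\<Sum>i<n. s i * (indicator A (x i) - indicator A (x' i))\<bar>) ` \<F>)) =
              (\<Sum>s\<in>PiE {..<n} (\<lambda>_. {-1,1}). Max ((\<lambda>v. \<bar>\<Sum>i<n. s i * v i\<bar>) ` V))"
          by (simp add: V_def image_image vec_def cong: sum.cong_simp)
        also have "\<dots> \<le> 2 ^ n * ((ln (2 * card V) + n * l\<^sup>2) / l)"
          using l by (intro massart V) (auto simp: V_def vec_def indicator_def)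
        also have "\<dots> \<le> 2 ^ n * ((n * l\<^sup>2 + n * l\<^sup>2) / l)"
        proof -
          have "ln (2 * card V) \<le> ln (2 * (2 * real n + 1) ^ d)"
            using cV cV0 by (subst ln_le_cancel_iff) auto
          then show ?thesis using n l by (intro mult_left_mono divide_right_mono) auto
        qed
        also have "\<dots> = 2 ^ n * (n * (2 * l))" using l by (simp add: power2_eq_square field_simps)
        also have "\<dots> \<le> 2 ^ n * (n * \<epsilon>)" using l by (intro mult_left_mono) auto
        finally show ?thesis .
      qed
      obtain x where x: "x \<in> PiE {..<n} (\<lambda>_. \<Omega>)" 
        and xA: "\<And>A. A \<in> \<F> \<Longrightarrow> \<bar>(\<Sum>i<n. indicator A (x i)) - n * sum w (A \<inter> \<Omega>)\<bar> \<le> n * \<epsilon>"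
        using symmetrization[OF \<Omega> _ w(2) fF False bound] w(1) by blast
      have "\<bar>(\<Sum>i<n. of_bool (x i \<in> A)) / n - sum w A\<bar> \<le> \<epsilon>" if A: "A \<in> \<F>" for A
      proof -
        have e: "(\<Sum>i<n. of_bool (x i \<in> A)) = (\<Sum>i<n. indicator A (x i) :: real)" by (simp add: indicator_def)
        have "A \<inter> \<Omega> = A" using A \<F> by auto
        then have "\<bar>(\<Sum>i<n. of_bool (x i \<in> A)) - n * sum w A\<bar> \<le> n * \<epsilon>" using xA[OF A] unfolding e by simp
        moreover have "(\<Sum>i<n. of_bool (x i \<in> A)) / n - sum w A = ((\<Sum>i<n. of_bool (x i \<in> A)) - n * sum w A) / n"
          using n by (simp add: field_simps)
        ultimately show ?thesis using n by (simp add: abs_divide divide_le_eq mult.commute)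
      qed
      then show ?thesis using x by (intro exI[of _ x]) auto
    qed
  qed
  with n(1) show ?thesis by (intro exI[of _ n] conjI)
qed

section \<open>First-order formulas and types\<close>

lemma finite_fv_trm: "finite (fv_trm t)"
  by (induction t) auto

lemma finite_fv: "finite (fv \<phi>)"
  by (induction \<phi>) (auto simp: finite_fv_trm)

lemma eval_cong: "(\<And>v. v \<in> fv_trm t \<Longrightarrow> e v = e' v) \<Longrightarrow> eval N e bs t = eval N e' bs t"
proof (induction t)
  case (App f ts)
  have "map (eval N e bs) ts = map (eval N e' bs) ts"
    using App by (intro map_cong refl) auto
  then show ?case by (simp only: eval.simps)
qed auto

lemma sat_env_cong: "(\<And>v. v \<in> fv \<phi> \<Longrightarrow> e v = e' v) \<Longrightarrow> sat_env N e bs \<phi> = sat_env N e' bs \<phi>"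
proof (induction \<phi> arbitrary: bs)
  case (Eq s t)
  have "eval N e bs s = eval N e' bs s" "eval N e bs t = eval N e' bs t"
    using Eq by (auto intro!: eval_cong)
  then show ?case by simp
next
  case (Rel r ts)
  have "map (eval N e bs) ts = map (eval N e' bs) ts"
    using Rel by (intro map_cong refl eval_cong) auto
  then show ?case by (simp only: sat_env.simps)
next
  case (And \<phi> \<psi>)
  have "sat_env N e bs \<phi> = sat_env N e' bs \<phi>" "sat_env N e bs \<psi> = sat_env N e' bs \<psi>"
    using And.prems by (auto intro!: And.IH)
  then show ?case by simp
next
  case (Neg \<phi>)
  have "sat_env N e bs \<phi> = sat_env N e' bs \<phi>"
    using Neg.prems by (intro Neg.IH) auto
  then show ?case by simp
next
  case (Ex \<phi>)
  have "sat_env N e bs \<phi> = sat_env N e' bs \<phi>" for bs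
    using Ex.prems by (intro Ex.IH) auto
  then show ?case by simp
qed

lemma sat_cong: "(\<And>v. v \<in> fv \<phi> \<Longrightarrow> e v = e' v) \<Longrightarrow> sat N e \<phi> = sat N e' \<phi>"
  unfolding sat_def by (rule sat_env_cong)

lemma eval_ren: "eval N e bs (ren_trm f t) = eval N (e \<circ> f) bs t"
proof (induction t)
  case (App g ts)
  then have "map (eval N e bs) (map (ren_trm f) ts) = map (eval N (e \<circ> f) bs) ts"
    by (simp add: comp_def)
  then show ?case by (simp only: eval.simps trm.map)
qed auto

lemma sat_env_ren: "sat_env N e bs (ren f \<phi>) = sat_env N (e \<circ> f) bs \<phi>"
proof (induction \<phi> arbitrary: bs)
  case (Rel r ts)
  have "map (eval N e bs) (map (ren_trm f) ts) = map (eval N (e \<circ> f) bs) ts"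
    by (simp add: eval_ren)
  then show ?case by (simp only: sat_env.simps fml.map)
qed (auto simp: eval_ren)

lemma sat_ren: "sat N e (ren f \<phi>) = sat N (e \<circ> f) \<phi>"
  unfolding sat_def by (rule sat_env_ren)

lemma wf_trm_ren: "wf_trm L n (ren_trm f t) = wf_trm L n t"
  by (induction t) auto

lemma wf_fml_ren: "wf_fml L n (ren f \<phi>) = wf_fml L n \<phi>"
  by (induction \<phi> arbitrary: n) (auto simp: wf_trm_ren)

lemma ren_fmls [simp]: "ren f \<phi> \<in> fmls L \<longleftrightarrow> \<phi> \<in> fmls L"
  by (simp add: fmls_def wf_fml_ren)

lemma Neg_fmls [simp]: "Neg \<phi> \<in> fmls L \<longleftrightarrow> \<phi> \<in> fmls L"
  by (simp add: fmls_def)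

lemma And_fmls [simp]: "And \<phi> \<psi> \<in> fmls L \<longleftrightarrow> \<phi> \<in> fmls L \<and> \<psi> \<in> fmls L"
  by (simp add: fmls_def)

lemma sat_Neg [simp]: "sat N e (Neg \<phi>) \<longleftrightarrow> \<not> sat N e \<phi>"
  by (simp add: sat_def)

lemma sat_And [simp]: "sat N e (And \<phi> \<psi>) \<longleftrightarrow> sat N e \<phi> \<and> sat N e \<psi>"
  by (simp add: sat_def)

definition Xor :: "('f, 'r, 'v) fml \<Rightarrow> ('f, 'r, 'v) fml \<Rightarrow> ('f, 'r, 'v) fml" where
  "Xor \<phi> \<psi> = And (Neg (And \<phi> \<psi>)) (Neg (And (Neg \<phi>) (Neg \<psi>)))"

lemma Xor_fmls [simp]: "Xor \<phi> \<psi> \<in> fmls L \<longleftrightarrow> \<phi> \<in> fmls L \<and> \<psi> \<in> fmls L"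
  by (auto simp: Xor_def)

lemma sat_Xor [simp]: "sat N e (Xor \<phi> \<psi>) \<longleftrightarrow> (sat N e \<phi> \<noteq> sat N e \<psi>)"
  by (auto simp: Xor_def)

lemma fv_Xor [simp]: "fv (Xor \<phi> \<psi>) = fv \<phi> \<union> fv \<psi>"
  by (auto simp: Xor_def)

lemma ren_Xor [simp]: "ren f (Xor \<phi> \<psi>) = Xor (ren f \<phi>) (ren f \<psi>)"
  by (auto simp: Xor_def)

text \<open>A closed formula, so that it counts as an L(A)-formula for every A and every index type
  of variables. The price is that its truth needs a nonempty universe.\<close>

definition tt :: "('f, 'r, 'v) fml" where
  "tt = Ex (Eq (Bound 0) (Bound 0))"

lemma tt_fmls [simp]: "tt \<in> fmls L"
  by (simp add: tt_def fmls_def)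

lemma fv_tt [simp]: "fv tt = {}"
  by (simp add: tt_def)

lemma sat_tt: "univ N \<noteq> {} \<Longrightarrow> sat N e tt"
  by (auto simp: tt_def sat_def)

lemma conj_formula:
  assumes "finite \<Gamma>" "\<Gamma> \<subseteq> fmls L"
  obtains \<xi> where "\<xi> \<in> fmls L" "fv \<xi> \<subseteq> (\<Union>\<phi>\<in>\<Gamma>. fv \<phi>)"
    "\<And>(N :: ('f, 'r, 'c) struct) e. univ N \<noteq> {} \<Longrightarrow> sat N e \<xi> \<longleftrightarrow> (\<forall>\<phi>\<in>\<Gamma>. sat N e \<phi>)"
proof -
  have "\<exists>\<xi>\<in>fmls L. fv \<xi> \<subseteq> (\<Union>\<phi>\<in>\<Gamma>. fv \<phi>) \<and>
    (\<forall>(N :: ('f, 'r, 'c) struct) e. univ N \<noteq> {} \<longrightarrow> sat N e \<xi> \<longleftrightarrow> (\<forall>\<phi>\<in>\<Gamma>. sat N e \<phi>))"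
    using assms
  proof (induction \<Gamma> rule: finite_induct)
    case empty
    show ?case by (intro bexI[of _ tt]) (auto simp: sat_tt)
  next
    case (insert \<phi> \<Gamma>)
    then obtain \<xi> where "\<xi> \<in> fmls L" "fv \<xi> \<subseteq> (\<Union>\<phi>\<in>\<Gamma>. fv \<phi>)"
      "\<forall>(N :: ('f, 'r, 'c) struct) e. univ N \<noteq> {} \<longrightarrow> sat N e \<xi> \<longleftrightarrow> (\<forall>\<phi>\<in>\<Gamma>. sat N e \<phi>)" by auto
    then show ?case using insert.prems by (intro bexI[of _ "And \<phi> \<xi>"]) auto
  qed
  then show ?thesis using that by auto
qed

section \<open>Existential quantification over free variables\<close>

fun bnd_trm :: "'v \<Rightarrow> nat \<Rightarrow> ('f, 'v) trm \<Rightarrow> ('f, 'v) trm" where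
  "bnd_trm v n (Free u) = (if u = v then Bound n else Free u)"
| "bnd_trm v n (Bound k) = Bound k"
| "bnd_trm v n (App f ts) = App f (map (bnd_trm v n) ts)"

text \<open>The index n counts the quantifiers already crossed, so \<open>Bound n\<close> points
  just beyond them to a new outermost quantifier. Accordingly its value stands at the end of the
  environment in the evaluation lemmas, and \<open>Ex (bnd v 0 \<phi>)\<close> quantifies over
  v.\<close>

fun bnd :: "'v \<Rightarrow> nat \<Rightarrow> ('f, 'r, 'v) fml \<Rightarrow> ('f, 'r, 'v) fml" where
  "bnd v n (Eq s t) = Eq (bnd_trm v n s) (bnd_trm v n t)"
| "bnd v n (Rel r ts) = Rel r (map (bnd_trm v n) ts)"
| "bnd v n (Neg \<phi>) = Neg (bnd v n \<phi>)"
| "bnd v n (And \<phi> \<psi>) = And (bnd v n \<phi>) (bnd v n \<psi>)"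
| "bnd v n (Ex \<phi>) = Ex (bnd v (Suc n) \<phi>)"

lemma wf_bnd_trm: "wf_trm L n t \<Longrightarrow> wf_trm L (Suc n) (bnd_trm v n t)"
  by (induction t) auto

lemma wf_bnd: "wf_fml L n \<phi> \<Longrightarrow> wf_fml L (Suc n) (bnd v n \<phi>)"
  by (induction \<phi> arbitrary: n) (auto simp: wf_bnd_trm)

lemma fv_bnd_trm: "fv_trm (bnd_trm v n t) = fv_trm t - {v}"
  by (induction t) auto

lemma fv_bnd: "fv (bnd v n \<phi>) = fv \<phi> - {v}"
  by (induction \<phi> arbitrary: n) (auto simp: fv_bnd_trm)

lemma eval_bnd_trm:
  "wf_trm L (length bs) t \<Longrightarrow> eval N e (bs @ [c]) (bnd_trm v (length bs) t) = eval N (e(v := c)) bs t"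
proof (induction t)
  case (App f ts)
  then have "map (eval N e (bs @ [c])) (map (bnd_trm v (length bs)) ts) = map (eval N (e(v := c)) bs) ts"
    by (auto simp: fun_upd_def)
  then show ?case by (simp only: eval.simps bnd_trm.simps)
qed (auto simp: nth_append)

lemma sat_env_bnd:
  "wf_fml L (length bs) \<phi> \<Longrightarrow> sat_env N e (bs @ [c]) (bnd v (length bs) \<phi>) = sat_env N (e(v := c)) bs \<phi>"
proof (induction \<phi> arbitrary: bs)
  case (Rel r ts)
  then have "map (eval N e (bs @ [c])) (map (bnd_trm v (length bs)) ts) = map (eval N (e(v := c)) bs) ts"
    by (auto simp: eval_bnd_trm)
  then show ?case by (simp only: sat_env.simps bnd.simps)
next
  case (Ex \<phi>)
  have "sat_env N e ((x # bs) @ [c]) (bnd v (length (x # bs)) \<phi>) = sat_env N (e(v := c)) (x # bs) \<phi>" for x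
    using Ex.prems by (intro Ex.IH) simp
  then show ?case by (simp add: fun_upd_def)
qed (auto simp: eval_bnd_trm)

lemma exists_formula:
  assumes "\<phi> \<in> fmls L" "finite V"
  obtains \<xi> where "\<xi> \<in> fmls L" "fv \<xi> = fv \<phi> - V"
    "\<And>(N :: ('f, 'r, 'c) struct) e. sat N e \<xi> \<longleftrightarrow>
       (\<exists>e'. (\<forall>v\<in>V. e' v \<in> univ N) \<and> (\<forall>v. v \<notin> V \<longrightarrow> e' v = e v) \<and> sat N e' \<phi>)"
proof -
  have "\<exists>\<xi>\<in>fmls L. fv \<xi> = fv \<phi> - V \<and> (\<forall>(N :: ('f, 'r, 'c) struct) e. sat N e \<xi> \<longleftrightarrow>
       (\<exists>e'. (\<forall>v\<in>V. e' v \<in> univ N) \<and> (\<forall>v. v \<notin> V \<longrightarrow> e' v = e v) \<and> sat N e' \<phi>))"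
    using assms(2)
  proof (induction V rule: finite_induct)
    case empty
    have "(\<exists>e'. (\<forall>v. e' v = e v) \<and> sat N e' \<phi>) \<longleftrightarrow> sat N e \<phi>" for N :: "('f, 'r, 'c) struct" and e
      by (auto simp: fun_eq_iff[symmetric])
    then show ?case using assms(1) by (intro bexI[of _ \<phi>]) auto
  next
    case (insert v V)
    then obtain \<xi> where \<xi>: "\<xi> \<in> fmls L" "fv \<xi> = fv \<phi> - V"
      "\<And>(N :: ('f, 'r, 'c) struct) e. sat N e \<xi> \<longleftrightarrow>
       (\<exists>e'. (\<forall>v\<in>V. e' v \<in> univ N) \<and> (\<forall>v. v \<notin> V \<longrightarrow> e' v = e v) \<and> sat N e' \<phi>)" by auto
    have eq: "sat N e (Ex (bnd v 0 \<xi>)) \<longleftrightarrow> (\<exists>c\<in>univ N. sat N (e(v := c)) \<xi>)"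
      for N :: "('f, 'r, 'c) struct" and e
      using sat_env_bnd[of L "[]" \<xi> N e _ v] \<xi>(1) by (simp add: sat_def fmls_def)
    have "sat N e (Ex (bnd v 0 \<xi>)) \<longleftrightarrow>
       (\<exists>e'. (\<forall>u\<in>insert v V. e' u \<in> univ N) \<and> (\<forall>u. u \<notin> insert v V \<longrightarrow> e' u = e u) \<and> sat N e' \<phi>)" (is "?l \<longleftrightarrow> ?r")
      for N :: "('f, 'r, 'c) struct" and e
    proof
      assume ?l
      then obtain c e' where "c \<in> univ N" "\<forall>u\<in>V. e' u \<in> univ N" "\<forall>u. u \<notin> V \<longrightarrow> e' u = (e(v := c)) u" "sat N e' \<phi>"
        using eq \<xi>(3) by auto
      then show ?r using insert.hyps by (intro exI[of _ e']) auto
    next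
      assume ?r
      then obtain e' where "\<forall>u\<in>insert v V. e' u \<in> univ N" "\<forall>u. u \<notin> insert v V \<longrightarrow> e' u = e u" "sat N e' \<phi>" by auto
      then have "sat N (e(v := e' v)) \<xi>" "e' v \<in> univ N" unfolding \<xi>(3) by (auto intro!: exI[of _ e'])
      then show ?l unfolding eq by blast
    qed
    then show ?case using \<xi> by (intro bexI[of _ "Ex (bnd v 0 \<xi>)"]) (auto simp: fv_bnd fmls_def wf_bnd)
  qed
  then show ?thesis using that by auto
qed

text \<open>Elementary substructures are defined through formulas whose variables are natural
  numbers. Only finitely many variables are free, so they can be injected into \<open>nat\<close>;
  all other numbers receive a fixed element of U. The new assignment does not depend on the
  structure, which lets two structures be compared.\<close>

lemma sat_sub_nat:
  assumes "\<phi> \<in> fmls L" "\<And>v. v \<in> fv \<phi> \<Longrightarrow> e v \<in> U" "U \<noteq> {}"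
  obtains \<phi>' and e' :: "nat \<Rightarrow> 'c" where "\<phi>' \<in> fmls L" "range e' \<subseteq> U"
    "\<And>N :: ('f, 'r, 'c) struct. sat N e \<phi> = sat N e' \<phi>'"
proof -
  obtain g :: "'a \<Rightarrow> nat" where g: "inj_on g (fv \<phi>)"
    using finite_imp_inj_to_nat_seg[OF finite_fv[of \<phi>]] by auto
  obtain x0 where x0: "x0 \<in> U" using assms(3) by auto
  define e' where "e' n = (if n \<in> g ` fv \<phi> then e (inv_into (fv \<phi>) g n) else x0)" for n
  have "range e' \<subseteq> U" using assms(2) x0 by (auto simp: e'_def inv_into_into)
  moreover have "sat N e \<phi> = sat N e' (ren g \<phi>)" for N :: "('f, 'r, 'c) struct"
    unfolding sat_ren by (rule sat_cong) (auto simp: e'_def g)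
  ultimately show ?thesis using that[of "ren g \<phi>" e'] assms(1) by auto
qed

lemma is_struct_nonempty: "is_struct L N \<Longrightarrow> univ N \<noteq> {}"
  by (simp add: is_struct_def)

lemma elem_sub_sat:
  assumes "elem_sub L N N'" "\<phi> \<in> fmls L" "\<And>v. v \<in> fv \<phi> \<Longrightarrow> e v \<in> univ N"
  shows "sat N e \<phi> = sat N' e \<phi>"
proof -
  have ne: "univ N \<noteq> {}" using assms(1) by (auto simp: elem_sub_def is_struct_def)
  show ?thesis
  proof (rule sat_sub_nat[OF assms(2), of e "univ N"])
    fix \<phi>' and e' :: "nat \<Rightarrow> 'c"
    assume "\<phi>' \<in> fmls L" "range e' \<subseteq> univ N" "\<And>N :: ('a, 'b, 'c) struct. sat N e \<phi> = sat N e' \<phi>'"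
    then show ?thesis using assms(1) by (simp add: elem_sub_def)
  qed (use assms(3) ne in auto)
qed

section \<open>Automorphisms preserve satisfaction\<close>

lemma eval_in_univ:
  "is_struct L N \<Longrightarrow> wf_trm L (length bs) t \<Longrightarrow> set bs \<subseteq> univ N \<Longrightarrow>
   (\<And>v. v \<in> fv_trm t \<Longrightarrow> e v \<in> univ N) \<Longrightarrow> eval N e bs t \<in> univ N"
proof (induction t)
  case (App f ts)
  have "eval N e bs t \<in> univ N" if "t \<in> set ts" for t
    using App.prems that by (intro App.IH) auto
  then have "set (map (eval N e bs) ts) \<subseteq> univ N" by auto
  then have "fint N f (map (eval N e bs) ts) \<in> univ N"
    using App.prems by (auto simp: is_struct_def)
  then show ?case by simp
qed auto

lemma AutD:
  assumes "\<sigma> \<in> Aut L N"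
  shows "bij_betw \<sigma> (univ N) (univ N)" "x \<in> univ N \<Longrightarrow> \<sigma> x \<in> univ N"
    "f \<in> fsyms L \<Longrightarrow> length as = farity L f \<Longrightarrow> set as \<subseteq> univ N \<Longrightarrow> \<sigma> (fint N f as) = fint N f (map \<sigma> as)"
    "r \<in> rsyms L \<Longrightarrow> length as = rarity L r \<Longrightarrow> set as \<subseteq> univ N \<Longrightarrow> rint N r as \<longleftrightarrow> rint N r (map \<sigma> as)"
  using assms by (auto simp: Aut_def bij_betw_def)

lemma eval_Aut:
  assumes "\<sigma> \<in> Aut L N" "is_struct L N"
  shows "wf_trm L (length bs) t \<Longrightarrow> set bs \<subseteq> univ N \<Longrightarrow> (\<And>v. v \<in> fv_trm t \<Longrightarrow> e v \<in> univ N) \<Longrightarrow>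
    eval N (\<sigma> \<circ> e) (map \<sigma> bs) t = \<sigma> (eval N e bs t)"
proof (induction t)
  case (App f ts)
  have in_univ: "set (map (eval N e bs) ts) \<subseteq> univ N"
    using App.prems by (auto intro!: eval_in_univ[OF assms(2)])
  have "map (eval N (\<sigma> \<circ> e) (map \<sigma> bs)) ts = map \<sigma> (map (eval N e bs) ts)"
    using App by (auto simp: comp_def)
  moreover have "\<sigma> (fint N f (map (eval N e bs) ts)) = fint N f (map \<sigma> (map (eval N e bs) ts))"
    using App.prems in_univ by (intro AutD(3)[OF assms(1)]) auto
  ultimately show ?case by (simp only: eval.simps)
qed auto

lemma sat_env_Aut:
  assumes \<sigma>: "\<sigma> \<in> Aut L N" and N: "is_struct L N"
  shows "wf_fml L (length bs) \<phi> \<Longrightarrow> set bs \<subseteq> univ N \<Longrightarrow> (\<And>v. v \<in> fv \<phi> \<Longrightarrow> e v \<in> univ N) \<Longrightarrow>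
    sat_env N (\<sigma> \<circ> e) (map \<sigma> bs) \<phi> = sat_env N e bs \<phi>"
proof (induction \<phi> arbitrary: bs)
  case (Eq s t)
  have "eval N e bs s \<in> univ N" "eval N e bs t \<in> univ N"
    using Eq.prems by (auto intro!: eval_in_univ[OF N])
  moreover have "inj_on \<sigma> (univ N)" using AutD(1)[OF \<sigma>] by (simp add: bij_betw_def)
  moreover have "eval N (\<sigma> \<circ> e) (map \<sigma> bs) s = \<sigma> (eval N e bs s)"
    "eval N (\<sigma> \<circ> e) (map \<sigma> bs) t = \<sigma> (eval N e bs t)"
    using Eq.prems by (auto intro!: eval_Aut[OF \<sigma> N])
  ultimately show ?case by (simp only: sat_env.simps inj_on_eq_iff)
next
  case (Rel r ts)
  have "map (eval N (\<sigma> \<circ> e) (map \<sigma> bs)) ts = map \<sigma> (map (eval N e bs) ts)"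
    using Rel.prems by (auto intro!: eval_Aut[OF \<sigma> N])
  moreover have "rint N r (map (eval N e bs) ts) \<longleftrightarrow> rint N r (map \<sigma> (map (eval N e bs) ts))"
    using Rel.prems by (intro AutD(4)[OF \<sigma>]) (auto intro!: eval_in_univ[OF N])
  ultimately show ?case by (simp only: sat_env.simps)
next
  case (Ex \<phi>)
  have IH: "sat_env N (\<sigma> \<circ> e) (\<sigma> c # map \<sigma> bs) \<phi> = sat_env N e (c # bs) \<phi>" if "c \<in> univ N" for c
    using Ex.IH[of "c # bs"] Ex.prems that by (simp add: comp_def)
  \<comment> \<open>A witness for the moved formula has to be an image of an element, which
    surjectivity on the universe provides.\<close>
  have "\<sigma> ` univ N = univ N" using AutD(1)[OF \<sigma>] by (simp add: bij_betw_def)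
  then have "(\<exists>c\<in>univ N. sat_env N (\<sigma> \<circ> e) (c # map \<sigma> bs) \<phi>) \<longleftrightarrow> (\<exists>c\<in>univ N. sat_env N (\<sigma> \<circ> e) (\<sigma> c # map \<sigma> bs) \<phi>)"
    by (metis (no_types, lifting) imageE imageI)
  then show ?case using IH by (simp add: comp_def)
qed auto

lemma sat_Aut:
  assumes "\<sigma> \<in> Aut L N" "is_struct L N" "\<phi> \<in> fmls L" "\<And>v. v \<in> fv \<phi> \<Longrightarrow> e v \<in> univ N"
  shows "sat N (\<sigma> \<circ> e) \<phi> = sat N e \<phi>"
  using sat_env_Aut[OF assms(1,2), of "[]" \<phi> e] assms by (simp add: sat_def fmls_def)

subsection \<open>Ultrafilters\<close>

definition ultra :: "'a filter \<Rightarrow> bool" where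
  "ultra U \<longleftrightarrow> U \<noteq> bot \<and> (\<forall>P. eventually P U \<or> eventually (\<lambda>x. \<not> P x) U)"

text \<open>In the order on filters an ultrafilter is a minimal proper filter, so Zorn is applied to
  the reversed order. The infimum of a chain is proper because what holds eventually for it already
  does so for a member. Minimality against the restriction of the filter to P decides P.\<close>

lemma ex_ultra:
  assumes "G \<noteq> bot"
  obtains U where "U \<le> G" "ultra U"
proof -
  define A where "A = {H. H \<noteq> bot \<and> H \<le> G}"
  have "\<exists>m\<in>A. \<forall>a\<in>A. a \<le> m \<longrightarrow> a = m"
  proof (rule predicate_Zorn[where P = "\<lambda>a b. b \<le> a", simplified])
    show "partial_order_on A (relation_of (\<lambda>a b. b \<le> a) A)"
      by (auto simp: partial_order_on_def preorder_on_def refl_on_def trans_def antisym_def relation_of_def)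
    fix C assume C: "C \<in> Chains (relation_of (\<lambda>a b. b \<le> a) A)"
    then have CA: "C \<subseteq> A" and tot: "\<And>a b. a \<in> C \<Longrightarrow> b \<in> C \<Longrightarrow> a \<le> b \<or> b \<le> a"
      by (auto simp: Chains_def relation_of_def)
    show "\<exists>u\<in>A. \<forall>a\<in>C. u \<le> a"
    proof (cases "C = {}")
      case True
      then show ?thesis using assms by (intro bexI[of _ G]) (auto simp: A_def)
    next
      case False
      have "Inf C \<noteq> bot"
      proof
        assume "Inf C = bot"
        then have "eventually (\<lambda>_. False) (Inf C)" by simp
        then have "\<exists>b\<in>C. eventually (\<lambda>_. False) b"
        proof (subst (asm) eventually_Inf_base)
          fix a b assume ab: "a \<in> C" "b \<in> C"
          then have "a \<le> inf a b \<or> b \<le> inf a b" using tot by fastforce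
          then show "\<exists>x\<in>C. x \<le> inf a b" using ab by blast
        qed (use False in auto)
        then show False using CA by (auto simp: A_def trivial_limit_def)
      qed
      moreover have "Inf C \<le> G" using False CA by (auto simp: A_def intro: Inf_lower2)
      ultimately show ?thesis by (intro bexI[of _ "Inf C"]) (auto simp: A_def intro: Inf_lower)
    qed
  qed
  then obtain m where m: "m \<noteq> bot" "m \<le> G" "\<And>a. a \<noteq> bot \<Longrightarrow> a \<le> m \<Longrightarrow> a = m" by (auto simp: A_def dest: order_trans)
  have "eventually P m \<or> eventually (\<lambda>x. \<not> P x) m" for P
  proof (rule disjCI)
    assume n: "\<not> eventually (\<lambda>x. \<not> P x) m"
    have "inf m (principal {x. P x}) \<noteq> bot"
      using n by (auto simp: trivial_limit_def eventually_inf_principal)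
    then have "inf m (principal {x. P x}) = m" by (intro m(3)) auto
    moreover have "eventually P (inf m (principal {x. P x}))" by (simp add: eventually_inf_principal)
    ultimately show "eventually P m" by simp
  qed
  then show ?thesis using that m by (auto simp: ultra_def)
qed

lemma ultra_not: "ultra U \<Longrightarrow> eventually (\<lambda>x. \<not> P x) U \<longleftrightarrow> \<not> eventually P U"
  unfolding ultra_def using eventually_conj[of P U "\<lambda>x. \<not> P x"] by auto

lemma ultra_ex: "ultra U \<Longrightarrow> eventually P U \<Longrightarrow> \<exists>x. P x"
  unfolding ultra_def using eventually_happens' by blast

text \<open>The index filter of the compactness arguments: almost every index is a finite subset of
  A, and each element of A belongs to almost every index.\<close>

lemma ultra_finite_subsets:
  "\<exists>U. ultra U \<and> (\<forall>x\<in>A. eventually (\<lambda>S. x \<in> S) U) \<and> eventually (\<lambda>S. finite S \<and> S \<subseteq> A) U"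
proof -
  obtain U where U: "U \<le> finite_subsets_at_top A" "ultra U"
    using ex_ultra[OF finite_subsets_at_top_neq_bot] by blast
  have "eventually (\<lambda>S. x \<in> S) (finite_subsets_at_top A)" if "x \<in> A" for x
    unfolding eventually_finite_subsets_at_top by (rule exI[of _ "{x}"]) (use that in auto)
  moreover have "eventually (\<lambda>S. finite S \<and> S \<subseteq> A) (finite_subsets_at_top A)"
    by (rule eventually_finite_subsets_at_top_weakI) auto
  ultimately show ?thesis using U by (intro exI[of _ U]) (auto simp: le_filter_def)
qed

subsection \<open>Complete types\<close>

lemma psat_Neg [simp]: "psat N a (Neg \<phi>) \<longleftrightarrow> \<not> psat N a \<phi>"
  by (simp add: psat_def)

lemma psat_And [simp]: "psat N a (And \<phi> \<psi>) \<longleftrightarrow> psat N a \<phi> \<and> psat N a \<psi>"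
  by (simp add: psat_def)

lemma psat_Xor [simp]: "psat N a (Xor \<phi> \<psi>) \<longleftrightarrow> psat N a \<phi> \<noteq> psat N a \<psi>"
  by (simp add: psat_def)

lemma pfmls_Neg [simp]: "Neg \<phi> \<in> pfmls L A \<longleftrightarrow> \<phi> \<in> pfmls L A"
  by (simp add: pfmls_def)

lemma pfmls_And [simp]: "And \<phi> \<psi> \<in> pfmls L A \<longleftrightarrow> \<phi> \<in> pfmls L A \<and> \<psi> \<in> pfmls L A"
  by (auto simp: pfmls_def)

lemma pfmls_Xor [simp]: "Xor \<phi> \<psi> \<in> pfmls L A \<longleftrightarrow> \<phi> \<in> pfmls L A \<and> \<psi> \<in> pfmls L A"
  by (auto simp: pfmls_def)

lemma tt_pfmls [simp]: "tt \<in> pfmls L A"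
  by (simp add: pfmls_def)

lemma psat_tt: "univ N \<noteq> {} \<Longrightarrow> psat N a tt"
  by (simp add: psat_def sat_tt)

lemma pfmls_mono: "A \<subseteq> B \<Longrightarrow> pfmls L A \<subseteq> pfmls L B"
  by (auto simp: pfmls_def)

lemma psat_cong:
  "(\<And>i. Inl i \<in> fv \<phi> \<Longrightarrow> a i = b i) \<Longrightarrow> psat N a \<phi> = psat N b \<phi>"
  unfolding psat_def by (rule sat_cong) (auto split: sum.splits)

lemma conj_pformula:
  assumes "finite \<Gamma>" "\<Gamma> \<subseteq> pfmls L A"
  obtains \<xi> where "\<xi> \<in> pfmls L A"
    "\<And>(N :: ('f, 'r, 'c) struct) a. univ N \<noteq> {} \<Longrightarrow> psat N a \<xi> \<longleftrightarrow> (\<forall>\<phi>\<in>\<Gamma>. psat N a \<phi>)"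
proof -
  have "\<Gamma> \<subseteq> fmls L" using assms(2) by (auto simp: pfmls_def)
  from conj_formula[OF assms(1) this] obtain \<xi> where xi: "\<xi> \<in> fmls L" "fv \<xi> \<subseteq> (\<Union>\<phi>\<in>\<Gamma>. fv \<phi>)"
    "\<And>(N :: ('f, 'r, 'c) struct) e. univ N \<noteq> {} \<Longrightarrow> sat N e \<xi> \<longleftrightarrow> (\<forall>\<phi>\<in>\<Gamma>. sat N e \<phi>)" by metis
  then have "\<xi> \<in> pfmls L A"
    using assms(2) unfolding pfmls_def by blast
  with xi show ?thesis using that[of \<xi>] by (simp add: psat_def)
qed

lemma types_pfmls: "p \<in> types L N A \<Longrightarrow> \<phi> \<in> p \<Longrightarrow> \<phi> \<in> pfmls L A"
  by (auto simp: types_def)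

lemma types_finsat:
  assumes "p \<in> types L N A" "finite \<Gamma>" "\<Gamma> \<subseteq> p"
  obtains a where "range a \<subseteq> univ N" "\<And>\<phi>. \<phi> \<in> \<Gamma> \<Longrightarrow> psat N a \<phi>"
proof -
  have "\<exists>a. range a \<subseteq> univ N \<and> (\<forall>\<phi>\<in>\<Gamma>. psat N a \<phi>)" using assms by (simp add: types_def)
  then show ?thesis using that by auto
qed

lemma types_Neg:
  assumes "p \<in> types L N A" "\<phi> \<in> pfmls L A"
  shows "Neg \<phi> \<in> p \<longleftrightarrow> \<phi> \<notin> p"
proof -
  have "\<not> (\<phi> \<in> p \<and> Neg \<phi> \<in> p)"
  proof
    assume "\<phi> \<in> p \<and> Neg \<phi> \<in> p"
    then have "{\<phi>, Neg \<phi>} \<subseteq> p" by simp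
    from types_finsat[OF assms(1) _ this] obtain a where "\<And>\<psi>. \<psi> \<in> {\<phi>, Neg \<phi>} \<Longrightarrow> psat N a \<psi>"
      by (metis finite.emptyI finite.insertI)
    from this[of \<phi>] this[of "Neg \<phi>"] show False by simp
  qed
  then show ?thesis using assms by (auto simp: types_def)
qed

text \<open>Otherwise the negation of \<theta> together with \<Gamma> would be a finite part of p
  without realization.\<close>

lemma types_closed:
  assumes p: "p \<in> types L N A" and \<theta>: "\<theta> \<in> pfmls L A" and \<Gamma>: "finite \<Gamma>" "\<Gamma> \<subseteq> p"
    and imp: "\<And>a. range a \<subseteq> univ N \<Longrightarrow> (\<And>\<phi>. \<phi> \<in> \<Gamma> \<Longrightarrow> psat N a \<phi>) \<Longrightarrow> psat N a \<theta>"
  shows "\<theta> \<in> p"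
proof (rule ccontr)
  assume "\<theta> \<notin> p"
  then have "Neg \<theta> \<in> p" using types_Neg[OF p \<theta>] by simp
  then have "insert (Neg \<theta>) \<Gamma> \<subseteq> p" using \<Gamma> by simp
  then obtain a where a: "range a \<subseteq> univ N" "\<And>\<phi>. \<phi> \<in> insert (Neg \<theta>) \<Gamma> \<Longrightarrow> psat N a \<phi>"
    using types_finsat[OF p, of "insert (Neg \<theta>) \<Gamma>"] \<Gamma> by auto
  from a(2)[of "Neg \<theta>"] have "\<not> psat N a \<theta>" by simp
  moreover have "psat N a \<theta>" using a by (intro imp) auto
  ultimately show False by simp
qed

lemma types_And:
  assumes "p \<in> types L N A" "\<phi> \<in> pfmls L A" "\<psi> \<in> pfmls L A"
  shows "And \<phi> \<psi> \<in> p \<longleftrightarrow> \<phi> \<in> p \<and> \<psi> \<in> p"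
proof
  assume "And \<phi> \<psi> \<in> p"
  then show "\<phi> \<in> p \<and> \<psi> \<in> p"
    using types_closed[OF assms(1,2), of "{And \<phi> \<psi>}"] types_closed[OF assms(1,3), of "{And \<phi> \<psi>}"] by simp
next
  assume "\<phi> \<in> p \<and> \<psi> \<in> p"
  then show "And \<phi> \<psi> \<in> p"
    using types_closed[OF assms(1), of "And \<phi> \<psi>" "{\<phi>, \<psi>}"] assms by simp
qed

lemma types_Xor:
  assumes "p \<in> types L N A" "\<phi> \<in> pfmls L A" "\<psi> \<in> pfmls L A"
  shows "Xor \<phi> \<psi> \<in> p \<longleftrightarrow> (\<phi> \<in> p) \<noteq> (\<psi> \<in> p)"
  using assms by (auto simp: Xor_def types_And types_Neg)

lemma types_eqI:
  assumes "p \<in> types L N A" "q \<in> types L N A" "p \<subseteq> q"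
  shows "p = q"
proof -
  have "\<phi> \<in> p" if "\<phi> \<in> q" for \<phi>
    using types_Neg[OF assms(1), of \<phi>] types_Neg[OF assms(2), of \<phi>] that assms types_pfmls[OF assms(2) that] by auto
  then show ?thesis using assms(3) by auto
qed

lemma tp_types: "range a \<subseteq> univ N \<Longrightarrow> tp L N A a \<in> types L N A"
  unfolding types_def tp_def by auto

lemma tt_types: "univ N \<noteq> {} \<Longrightarrow> p \<in> types L N A \<Longrightarrow> tt \<in> p"
  using types_closed[of p L N A tt "{}"] by (simp add: psat_tt)

lemma ultra_limit_types:
  assumes U: "ultra U" and f: "eventually (\<lambda>w. range (f w) \<subseteq> univ N) U"
  shows "{\<theta> \<in> pfmls L A. eventually (\<lambda>w. psat N (f w) \<theta>) U} \<in> types L N A"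
  unfolding types_def
proof (intro CollectI conjI allI impI ballI)
  fix \<Gamma> assume "finite \<Gamma>" and \<Gamma>: "\<Gamma> \<subseteq> {\<theta> \<in> pfmls L A. eventually (\<lambda>w. psat N (f w) \<theta>) U}"
  then have "eventually (\<lambda>w. \<forall>\<phi>\<in>\<Gamma>. psat N (f w) \<phi>) U"
    by (intro eventually_ball_finite) auto
  with f have "eventually (\<lambda>w. range (f w) \<subseteq> univ N \<and> (\<forall>\<phi>\<in>\<Gamma>. psat N (f w) \<phi>)) U"
    by eventually_elim auto
  from ultra_ex[OF U this] show "\<exists>a. range a \<subseteq> univ N \<and> (\<forall>\<phi>\<in>\<Gamma>. psat N a \<phi>)" by blast
qed (use U in \<open>auto simp: ultra_not\<close>)

text \<open>The set Z restricts where finite parts are realized, and the completion keeps this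
  property. With Z the tuples of a submodel this yields coheirs; with Z all tuples it is ordinary
  completion. The type is the ultralimit of chosen realizations of the finite parts.\<close>

lemma complete_type:
  assumes \<Gamma>: "\<Gamma> \<subseteq> pfmls L A" and Z: "\<And>a. a \<in> Z \<Longrightarrow> range a \<subseteq> univ N"
    and sat: "\<And>\<Delta>. finite \<Delta> \<Longrightarrow> \<Delta> \<subseteq> \<Gamma> \<Longrightarrow> \<exists>a\<in>Z. \<forall>\<phi>\<in>\<Delta>. psat N a \<phi>"
  obtains p where "p \<in> types L N A" "\<Gamma> \<subseteq> p" "\<And>\<theta>. \<theta> \<in> p \<Longrightarrow> \<exists>a\<in>Z. psat N a \<theta>"
proof -
  obtain U where U: "ultra U" "\<And>x. x \<in> \<Gamma> \<Longrightarrow> eventually (\<lambda>S. x \<in> S) U"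
    "eventually (\<lambda>S. finite S \<and> S \<subseteq> \<Gamma>) U" using ultra_finite_subsets[of \<Gamma>] by blast
  define f where "f \<Delta> = (SOME a. a \<in> Z \<and> (\<forall>\<phi>\<in>\<Delta>. psat N a \<phi>))" for \<Delta>
  have f: "f \<Delta> \<in> Z \<and> (\<forall>\<phi>\<in>\<Delta>. psat N (f \<Delta>) \<phi>)" if "finite \<Delta> \<and> \<Delta> \<subseteq> \<Gamma>" for \<Delta>
  proof -
    have ex: "\<exists>a. a \<in> Z \<and> (\<forall>\<phi>\<in>\<Delta>. psat N a \<phi>)" using sat[of \<Delta>] that by blast
    show ?thesis unfolding f_def using someI_ex[OF ex] by blast
  qed
  define p where "p = {\<theta> \<in> pfmls L A. eventually (\<lambda>w. psat N (f w) \<theta>) U}"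
  have fZ: "eventually (\<lambda>w. f w \<in> Z) U" using U(3) by eventually_elim (use f in blast)
  then have "eventually (\<lambda>w. range (f w) \<subseteq> univ N) U" by eventually_elim (use Z in blast)
  then have "p \<in> types L N A" unfolding p_def by (rule ultra_limit_types[OF U(1)])
  moreover have "\<Gamma> \<subseteq> p"
  proof
    fix \<phi> assume \<phi>: "\<phi> \<in> \<Gamma>"
    have "eventually (\<lambda>w. psat N (f w) \<phi>) U" using U(3) U(2)[OF \<phi>] by eventually_elim (use f in blast)
    then show "\<phi> \<in> p" using \<phi> \<Gamma> by (auto simp: p_def)
  qed
  moreover have "\<exists>a\<in>Z. psat N a \<theta>" if "\<theta> \<in> p" for \<theta>
  proof -
    have "eventually (\<lambda>w. psat N (f w) \<theta>) U" using that by (simp add: p_def)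
    with fZ have "eventually (\<lambda>w. f w \<in> Z \<and> psat N (f w) \<theta>) U" by eventually_elim auto
    from ultra_ex[OF U(1) this] show ?thesis by blast
  qed
  ultimately show ?thesis using that by blast
qed

section \<open>Saturation and homogeneity in countably many variables\<close>

locale monster =
  fixes L :: "('f, 'r) lang" and N :: "('f, 'r, 'c) struct" and \<kappa> :: "'k rel"
  assumes struct: "is_struct L N"
    and saturated: "saturated L \<kappa> N"
    and homogeneous: "strongly_homogeneous L \<kappa> N"
    and card_order: "Card_order \<kappa>" and natLeq: "natLeq <o \<kappa>"
begin

lemma small_countable: "countable A \<Longrightarrow> |A| <o \<kappa>"
  using natLeq countable_card_le_natLeq ordLeq_ordLess_trans by blast

lemma small_Un:
  assumes "|A| <o \<kappa>" "|B| <o \<kappa>"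
  shows "|A \<union> B| <o \<kappa>"
proof (rule card_of_Un_ordLess_infinite_Field[OF _ card_order assms])
  show "infinite (Field \<kappa>)"
    using natLeq card_order by (metis Card_order_iff_ordLeq_card_of card_of_ordLeq_finite card_of_Field_ordIso
      natLeq_Card_order Field_natLeq infinite_UNIV_nat card_of_unique ordLess_imp_ordLeq card_of_mono2)
qed

lemma ex_conj:
  assumes "finite \<Delta>" "\<Delta> \<subseteq> pfmls L A"
  shows "\<exists>\<phi>\<in>pfmls L A. \<forall>e. psat N e \<phi> \<longleftrightarrow> (\<forall>\<psi>\<in>\<Delta>. psat N e \<psi>)"
proof (rule conj_pformula[OF assms])
  fix \<xi> assume "\<xi> \<in> pfmls L A"
    and "\<And>(N :: ('f, 'r, 'c) struct) a. univ N \<noteq> {} \<Longrightarrow> psat N a \<xi> \<longleftrightarrow> (\<forall>\<phi>\<in>\<Delta>. psat N a \<phi>)"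
  then show ?thesis using is_struct_nonempty[OF struct] by blast
qed

text \<open>Saturation speaks of types in a single variable. The variable v is kept, the variables
  in D turn into parameters by their values under a, and all others are quantified
  existentially.\<close>

lemma one_variable_formula:
  fixes \<phi> :: "('f, 'r, 'j + 'c) fml"
  assumes \<phi>: "\<phi> \<in> pfmls L A" and D: "v \<notin> D" and aD: "a ` D \<subseteq> univ N"
  shows "\<exists>\<xi> :: ('f, 'r, unit + 'c) fml. \<xi> \<in> pfmls L (A \<union> a ` D) \<and> (\<forall>b. range b \<subseteq> univ N \<longrightarrow> (psat N b \<xi> \<longleftrightarrow>
     (\<exists>e. range e \<subseteq> univ N \<and> e v = b () \<and> (\<forall>i\<in>D. e i = a i) \<and> psat N e \<phi>)))"
proof -
  \<comment> \<open>The left summand collects the kept variable and the parameters, the right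
    summand the variables to be quantified.\<close>
  define r :: "'j + 'c \<Rightarrow> (unit + 'c) + 'j" where
    "r x = (case x of Inr c \<Rightarrow> Inl (Inr c) | Inl i \<Rightarrow> if i = v then Inl (Inl ()) else if i \<in> D then Inl (Inr (a i)) else Inr i)" for x
  define V where "V = fv (ren r \<phi>) \<inter> range Inr"
  have "ren r \<phi> \<in> fmls L" "finite V" using \<phi> by (auto simp: pfmls_def V_def finite_fv)
  from exists_formula[OF this] obtain \<xi> where \<xi>: "\<xi> \<in> fmls L" "fv \<xi> = fv (ren r \<phi>) - V"
    "\<And>(N :: ('f, 'r, 'c) struct) e. sat N e \<xi> \<longleftrightarrow>
       (\<exists>e'. (\<forall>v\<in>V. e' v \<in> univ N) \<and> (\<forall>v. v \<notin> V \<longrightarrow> e' v = e v) \<and> sat N e' (ren r \<phi>))" by blast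
  \<comment> \<open>Drops the now empty right summand. The value there is a dummy, since no variable
    of the right summand is free in \<xi> any more.\<close>
  define k :: "(unit + 'c) + 'j \<Rightarrow> unit + 'c" where "k x = (case x of Inl y \<Rightarrow> y | Inr _ \<Rightarrow> Inl ())" for x
  obtain x0 where x0: "x0 \<in> univ N" using struct by (auto simp: is_struct_def)
  have fvr: "fv (ren r \<phi>) = r ` fv \<phi>" by (simp add: fml.set_map)
  have "fv (ren k \<xi>) \<subseteq> {Inl ()} \<union> Inr ` (A \<union> a ` D)"
  proof
    fix y assume "y \<in> fv (ren k \<xi>)"
    then obtain x where x: "x \<in> fv \<phi>" "r x \<notin> range Inr" "y = k (r x)"
      by (auto simp: fml.set_map \<xi>(2) V_def)
    then show "y \<in> {Inl ()} \<union> Inr ` (A \<union> a ` D)" using \<phi>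
      by (auto simp: r_def k_def pfmls_def split: sum.splits if_splits)
  qed
  then have p: "ren k \<xi> \<in> pfmls L (A \<union> a ` D)" using \<xi>(1) by (auto simp: pfmls_def)
  have "psat N b (ren k \<xi>) \<longleftrightarrow> (\<exists>e. range e \<subseteq> univ N \<and> e v = b () \<and> (\<forall>i\<in>D. e i = a i) \<and> psat N e \<phi>)" (is "?l \<longleftrightarrow> ?r")
    if b: "range b \<subseteq> univ N" for b :: "unit \<Rightarrow> 'c"
  proof
    assume ?l
    then obtain e' where e': "\<forall>u\<in>V. e' u \<in> univ N" "\<forall>u. u \<notin> V \<longrightarrow> e' u = (case_sum b id \<circ> k) u" "sat N e' (ren r \<phi>)"
      unfolding psat_def sat_ren \<xi>(3) by blast
    define e where "e i = (if i = v then b () else if i \<in> D then a i else if Inr i \<in> V then e' (Inr i) else x0)" for i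
    have V: "Inl x \<notin> V" for x by (auto simp: V_def)
    have "sat N (case_sum e id) \<phi> = sat N (e' \<circ> r) \<phi>"
    proof (rule sat_cong)
      fix x assume x: "x \<in> fv \<phi>"
      show "case_sum e id x = (e' \<circ> r) x"
      proof (cases x)
        case (Inl i)
        show ?thesis
        proof (cases "i = v \<or> i \<in> D")
          case True
          then show ?thesis using Inl e'(2) V by (auto simp: r_def e_def k_def)
        next
          case False
          then have "r x = Inr i" using Inl by (simp add: r_def)
          then have "Inr i \<in> V" using x by (force simp: V_def fvr)
          then show ?thesis using False Inl by (auto simp: r_def e_def)
        qed
      next
        case (Inr c)
        then show ?thesis using e'(2) V by (simp add: r_def k_def)
      qed
    qed
    then have "psat N e \<phi>" using e'(3) by (simp add: psat_def sat_ren)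
    moreover have "range e \<subseteq> univ N" using e'(1) b aD x0 by (auto simp: e_def)
    ultimately show ?r using D by (intro exI[of _ e]) (auto simp: e_def)
  next
    assume ?r
    then obtain e where e: "range e \<subseteq> univ N" "e v = b ()" "\<forall>i\<in>D. e i = a i" "psat N e \<phi>" by blast
    define e' where "e' u = (if u \<in> V then (case u of Inr i \<Rightarrow> e i | Inl _ \<Rightarrow> x0) else (case_sum b id \<circ> k) u)" for u
    have "sat N (e' \<circ> r) \<phi> = sat N (case_sum e id) \<phi>"
    proof (rule sat_cong)
      fix x assume x: "x \<in> fv \<phi>"
      then have rx: "r x \<in> fv (ren r \<phi>)" by (simp add: fvr)
      show "(e' \<circ> r) x = case_sum e id x"
      proof (cases x)
        case (Inl i)
        show ?thesis
        proof (cases "i = v \<or> i \<in> D")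
          case True
          then show ?thesis using Inl e D by (auto simp: r_def e'_def k_def V_def)
        next
          case False
          then have "r x = Inr i" using Inl by (simp add: r_def)
          then have "Inr i \<in> V" using rx by (simp add: V_def)
          then show ?thesis using \<open>r x = Inr i\<close> Inl by (auto simp: e'_def)
        qed
      next
        case (Inr c)
        then show ?thesis by (auto simp: r_def e'_def k_def V_def)
      qed
    qed
    then have "sat N e' (ren r \<phi>)" using e(4) by (simp add: psat_def sat_ren)
    moreover have "\<forall>u\<in>V. e' u \<in> univ N" using e(1) x0 by (auto simp: e'_def split: sum.splits)
    moreover have "\<forall>u. u \<notin> V \<longrightarrow> e' u = (case_sum b id \<circ> k) u" by (simp add: e'_def)
    ultimately show ?l unfolding psat_def sat_ren \<xi>(3) by blast
  qed
  then show ?thesis using p by blast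
qed

definition satisfiable_over ::
  "('f, 'r, 'j + 'c) fml set \<Rightarrow> 'j set \<Rightarrow> ('j \<Rightarrow> 'c) \<Rightarrow> bool" where
  "satisfiable_over \<Gamma> D a \<longleftrightarrow> (\<forall>\<Delta>. finite \<Delta> \<longrightarrow> \<Delta> \<subseteq> \<Gamma> \<longrightarrow>
     (\<exists>e. range e \<subseteq> univ N \<and> (\<forall>i\<in>D. e i = a i) \<and> (\<forall>\<phi>\<in>\<Delta>. psat N e \<phi>)))"

text \<open>The formulas X \<Delta> say that v can be completed to a solution of \<Delta> with the
  values on D unchanged. They form a partial type in one variable over fewer than \<kappa>
  parameters, and a realization of it is a good value for v.\<close>

lemma satisfiable_extend:
  fixes \<Gamma> :: "('f, 'r, 'j + 'c) fml set"
  assumes A: "A \<subseteq> univ N" "|A| <o \<kappa>" and \<Gamma>: "\<Gamma> \<subseteq> pfmls L A" and D: "finite D" "v \<notin> D"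
    and aD: "a ` D \<subseteq> univ N" and S: "satisfiable_over \<Gamma> D a"
  shows "\<exists>c\<in>univ N. satisfiable_over \<Gamma> (insert v D) (a(v := c))"
proof -
  define Q where "Q \<Delta> (\<xi> :: ('f, 'r, unit + 'c) fml) \<longleftrightarrow> \<xi> \<in> pfmls L (A \<union> a ` D) \<and> (\<forall>b. range b \<subseteq> univ N \<longrightarrow> (psat N b \<xi> \<longleftrightarrow>
     (\<exists>e. range e \<subseteq> univ N \<and> e v = b () \<and> (\<forall>i\<in>D. e i = a i) \<and> (\<forall>\<phi>\<in>\<Delta>. psat N e \<phi>))))" for \<Delta> \<xi>
  have ex: "\<exists>\<xi>. Q \<Delta> \<xi>"
    if \<Delta>: "finite \<Delta> \<and> \<Delta> \<subseteq> \<Gamma>" for \<Delta>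
  proof -
    have "\<Delta> \<subseteq> pfmls L A" using \<Delta> \<Gamma> by blast
    then obtain \<phi> where \<phi>: "\<phi> \<in> pfmls L A" "\<And>e. psat N e \<phi> \<longleftrightarrow> (\<forall>\<phi>\<in>\<Delta>. psat N e \<phi>)"
      using ex_conj[of \<Delta> A] \<Delta> by blast
    show ?thesis using one_variable_formula[OF \<phi>(1) D(2) aD] unfolding \<phi>(2) Q_def .
  qed
  define X where "X \<Delta> = (SOME \<xi>. Q \<Delta> \<xi>)" for \<Delta>
  have QX: "Q \<Delta> (X \<Delta>)" if "finite \<Delta>" "\<Delta> \<subseteq> \<Gamma>" for \<Delta>
    unfolding X_def by (rule someI_ex) (use ex that in simp)
  have X: "X \<Delta> \<in> pfmls L (A \<union> a ` D)" if "finite \<Delta>" "\<Delta> \<subseteq> \<Gamma>" for \<Delta>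
    using QX[OF that] by (simp add: Q_def)
  have X2: "psat N b (X \<Delta>) \<longleftrightarrow>
     (\<exists>e. range e \<subseteq> univ N \<and> e v = b () \<and> (\<forall>i\<in>D. e i = a i) \<and> (\<forall>\<phi>\<in>\<Delta>. psat N e \<phi>))"
    if "finite \<Delta>" "\<Delta> \<subseteq> \<Gamma>" "range b \<subseteq> univ N" for \<Delta> b
    using QX[OF that(1,2)] that(3) unfolding Q_def by blast
  define Z where "Z = {b :: unit \<Rightarrow> 'c. range b \<subseteq> univ N}"
  define P where "P = X ` {\<Delta>. finite \<Delta> \<and> \<Delta> \<subseteq> \<Gamma>}"
  have "\<exists>p. p \<in> types L N (A \<union> a ` D) \<and> P \<subseteq> p"
  proof (rule complete_type[of P L "A \<union> a ` D" Z N])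
    show "P \<subseteq> pfmls L (A \<union> a ` D)" using X by (auto simp: P_def)
    fix E assume "finite E" "E \<subseteq> P"
    then obtain \<D> where \<D>: "finite \<D>" "\<D> \<subseteq> {\<Delta>. finite \<Delta> \<and> \<Delta> \<subseteq> \<Gamma>}" "E = X ` \<D>"
      unfolding P_def by (meson finite_subset_image)
    \<comment> \<open>Finitely many of these formulas hold simultaneously because the union of the
      sets involved is again a finite part of \<Gamma>.\<close>
    have "finite (\<Union>\<D>)" "\<Union>\<D> \<subseteq> \<Gamma>" using \<D> by auto
    then obtain e where e: "range e \<subseteq> univ N" "\<forall>i\<in>D. e i = a i" "\<forall>\<phi>\<in>\<Union>\<D>. psat N e \<phi>"
      using S unfolding satisfiable_over_def by meson
    define b where "b = (\<lambda>_::unit. e v)"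
    have b: "range b \<subseteq> univ N" using e(1) by (auto simp: b_def)
    have "psat N b (X \<Delta>)" if "\<Delta> \<in> \<D>" for \<Delta>
    proof -
      have "finite \<Delta>" "\<Delta> \<subseteq> \<Gamma>" using \<D> that by auto
      from X2[OF this b] show ?thesis
      proof (rule iffD2, intro exI[of _ e] conjI)
        show "\<forall>\<phi>\<in>\<Delta>. psat N e \<phi>" using e(3) that by blast
      qed (use e in \<open>auto simp: b_def\<close>)
    qed
    then show "\<exists>b\<in>Z. \<forall>\<phi>\<in>E. psat N b \<phi>" using b \<D>(3) by (intro bexI[of _ b]) (auto simp: Z_def)
  qed (auto simp: Z_def)
  then obtain p where p: "p \<in> types L N (A \<union> a ` D)" "P \<subseteq> p" by blast
  have "|A \<union> a ` D| <o \<kappa>" using small_Un[OF A(2) small_countable[of "a ` D"]] D by (simp add: countable_finite)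
  then obtain b :: "unit \<Rightarrow> 'c" where b: "range b \<subseteq> univ N" "tp L N (A \<union> a ` D) b = p"
    using saturated p A aD unfolding saturated_def by (metis Un_least)
  have "satisfiable_over \<Gamma> (insert v D) (a(v := b ()))"
    unfolding satisfiable_over_def
  proof (intro allI impI)
    fix \<Delta> assume \<Delta>: "finite \<Delta>" "\<Delta> \<subseteq> \<Gamma>"
    then have "X \<Delta> \<in> p" using p by (auto simp: P_def)
    then have "psat N b (X \<Delta>)" using b by (auto simp: tp_def)
    then obtain e where "range e \<subseteq> univ N" "e v = b ()" "\<forall>i\<in>D. e i = a i" "\<forall>\<phi>\<in>\<Delta>. psat N e \<phi>"
      using X2[OF \<Delta> b(1)] by blast
    then show "\<exists>e. range e \<subseteq> univ N \<and> (\<forall>i\<in>insert v D. e i = (a(v := b ())) i) \<and> (\<forall>\<phi>\<in>\<Delta>. psat N e \<phi>)"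
      using D by (intro exI[of _ e]) auto
  qed
  then show ?thesis using b(1) by blast
qed

text \<open>The variables are enumerated and given values one at a time, each choice keeping
  \<Gamma> finitely satisfiable. A formula sees only finitely many variables, so it is decided at a
  finite stage and holds for the limit tuple.\<close>

theorem realize:
  fixes \<Gamma> :: "('f, 'r, 'j + 'c) fml set"
  assumes A: "A \<subseteq> univ N" "|A| <o \<kappa>" and \<Gamma>: "\<Gamma> \<subseteq> pfmls L A" and cnt: "countable (UNIV :: 'j set)"
    and S: "\<And>\<Delta>. finite \<Delta> \<Longrightarrow> \<Delta> \<subseteq> \<Gamma> \<Longrightarrow> \<exists>e. range e \<subseteq> univ N \<and> (\<forall>\<phi>\<in>\<Delta>. psat N e \<phi>)"
  shows "\<exists>a. range a \<subseteq> univ N \<and> (\<forall>\<phi>\<in>\<Gamma>. psat N a \<phi>)"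
proof -
  obtain x0 where x0: "x0 \<in> univ N" using struct by (auto simp: is_struct_def)
  define f where "f = from_nat_into (UNIV :: 'j set)"
  have f: "range f = UNIV" using cnt by (simp add: f_def range_from_nat_into)
  define P where "P n a \<longleftrightarrow> range a \<subseteq> univ N \<and> satisfiable_over \<Gamma> (f ` {..<n}) a" for n a
  have "\<exists>s. \<forall>n. P n (s n) \<and> (\<forall>i\<in>f ` {..<n}. s (Suc n) i = s n i)"
  proof (rule dependent_nat_choice)
    show "\<exists>a. P 0 a" using S x0 by (intro exI[of _ "\<lambda>_. x0"]) (auto simp: P_def satisfiable_over_def)
    fix a n assume Pa: "P n a"
    show "\<exists>b. P (Suc n) b \<and> (\<forall>i\<in>f ` {..<n}. b i = a i)"
    proof (cases "f n \<in> f ` {..<n}")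
      case True
      then have "f ` {..<Suc n} = f ` {..<n}" by (auto simp: lessThan_Suc)
      then show ?thesis using Pa by (intro exI[of _ a]) (simp add: P_def)
    next
      case False
      have aD: "a ` f ` {..<n} \<subseteq> univ N" and Sa: "satisfiable_over \<Gamma> (f ` {..<n}) a" using Pa by (auto simp: P_def)
      obtain c where c: "c \<in> univ N" "satisfiable_over \<Gamma> (insert (f n) (f ` {..<n})) (a(f n := c))"
        using satisfiable_extend[OF A \<Gamma> _ False aD Sa] by auto
      have "insert (f n) (f ` {..<n}) = f ` {..<Suc n}" by (auto simp: lessThan_Suc)
      then have "P (Suc n) (a(f n := c))" using c Pa by (auto simp: P_def)
      moreover have "\<forall>i\<in>f ` {..<n}. (a(f n := c)) i = a i" using False by (metis fun_upd_other)
      ultimately show ?thesis by blast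
    qed
  qed
  then obtain s where s: "\<And>n. P n (s n)" "\<And>n i. i \<in> f ` {..<n} \<Longrightarrow> s (Suc n) i = s n i" by blast
  have mono: "s n i = s k i" if "k \<le> n" "i \<in> f ` {..<k}" for n k i
    using that(1)
  proof (induction n rule: dec_induct)
    case (step n)
    have "i \<in> f ` {..<n}" using that(2) step.hyps by auto
    then show ?case using s(2) step.IH by simp
  qed simp
  \<comment> \<open>One position of i in the enumeration, which may list i repeatedly. After stage
    \<open>Suc (k i)\<close> the value at i no longer changes.\<close>
  define k where "k i = (SOME n. f n = i)" for i
  have k: "f (k i) = i" for i unfolding k_def by (rule someI_ex) (use f in \<open>metis rangeE UNIV_I\<close>)
  define a where "a i = s (Suc (k i)) i" for i
  have "range a \<subseteq> univ N" using s(1) by (fastforce simp: a_def P_def)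
  moreover have "psat N a \<phi>" if \<phi>: "\<phi> \<in> \<Gamma>" for \<phi>
  proof -
    define W where "W = {i. Inl i \<in> fv \<phi>}"
    have "finite W" unfolding W_def using finite_fv[of \<phi>] finite_vimageI[of "fv \<phi>" Inl] by (simp add: vimage_def)
    then obtain n where n: "\<forall>i\<in>W. Suc (k i) \<le> n" by (meson finite_imageI finite_nat_set_iff_bounded_le image_eqI)
    have ai: "a i = s n i" "i \<in> f ` {..<n}" if "i \<in> W" for i
    proof -
      have "i \<in> f ` {..<Suc (k i)}" using k[of i] by force
      then show "a i = s n i" using mono[of "Suc (k i)" n i] n that by (simp add: a_def)
      show "i \<in> f ` {..<n}" using \<open>i \<in> f ` {..<Suc (k i)}\<close> n that by (meson image_mono lessThan_subset_iff subsetD)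
    qed
    obtain e where e: "\<forall>i\<in>f ` {..<n}. e i = s n i" "psat N e \<phi>"
      using s(1)[of n] \<phi> unfolding P_def satisfiable_over_def
      by (metis finite.emptyI finite.insertI insertI1 insert_subset empty_subsetI)
    have "psat N a \<phi> = psat N e \<phi>" 
    proof (rule psat_cong)
      fix i assume "Inl i \<in> fv \<phi>"
      then have "i \<in> W" by (simp add: W_def)
      with ai[of i] e(1) show "a i = e i" by metis
    qed
    then show ?thesis using e by simp
  qed
  ultimately show ?thesis by blast
qed

lemma realize_type:
  fixes p :: "('f, 'r, 'j + 'c) fml set"
  assumes A: "A \<subseteq> univ N" "|A| <o \<kappa>" and p: "p \<in> types L N A" and cnt: "countable (UNIV :: 'j set)"
  obtains a where "range a \<subseteq> univ N" "tp L N A a = p"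
proof -
  have "\<exists>a. range a \<subseteq> univ N \<and> (\<forall>\<phi>\<in>p. psat N a \<phi>)"
  proof (rule realize[OF A _ cnt])
    show "p \<subseteq> pfmls L A" using types_pfmls[OF p] by blast
    fix \<Delta> assume "finite \<Delta>" "\<Delta> \<subseteq> p"
    then show "\<exists>e. range e \<subseteq> univ N \<and> (\<forall>\<phi>\<in>\<Delta>. psat N e \<phi>)" using types_finsat[OF p] by metis
  qed
  then obtain a where a: "range a \<subseteq> univ N" "\<forall>\<phi>\<in>p. psat N a \<phi>" by blast
  then have "p \<subseteq> tp L N A a" using types_pfmls[OF p] by (auto simp: tp_def)
  then have "tp L N A a = p" using types_eqI[OF p tp_types[OF a(1)]] by simp
  then show ?thesis using that a by blast
qed

lemma psat_ren_param:
  "psat N a (ren g \<phi>) = sat N (case_sum a id \<circ> g) \<phi>"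
  by (simp add: psat_def sat_ren)

text \<open>The map sending each entry of a to that of a' and fixing A is well defined because the
  common type contains the equations between variables and those between a variable and a parameter.
  It is partial elementary by equality of types, so homogeneity extends it.\<close>

theorem tp_eq_Aut:
  fixes a a' :: "'j \<Rightarrow> 'c"
  assumes A: "A \<subseteq> univ N" "|A| <o \<kappa>" and cnt: "countable (UNIV :: 'j set)"
    and a: "range a \<subseteq> univ N" "range a' \<subseteq> univ N" and eq: "tp L N A a = tp L N A a'"
  obtains \<sigma> where "\<sigma> \<in> Aut_over L N A" "\<sigma> \<circ> a = a'"
proof -
  have eq': "psat N a \<phi> \<longleftrightarrow> psat N a' \<phi>" if "\<phi> \<in> pfmls L A" for \<phi>
    using eq that unfolding tp_def by blast
  have E: "Eq (Free u) (Free v) \<in> pfmls L A" if "\<forall>c. Inr c \<in> {u, v} \<longrightarrow> c \<in> A" for u v :: "'j + 'c"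
    using that by (auto simp: pfmls_def fmls_def)
  have psE: "psat N b (Eq (Free u) (Free v)) \<longleftrightarrow> case_sum b id u = case_sum b id v" for b :: "'j \<Rightarrow> 'c" and u v
    by (simp add: psat_def sat_def)
  define g where "g x = (if x \<in> range a then a' (SOME i. a i = x) else x)" for x
  have ga: "g (a i) = a' i" for i
  proof -
    define j where "j = (SOME k. a k = a i)"
    have "a j = a i" unfolding j_def by (rule someI[of _ i]) simp
    then have "psat N a (Eq (Free (Inl j)) (Free (Inl i)))" by (simp add: psE)
    then have "a' j = a' i" using eq'[OF E, of "Inl j" "Inl i"] by (simp add: psE)
    then show ?thesis by (simp add: g_def j_def)
  qed
  have gA: "g x = x" if "x \<in> A" for x
  proof (cases "x \<in> range a")
    case True
    then obtain i where i: "x = a i" by blast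
    then have "psat N a (Eq (Free (Inl i)) (Free (Inr x)))" by (simp add: psE)
    then have "a' i = x" using eq'[OF E, of "Inl i" "Inr x"] that by (simp add: psE)
    then show ?thesis using ga i by simp
  qed (simp add: g_def)
  have "partial_elementary L N (A \<union> range a) g"
    unfolding partial_elementary_def
  proof (intro conjI ballI allI impI)
    show "A \<union> range a \<subseteq> univ N" using A a by simp
    show "g ` (A \<union> range a) \<subseteq> univ N" using A a ga gA by (auto simp: image_Un image_subset_iff)
    fix \<phi> :: "('f, 'r, nat) fml" and e :: "nat \<Rightarrow> 'c" assume \<phi>: "\<phi> \<in> fmls L" and e: "range e \<subseteq> A \<union> range a"
    \<comment> \<open>Entries from A become parameters, all others become variables of the type.
      Giving A priority makes the result an L(A)-formula.\<close>
    define k where "k n = (if e n \<in> A then Inr (e n) else Inl (SOME i. a i = e n))" for n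
    have "a (SOME i. a i = e n) = e n" if "e n \<notin> A" for n
      by (rule someI_ex) (use e that in \<open>metis UnE rangeE range_subsetD\<close>)
    then have ke: "case_sum a id (k n) = e n" "case_sum a' id (k n) = g (e n)" for n
      using ga[of "SOME i. a i = e n"] gA by (auto simp: k_def)
    have "ren k \<phi> \<in> pfmls L A" using \<phi> by (auto simp: pfmls_def fml.set_map k_def split: if_splits)
    from eq'[OF this] show "sat N e \<phi> \<longleftrightarrow> sat N (g \<circ> e) \<phi>"
      by (simp add: psat_ren_param comp_def ke)
  qed
  moreover have "|A \<union> range a| <o \<kappa>"
    using cnt by (intro small_Un A small_countable) auto
  ultimately obtain \<sigma> where \<sigma>: "\<sigma> \<in> Aut L N" "\<forall>x\<in>A \<union> range a. \<sigma> x = g x"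
    using homogeneous unfolding strongly_homogeneous_def by blast
  then have "\<sigma> \<in> Aut_over L N A" "\<sigma> \<circ> a = a'" using gA ga by (auto simp: Aut_over_def)
  then show ?thesis using that by blast
qed

end

section \<open>Regular Borel measures from contents on clopen algebras\<close>

lemma space_borel_of: "space (borel_of X) = topspace X"
  unfolding borel_of_def by (rule space_measure_of) (auto dest: openin_subset)

lemma sets_borel_of: "sets (borel_of X) = sigma_sets (topspace X) {U. openin X U}"
  unfolding borel_of_def by (rule sets_measure_of) (auto dest: openin_subset)

text \<open>Abstracts the values of a Keisler measure on the clopen algebra of a type space. The
  global type space need not have a countable base, so its Borel sets can go beyond those generated
  by the clopen sets; this is why regularity is part of both existence and uniqueness of the
  extension.\<close>

locale clopen_content =
  fixes X :: "'a topology" and \<B> :: "'a set set" and \<nu> :: "'a set \<Rightarrow> real"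
  assumes compact: "compact_space X"
    and alg: "algebra (topspace X) \<B>"
    and clopen: "B \<in> \<B> \<Longrightarrow> openin X B"
    and basis: "openin X U \<Longrightarrow> x \<in> U \<Longrightarrow> \<exists>B\<in>\<B>. x \<in> B \<and> B \<subseteq> U"
    and nonneg: "B \<in> \<B> \<Longrightarrow> 0 \<le> \<nu> B"
    and total: "\<nu> (topspace X) = 1"
    and additive: "A \<in> \<B> \<Longrightarrow> B \<in> \<B> \<Longrightarrow> A \<inter> B = {} \<Longrightarrow> \<nu> (A \<union> B) = \<nu> A + \<nu> B"
begin

sublocale algebra "topspace X" \<B> by (rule alg)

lemma closed: "B \<in> \<B> \<Longrightarrow> closedin X B"
  unfolding closedin_def using clopen compl_sets sets_into_space by auto

lemma nu_empty: "\<nu> {} = 0"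
  using additive[of "{}" "{}"] by simp

lemma nu_mono:
  assumes "A \<in> \<B>" "B \<in> \<B>" "A \<subseteq> B"
  shows "\<nu> A \<le> \<nu> B"
proof -
  have "\<nu> (A \<union> (B - A)) = \<nu> A + \<nu> (B - A)" using assms by (intro additive) auto
  moreover have "A \<union> (B - A) = B" using assms by auto
  ultimately show ?thesis using nonneg[of "B - A"] assms by auto
qed

lemma nu_subadd:
  assumes "A \<in> \<B>" "B \<in> \<B>"
  shows "\<nu> (A \<union> B) \<le> \<nu> A + \<nu> B"
proof -
  have "\<nu> (A \<union> (B - A)) = \<nu> A + \<nu> (B - A)" using assms by (intro additive) auto
  moreover have "\<nu> (B - A) \<le> \<nu> B" using assms by (intro nu_mono) auto
  ultimately show ?thesis by simp
qed

lemma nu_finite_subadd: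
  assumes "\<And>n. n < k \<Longrightarrow> D n \<in> \<B>"
  shows "(\<Union>n<k. D n) \<in> \<B> \<and> \<nu> (\<Union>n<k. D n) \<le> (\<Sum>n<(k::nat). \<nu> (D n))"
  using assms
proof (induction k)
  case 0
  then show ?case by (simp add: nu_empty)
next
  case (Suc k)
  then have IH: "(\<Union>n<k. D n) \<in> \<B>" "\<nu> (\<Union>n<k. D n) \<le> (\<Sum>n<k. \<nu> (D n))" by auto
  have eq: "(\<Union>n<Suc k. D n) = (\<Union>n<k. D n) \<union> D k" by (auto simp: lessThan_Suc)
  then show ?case unfolding eq using IH Suc.prems nu_subadd[of "\<Union>n<k. D n" "D k"] by auto
qed

lemma compact_basic_cover:
  assumes K: "compactin X K" "K \<subseteq> U" and U: "openin X U"
  obtains B where "B \<in> \<B>" "K \<subseteq> B" "B \<subseteq> U"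
proof -
  have "K \<subseteq> \<Union>{B\<in>\<B>. B \<subseteq> U}"
  proof
    fix x assume "x \<in> K"
    then have "x \<in> U" using K by auto
    from basis[OF U this] show "x \<in> \<Union>{B\<in>\<B>. B \<subseteq> U}" by blast
  qed
  then obtain \<F> where \<F>: "finite \<F>" "\<F> \<subseteq> {B\<in>\<B>. B \<subseteq> U}" "K \<subseteq> \<Union>\<F>"
    using K(1) clopen unfolding compactin_def by (metis (mono_tags, lifting) mem_Collect_eq)
  have "\<Union>\<F> \<in> \<B>" using \<F> by (intro finite_Union) auto
  then show ?thesis using that[of "\<Union>\<F>"] \<F> by auto
qed

text \<open>A clopen set is compact, so a countable open cover shrinks to finitely many clopen
  pieces. These are grouped by the open set they lie in, so that each open set is charged
  once.\<close>

lemma countable_cover: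
  fixes U :: "nat \<Rightarrow> 'a set"
  assumes B: "B \<in> \<B>" and U: "\<And>n. openin X (U n)" and BU: "B \<subseteq> (\<Union>n. U n)"
  obtains k D where "\<And>n. n < k \<Longrightarrow> D n \<in> \<B> \<and> D n \<subseteq> U n" "B \<subseteq> (\<Union>n<k. D n)"
proof -
  have "compactin X B" using compact closed[OF B] by (rule closedin_compact_space)
  moreover have "B \<subseteq> \<Union>{D\<in>\<B>. \<exists>n. D \<subseteq> U n}"
  proof
    fix x assume "x \<in> B"
    then obtain n where "x \<in> U n" using BU by auto
    from basis[OF U this] show "x \<in> \<Union>{D\<in>\<B>. \<exists>n. D \<subseteq> U n}" by blast
  qed
  ultimately obtain \<F> where \<F>: "finite \<F>" "\<F> \<subseteq> {D\<in>\<B>. \<exists>n. D \<subseteq> U n}" "B \<subseteq> \<Union>\<F>"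
    using clopen unfolding compactin_def by (metis (mono_tags, lifting) mem_Collect_eq)
  then have "\<forall>D\<in>\<F>. \<exists>n. D \<subseteq> U n" by auto
  then obtain f where f: "\<forall>D\<in>\<F>. D \<subseteq> U (f D)" by metis
  obtain k where k: "\<forall>D\<in>\<F>. f D < k" using \<F>(1) by (meson finite_imageI finite_nat_set_iff_bounded imageI)
  define D where "D n = \<Union>{E\<in>\<F>. f E = n}" for n
  have "D n \<in> \<B> \<and> D n \<subseteq> U n" for n
    unfolding D_def using \<F> f by (intro conjI finite_Union) auto
  moreover have "B \<subseteq> (\<Union>n<k. D n)" using \<F>(3) k by (fastforce simp: D_def)
  ultimately show ?thesis using that[of k D] by blast
qed

section \<open>The outer measure induced by a clopen content\<close>

definition lam :: "'a set \<Rightarrow> ennreal" where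
  "lam U = (SUP B\<in>{B\<in>\<B>. B \<subseteq> U}. ennreal (\<nu> B))"

text \<open>\<open>lam\<close> measures open sets from inside by clopen sets, \<open>out\<close>
  measures arbitrary sets from outside by open sets, so outer regularity of the extension holds by
  construction.\<close>

definition out :: "'a set \<Rightarrow> ennreal" where
  "out A = (INF U\<in>{U. openin X U \<and> A \<subseteq> U}. lam U)"

lemma lam_upper: "B \<in> \<B> \<Longrightarrow> B \<subseteq> U \<Longrightarrow> ennreal (\<nu> B) \<le> lam U"
  unfolding lam_def by (rule SUP_upper) auto

lemma lam_mono: "U \<subseteq> V \<Longrightarrow> lam U \<le> lam V"
  unfolding lam_def by (rule SUP_subset_mono) auto

lemma lam_basic: "B \<in> \<B> \<Longrightarrow> lam B = ennreal (\<nu> B)"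
  by (rule antisym[OF _ lam_upper]) (auto simp: lam_def intro!: SUP_least ennreal_leI nu_mono)

lemma out_le_lam: "openin X U \<Longrightarrow> A \<subseteq> U \<Longrightarrow> out A \<le> lam U"
  unfolding out_def by (rule INF_lower) auto

lemma out_open:
  assumes U: "openin X U" shows "out U = lam U"
proof (rule antisym)
  show "lam U \<le> out U" unfolding out_def by (rule INF_greatest) (auto intro: lam_mono)
qed (use U in \<open>auto intro: out_le_lam\<close>)

lemma out_mono: "A \<subseteq> B \<Longrightarrow> out A \<le> out B"
  unfolding out_def by (rule INF_superset_mono) auto

lemma out_le_1: "A \<subseteq> topspace X \<Longrightarrow> out A \<le> 1"
  using out_le_lam[of "topspace X" A] lam_basic[OF top] total by simp

lemma out_empty: "out {} = 0"
  using out_open[of "{}"] lam_basic[OF empty_sets] nu_empty by simp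

text \<open>By compactness a clopen set inside the union is covered by finitely many clopen pieces,
  each inside one of the open sets, so finite subadditivity of the content suffices.\<close>

lemma lam_countably_subadditive:
  assumes U: "\<And>n. openin X (U n)"
  shows "lam (\<Union>n. U n) \<le> (\<Sum>n. lam (U n))"
  unfolding lam_def[of "\<Union>n. U n"]
proof (rule SUP_least)
  fix B assume "B \<in> {B \<in> \<B>. B \<subseteq> (\<Union>n. U n)}"
  then have B: "B \<in> \<B>" "B \<subseteq> (\<Union>n. U n)" by auto
  obtain k D where D: "\<And>n. n < k \<Longrightarrow> D n \<in> \<B> \<and> D n \<subseteq> U n" "B \<subseteq> (\<Union>n<k. D n)"
    using countable_cover[OF B(1) U B(2)] by blast
  have fs: "(\<Union>n<k. D n) \<in> \<B>" "\<nu> (\<Union>n<k. D n) \<le> (\<Sum>n<k. \<nu> (D n))"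
    using nu_finite_subadd[of k D] D(1) by auto
  have "\<nu> B \<le> (\<Sum>n<k. \<nu> (D n))" using nu_mono[OF B(1) fs(1) D(2)] fs(2) by simp
  then have "ennreal (\<nu> B) \<le> ennreal (\<Sum>n<k. \<nu> (D n))" by (rule ennreal_leI)
  also have "\<dots> = (\<Sum>n<k. ennreal (\<nu> (D n)))" using D(1) nonneg by (intro sum_ennreal[symmetric]) auto
  also have "\<dots> \<le> (\<Sum>n<k. lam (U n))" using D(1) by (intro sum_mono lam_upper) auto
  also have "\<dots> \<le> (\<Sum>n. lam (U n))" by (intro sum_le_suminf) auto
  finally show "ennreal (\<nu> B) \<le> (\<Sum>n. lam (U n))" .
qed

lemma out_approx:
  assumes "A \<subseteq> topspace X" "0 < (e::real)"
  obtains U where "openin X U" "A \<subseteq> U" "lam U \<le> out A + ennreal e"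
proof -
  have "out A < top" using out_le_1[OF assms(1)] by (metis ennreal_one_less_top order_le_less_trans)
  then have "out A < out A + ennreal e" using assms(2) by simp
  then obtain U where "openin X U" "A \<subseteq> U" "lam U < out A + ennreal e"
    unfolding out_def INF_less_iff by auto
  then show ?thesis using that by (meson less_imp_le)
qed

lemma outer_measure_out: "outer_measure_space (Pow (topspace X)) out"
  unfolding outer_measure_space_def
proof (intro conjI)
  show "positive (Pow (topspace X)) out" by (simp add: positive_def out_empty)
  show "increasing (Pow (topspace X)) out" by (auto simp: increasing_def intro: out_mono)
  show "countably_subadditive (Pow (topspace X)) out"
    unfolding countably_subadditive_def
  proof (intro allI impI)
    fix A :: "nat \<Rightarrow> 'a set" assume A: "range A \<subseteq> Pow (topspace X)"
    show "out (\<Union>i. A i) \<le> (\<Sum>i. out (A i))"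
    proof (rule ennreal_le_epsilon)
      fix e :: real assume e: "0 < e"
      have "\<exists>U. openin X U \<and> A n \<subseteq> U \<and> lam U \<le> out (A n) + ennreal (e * (1/2) ^ Suc n)" for n
        using out_approx[of "A n" "e * (1/2) ^ Suc n"] A e by (metis PowD range_subsetD zero_less_divide_1_iff zero_less_mult_iff zero_less_numeral zero_less_power)
      then obtain U where U: "\<And>n. openin X (U n)" "\<And>n. A n \<subseteq> U n"
        "\<And>n. lam (U n) \<le> out (A n) + ennreal (e * (1/2) ^ Suc n)" by metis
      have "out (\<Union>i. A i) \<le> lam (\<Union>n. U n)" using U by (intro out_le_lam UN_mono openin_Union) auto
      also have "\<dots> \<le> (\<Sum>n. lam (U n))" using U by (intro lam_countably_subadditive)
      also have "\<dots> \<le> (\<Sum>n. out (A n) + ennreal (e * (1/2) ^ Suc n))"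
        using U by (intro suminf_le) auto
      also have "\<dots> = (\<Sum>n. out (A n)) + (\<Sum>n. ennreal e * ennreal ((1/2) ^ Suc n))"
        using \<open>0 < e\<close> by (subst suminf_add[symmetric])
                       (auto simp del: ennreal_suminf_cmult simp add: ennreal_mult[symmetric])
      also have "\<dots> = (\<Sum>n. out (A n)) + e"
        unfolding ennreal_suminf_cmult
        by (subst suminf_ennreal_eq[OF zero_le_power power_half_series]) auto
      finally show "out (\<Union>i. A i) \<le> (\<Sum>n. out (A n)) + e" .
    qed
  qed
qed

text \<open>Two suprema in succession, over clopen B inside U \<inter> V and over clopen D inside V
  - B. Such B and D are disjoint subsets of V, and the open set V - B contains V - U.\<close>

lemma open_superadditive:
  assumes U: "openin X U" and V: "openin X V"
  shows "out (U \<inter> V) + out (V - U) \<le> lam V"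
proof -
  have UV: "openin X (U \<inter> V)" using U V by blast
  have "out (U \<inter> V) + out (V - U) = (SUP B\<in>{B\<in>\<B>. B \<subseteq> U \<inter> V}. ennreal (\<nu> B) + out (V - U))"
    unfolding out_open[OF UV] lam_def
    by (rule ennreal_SUP_add_left[symmetric]) (auto intro: exI[of _ "{}"])
  also have "\<dots> \<le> lam V"
  proof (rule SUP_least)
    fix B assume "B \<in> {B\<in>\<B>. B \<subseteq> U \<inter> V}"
    then have B: "B \<in> \<B>" "B \<subseteq> U \<inter> V" by auto
    have VB: "openin X (V - B)" using V closed[OF B(1)] by (rule openin_diff)
    have "ennreal (\<nu> B) + out (V - U) \<le> ennreal (\<nu> B) + lam (V - B)"
      using B by (intro add_left_mono out_le_lam VB) auto
    also have "\<dots> = (SUP D\<in>{D\<in>\<B>. D \<subseteq> V - B}. ennreal (\<nu> B) + ennreal (\<nu> D))"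
      unfolding lam_def by (rule ennreal_SUP_add_right) (auto intro: exI[of _ "{}"])
    also have "\<dots> \<le> lam V"
    proof (rule SUP_least)
      fix D assume "D \<in> {D\<in>\<B>. D \<subseteq> V - B}"
      then have D: "D \<in> \<B>" "D \<subseteq> V - B" by auto
      have "ennreal (\<nu> B) + ennreal (\<nu> D) = ennreal (\<nu> (B \<union> D))"
        using B D nonneg by (subst additive) auto
      also have "\<dots> \<le> lam V" using B D by (intro lam_upper) auto
      finally show "ennreal (\<nu> B) + ennreal (\<nu> D) \<le> lam V" .
    qed
    finally show "ennreal (\<nu> B) + out (V - U) \<le> lam V" .
  qed
  finally show ?thesis .
qed

interpretation P: sigma_algebra "topspace X" "Pow (topspace X)"
  by (rule sigma_algebra_Pow)

text \<open>Caratheodory's condition for an arbitrary A reduces through the infimum in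
  \<open>out\<close> to open test sets, where it is superadditivity.\<close>

lemma open_in_lambda_system:
  assumes U: "openin X U"
  shows "U \<in> lambda_system (topspace X) (Pow (topspace X)) out"
  unfolding lambda_system_def
proof (intro CollectI conjI ballI)
  show "U \<in> Pow (topspace X)" using openin_subset[OF U] by simp
  fix A assume "A \<in> Pow (topspace X)"
  then have A: "A \<subseteq> topspace X" by simp
  show "out (U \<inter> A) + out ((topspace X - U) \<inter> A) = out A"
  proof (rule antisym)
    show "out (U \<inter> A) + out ((topspace X - U) \<inter> A) \<le> out A"
      unfolding out_def[of A]
    proof (rule INF_greatest)
      fix V assume "V \<in> {V. openin X V \<and> A \<subseteq> V}"
      then have V: "openin X V" "A \<subseteq> V" by auto
      have "out (U \<inter> A) + out ((topspace X - U) \<inter> A) \<le> out (U \<inter> V) + out (V - U)"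
        using V by (intro add_mono out_mono) auto
      also have "\<dots> \<le> lam V" by (rule open_superadditive[OF U V(1)])
      finally show "out (U \<inter> A) + out ((topspace X - U) \<inter> A) \<le> lam V" .
    qed
    have "subadditive (Pow (topspace X)) out"
      using outer_measure_out P.countably_subadditive_subadditive unfolding outer_measure_space_def by blast
    from subadditiveD[OF this, of "U \<inter> A" "(topspace X - U) \<inter> A"]
    have "out (U \<inter> A \<union> (topspace X - U) \<inter> A) \<le> out (U \<inter> A) + out ((topspace X - U) \<inter> A)" using A by auto
    moreover have "U \<inter> A \<union> (topspace X - U) \<inter> A = A" using A by auto
    ultimately show "out A \<le> out (U \<inter> A) + out ((topspace X - U) \<inter> A)" by simp
  qed
qed

definition ext :: "'a measure" where
  "ext = measure_of (topspace X) {U. openin X U} out"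

lemma opens_Pow: "{U. openin X U} \<subseteq> Pow (topspace X)"
  using openin_subset by auto

lemma measure_space_ext: "measure_space (topspace X) (sigma_sets (topspace X) {U. openin X U}) out"
proof -
  have ms: "measure_space (topspace X) (lambda_system (topspace X) (Pow (topspace X)) out) out"
    by (rule P.caratheodory_lemma[OF outer_measure_out])
  then have "sigma_algebra (topspace X) (lambda_system (topspace X) (Pow (topspace X)) out)"
    by (simp add: measure_space_def)
  from sigma_algebra.sigma_sets_subset[OF this, of "{U. openin X U}"]
  have "sigma_sets (topspace X) {U. openin X U} \<subseteq> lambda_system (topspace X) (Pow (topspace X)) out"
    using open_in_lambda_system by auto
  then show ?thesis by (rule measure_down[OF ms sigma_algebra_sigma_sets[OF opens_Pow]])
qed

lemma space_ext: "space ext = topspace X"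
  unfolding ext_def by (rule space_measure_of[OF opens_Pow])

lemma sets_ext: "sets ext = sigma_sets (topspace X) {U. openin X U}"
  unfolding ext_def by (rule sets_measure_of[OF opens_Pow])

lemma emeasure_ext: "A \<in> sets ext \<Longrightarrow> emeasure ext A = out A"
  unfolding ext_def
  by (rule emeasure_measure_of[OF refl opens_Pow]) (use measure_space_ext opens_Pow in \<open>auto simp: measure_space_def\<close>)

lemma prob_ext: "prob_space ext"
proof
  have "topspace X \<in> sets ext" unfolding sets_ext by (rule sigma_sets_top)
  then show "emeasure ext (space ext) = 1"
    using lam_basic[OF top] total by (simp add: emeasure_ext out_open space_ext)
qed

lemma open_sets_ext: "openin X U \<Longrightarrow> U \<in> sets ext"
  unfolding sets_ext by (auto intro: sigma_sets.Basic)

text \<open>Outer regularity is the definition of \<open>out\<close>. Inner regularity follows by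
  taking complements, closed sets being compact here.\<close>

lemma regular_ext: "regular_borel_prob X ext"
  unfolding regular_borel_prob_def
proof (intro conjI ballI prob_ext space_ext)
  interpret E: prob_space ext by (rule prob_ext)
  show "sets ext = sets (borel_of X)" by (simp add: sets_ext sets_borel_of)
  have outer: "emeasure ext B = (INF U\<in>{U. openin X U \<and> B \<subseteq> U}. emeasure ext U)" if "B \<in> sets ext" for B
    unfolding emeasure_ext[OF that] out_def[of B]
    by (rule INF_cong[OF refl]) (auto simp: emeasure_ext open_sets_ext out_open)
  fix B assume B: "B \<in> sets ext"
  show "emeasure ext B = (INF U\<in>{U. openin X U \<and> B \<subseteq> U}. emeasure ext U)" by (rule outer[OF B])
  have BX: "B \<subseteq> topspace X" using sets.sets_into_space[OF B] by (simp add: space_ext)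
  show "emeasure ext B = (SUP K\<in>{K. compactin X K \<and> K \<subseteq> B}. emeasure ext K)"
  proof (rule antisym)
    show "emeasure ext B \<le> (SUP K\<in>{K. compactin X K \<and> K \<subseteq> B}. emeasure ext K)"
    proof (rule ennreal_le_epsilon)
      fix e :: real assume e: "0 < e"
      have cB: "topspace X - B \<in> sets ext" using sets.compl_sets[OF B] by (simp add: space_ext)
      obtain U where U: "openin X U" "topspace X - B \<subseteq> U" "lam U \<le> out (topspace X - B) + ennreal e"
        using out_approx[of "topspace X - B" e] e by auto
      define K where "K = topspace X - U"
      have K: "closedin X K" "K \<subseteq> B" using U BX by (auto simp: K_def)
      have Ks: "K \<in> sets ext" unfolding K_def
        using sets.compl_sets[OF open_sets_ext[OF U(1)]] by (simp add: space_ext)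
      have "measure ext U \<le> measure ext (topspace X - B) + e"
      proof -
        have "emeasure ext U \<le> emeasure ext (topspace X - B) + ennreal e"
          using U(3) by (simp add: emeasure_ext cB open_sets_ext U(1) out_open)
        then show ?thesis using e
          by (simp add: E.emeasure_eq_measure flip: ennreal_plus)
      qed
      moreover have "measure ext (topspace X - B) = 1 - measure ext B"
        using E.prob_compl[OF B] by (simp add: space_ext)
      moreover have "measure ext K = 1 - measure ext U"
        using E.prob_compl[OF open_sets_ext[OF U(1)]] by (simp add: space_ext K_def)
      ultimately have "measure ext B \<le> measure ext K + e" by simp
      then have "emeasure ext B \<le> emeasure ext K + ennreal e"
        using e by (simp add: E.emeasure_eq_measure flip: ennreal_plus)
      also have "emeasure ext K \<le> (SUP K\<in>{K. compactin X K \<and> K \<subseteq> B}. emeasure ext K)"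
        using K closedin_compact_space[OF compact K(1)] by (intro SUP_upper) auto
      finally show "emeasure ext B \<le> (SUP K\<in>{K. compactin X K \<and> K \<subseteq> B}. emeasure ext K) + ennreal e"
        by (simp add: add_right_mono)
    qed
    show "(SUP K\<in>{K. compactin X K \<and> K \<subseteq> B}. emeasure ext K) \<le> emeasure ext B"
      using B by (intro SUP_least emeasure_mono) auto
  qed
qed

lemma measure_ext:
  assumes "B \<in> \<B>" shows "measure ext B = \<nu> B"
  using assms nonneg by (simp add: measure_def emeasure_ext open_sets_ext clopen out_open lam_basic)

text \<open>A compact subset of an open U fits inside a clopen subset of U. Inner regularity
  therefore fixes the measure on open sets, and outer regularity then fixes it everywhere.\<close>

lemma regular_unique:
  assumes N: "regular_borel_prob X N" "\<And>B. B \<in> \<B> \<Longrightarrow> measure N B = \<nu> B"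
  shows "N = ext"
proof (rule measure_eqI)
  have N': "space N = topspace X" "sets N = sets (borel_of X)" "prob_space N"
    "\<And>B. B \<in> sets N \<Longrightarrow> emeasure N B = (SUP K\<in>{K. compactin X K \<and> K \<subseteq> B}. emeasure N K)"
    "\<And>B. B \<in> sets N \<Longrightarrow> emeasure N B = (INF U\<in>{U. openin X U \<and> B \<subseteq> U}. emeasure N U)"
    using N(1) unfolding regular_borel_prob_def by blast+
  interpret N: prob_space N by (rule N'(3))
  show sets: "sets N = sets ext" using N'(2) by (simp add: sets_ext sets_borel_of)
  have open_eq: "emeasure N U = lam U" if U: "openin X U" for U
  proof (rule antisym)
    have Us: "U \<in> sets N" using open_sets_ext[OF U] sets by simp
    show "emeasure N U \<le> lam U"
      unfolding N'(4)[OF Us]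
    proof (rule SUP_least)
      fix K assume "K \<in> {K. compactin X K \<and> K \<subseteq> U}"
      then obtain B where B: "B \<in> \<B>" "K \<subseteq> B" "B \<subseteq> U" using compact_basic_cover[OF _ _ U] by blast
      have "emeasure N K \<le> emeasure N B"
        using B open_sets_ext[OF clopen[OF B(1)]] sets by (intro emeasure_mono) auto
      also have "\<dots> = ennreal (\<nu> B)" using N(2)[OF B(1)] by (simp add: N.emeasure_eq_measure)
      also have "\<dots> \<le> lam U" using B by (intro lam_upper)
      finally show "emeasure N K \<le> lam U" .
    qed
    show "lam U \<le> emeasure N U"
      unfolding lam_def
    proof (rule SUP_least)
      fix B assume "B \<in> {B\<in>\<B>. B \<subseteq> U}"
      then have B: "B \<in> \<B>" "B \<subseteq> U" by auto
      have "ennreal (\<nu> B) = emeasure N B" using N(2)[OF B(1)] by (simp add: N.emeasure_eq_measure)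
      also have "\<dots> \<le> emeasure N U" using B Us by (intro emeasure_mono) auto
      finally show "ennreal (\<nu> B) \<le> emeasure N U" .
    qed
  qed
  fix A assume A: "A \<in> sets N"
  have "emeasure N A = out A" unfolding N'(5)[OF A] out_def
    by (rule INF_cong[OF refl]) (simp add: open_eq)
  then show "emeasure N A = emeasure ext A" using A sets by (simp add: emeasure_ext)
qed

end

section \<open>Type spaces\<close>

definition basic ::
  "('f, 'r) lang \<Rightarrow> ('f, 'r, 'c) struct \<Rightarrow> 'c set \<Rightarrow> ('f, 'r, 'j + 'c) fml \<Rightarrow> ('f, 'r, 'j + 'c) fml set set" where
  "basic L N A \<phi> = {p \<in> types L N A. \<phi> \<in> p}"

lemma basic_subset: "basic L N A \<phi> \<subseteq> types L N A"
  by (auto simp: basic_def)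

lemma basic_And:
  "\<phi> \<in> pfmls L A \<Longrightarrow> \<psi> \<in> pfmls L A \<Longrightarrow> basic L N A (And \<phi> \<psi>) = basic L N A \<phi> \<inter> basic L N A \<psi>"
  by (auto simp: basic_def types_And)

lemma basic_Neg:
  "\<phi> \<in> pfmls L A \<Longrightarrow> basic L N A (Neg \<phi>) = types L N A - basic L N A \<phi>"
  by (auto simp: basic_def types_Neg)

lemma basic_tt:
  assumes "univ N \<noteq> {}" shows "basic L N A tt = types L N A"
  using tt_types[OF assms] by (auto simp: basic_def)

lemma type_topology_alt: "type_topology L N A = topology_generated_by (basic L N A ` pfmls L A)"
  by (simp add: type_topology_def basic_def)

lemma openin_basic: "\<phi> \<in> pfmls L A \<Longrightarrow> openin (type_topology L N A) (basic L N A \<phi>)"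
  unfolding type_topology_alt by (intro topology_generated_by_Basis) auto

lemma topspace_type_topology:
  assumes "univ N \<noteq> {}"
  shows "topspace (type_topology L N A) = types L N A"
proof -
  have "types L N A \<in> basic L N A ` pfmls L A"
    using basic_tt[OF assms] tt_pfmls by (metis image_eqI)
  then show ?thesis unfolding type_topology_alt topology_generated_by_topspace
    using basic_subset by blast
qed

lemma type_topology_basis:
  assumes U: "openin (type_topology L N A) U" and p: "p \<in> U"
  obtains \<phi> where "\<phi> \<in> pfmls L A" "\<phi> \<in> p" "basic L N A \<phi> \<subseteq> U" "p \<in> basic L N A \<phi>"
proof -
  have "generate_topology_on (basic L N A ` pfmls L A) U"
    using U unfolding type_topology_alt by (rule openin_topology_generated_by)
  then have "\<forall>p\<in>U. \<exists>\<phi>\<in>pfmls L A. p \<in> basic L N A \<phi> \<and> basic L N A \<phi> \<subseteq> U"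
  proof induction
    case (Int a b)
    show ?case
    proof
      fix p assume "p \<in> a \<inter> b"
      then obtain \<phi> \<psi> where "\<phi> \<in> pfmls L A" "p \<in> basic L N A \<phi>" "basic L N A \<phi> \<subseteq> a"
        "\<psi> \<in> pfmls L A" "p \<in> basic L N A \<psi>" "basic L N A \<psi> \<subseteq> b" using Int.IH by blast
      then show "\<exists>\<phi>\<in>pfmls L A. p \<in> basic L N A \<phi> \<and> basic L N A \<phi> \<subseteq> a \<inter> b"
        by (intro bexI[of _ "And \<phi> \<psi>"]) (auto simp: basic_And)
    qed
  next
    case (UN K)
    then show ?case by (meson Union_iff Union_upper order_trans)
  qed auto
  then show ?thesis using p that unfolding basic_def by blast
qed

text \<open>Consider the formulas whose basic set lies inside a member of the cover. Without a
  finite subcover their negations are finitely satisfiable, hence contained in a type; but that type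
  lies in a member of the cover and so contains one of the formulas.\<close>

lemma compact_type_topology:
  fixes L :: "('f, 'r) lang" and N :: "('f, 'r, 'c) struct"
  assumes ne: "univ N \<noteq> {}"
  shows "compact_space (type_topology L N A :: ('f, 'r, 'j + 'c) fml set topology)"
  unfolding compact_space_def compactin_def
proof (intro conjI allI impI)
  let ?X = "type_topology L N A :: ('f, 'r, 'j + 'c) fml set topology"
  fix \<U> :: "('f, 'r, 'j + 'c) fml set set set" assume \<U>: "(\<forall>U\<in>\<U>. openin ?X U) \<and> topspace ?X \<subseteq> \<Union>\<U>"
  show "\<exists>\<F>. finite \<F> \<and> \<F> \<subseteq> \<U> \<and> topspace ?X \<subseteq> \<Union>\<F>"
  proof (rule ccontr)
    assume no: "\<not> ?thesis"
    define \<Phi> where "\<Phi> = {\<phi> \<in> pfmls L A :: ('f, 'r, 'j + 'c) fml set. \<exists>U\<in>\<U>. basic L N A \<phi> \<subseteq> U}"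
    have "\<exists>p. p \<in> types L N A \<and> Neg ` \<Phi> \<subseteq> p"
    proof (rule complete_type[of "Neg ` \<Phi>" L A "{a. range a \<subseteq> univ N}" N])
      show "Neg ` \<Phi> \<subseteq> pfmls L A" by (auto simp: \<Phi>_def)
      fix \<Delta> assume "finite \<Delta>" "\<Delta> \<subseteq> Neg ` \<Phi>"
      then obtain E where E: "finite E" "E \<subseteq> \<Phi>" "\<Delta> = Neg ` E" by (meson finite_subset_image)
      show "\<exists>a\<in>{a. range a \<subseteq> univ N}. \<forall>\<phi>\<in>\<Delta>. psat N a \<phi>"
      proof (rule ccontr)
        assume neg: "\<not> ?thesis"
        have "\<forall>\<phi>\<in>E. \<exists>U\<in>\<U>. basic L N A \<phi> \<subseteq> U" using E by (auto simp: \<Phi>_def)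
        then obtain u where u: "\<forall>\<phi>\<in>E. u \<phi> \<in> \<U> \<and> basic L N A \<phi> \<subseteq> u \<phi>" by metis
        have "topspace ?X \<subseteq> \<Union>(u ` E)"
        proof
          fix p assume "p \<in> topspace ?X"
          then have p: "p \<in> types L N A" using topspace_type_topology[OF ne] by blast
          have "\<exists>\<phi>\<in>E. \<phi> \<in> p"
          proof (rule ccontr)
            assume "\<not> (\<exists>\<phi>\<in>E. \<phi> \<in> p)"
            then have "\<Delta> \<subseteq> p" using E p by (auto simp: types_Neg \<Phi>_def)
            then obtain a where "range a \<subseteq> univ N" "\<And>\<phi>. \<phi> \<in> \<Delta> \<Longrightarrow> psat N a \<phi>"
              using types_finsat[OF p \<open>finite \<Delta>\<close>] by metis
            then show False using neg by blast
          qed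
          then show "p \<in> \<Union>(u ` E)" using u p by (auto simp: basic_def)
        qed
        then show False using no u E by (meson finite_imageI image_subset_iff)
      qed
    qed auto
    then obtain p where p: "p \<in> types L N A" "Neg ` \<Phi> \<subseteq> p" by blast
    then obtain U where U: "U \<in> \<U>" "p \<in> U" using \<U> topspace_type_topology[OF ne] by blast
    then obtain \<phi> where \<phi>: "\<phi> \<in> pfmls L A" "\<phi> \<in> p" "basic L N A \<phi> \<subseteq> U"
      using type_topology_basis \<U> by metis
    then have "Neg \<phi> \<in> p" using p(2) U by (auto simp: \<Phi>_def)
    then show False using types_Neg[OF p(1) \<phi>(1)] \<phi>(2) by simp
  qed
qed simp

text \<open>With countably many formulas every open set is a countable union of basic sets. Over M,
  unlike over C, a Borel measure is thus determined by its values on formulas without an appeal to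
  regularity.\<close>

lemma sets_borel_type_topology:
  assumes ne: "univ N \<noteq> {}" and cnt: "countable (pfmls L A :: ('f, 'r, 'j + 'c) fml set)"
  shows "sets (borel_of (type_topology L N A :: ('f, 'r, 'j + 'c) fml set topology)) =
     sigma_sets (types L N A) (basic L N A ` pfmls L A)"
proof (rule antisym)
  let ?X = "type_topology L N A :: ('f, 'r, 'j + 'c) fml set topology"
  interpret S: sigma_algebra "types L N A" "sigma_sets (types L N A) (basic L N A ` (pfmls L A :: ('f, 'r, 'j + 'c) fml set))"
    by (rule sigma_algebra_sigma_sets) (auto simp: basic_def)
  have "U \<in> sigma_sets (types L N A) (basic L N A ` pfmls L A)" if U: "openin ?X U" for U
  proof -
    have "U = (\<Union>\<phi>\<in>{\<phi>\<in>pfmls L A. basic L N A \<phi> \<subseteq> U}. basic L N A \<phi>)"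
      using type_topology_basis[OF U] by blast
    also have "\<dots> \<in> sigma_sets (types L N A) (basic L N A ` pfmls L A)"
      using cnt by (intro S.countable_UN'') (auto intro: countable_subset)
    finally show ?thesis .
  qed
  then show "sets (borel_of ?X) \<subseteq> sigma_sets (types L N A) (basic L N A ` pfmls L A)"
    unfolding sets_borel_of topspace_type_topology[OF ne] by (intro S.sigma_sets_subset) auto
  show "sigma_sets (types L N A) (basic L N A ` pfmls L A) \<subseteq> sets (borel_of ?X)"
    unfolding sets_borel_of topspace_type_topology[OF ne] by (intro sigma_sets_mono') (auto intro: openin_basic)
qed

subsection \<open>Countability of the set of formulas\<close>

text \<open>The terms are exhausted by the finite stages of the operator R, which applies each
  constructor once. The stages increase, so the finitely many arguments of a term share a
  stage.\<close>

lemma countable_trms: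
  fixes V :: "'v set"
  assumes "countable_lang L" "countable V"
  shows "countable {t :: ('f, 'v) trm. wf_trm L n t \<and> fv_trm t \<subseteq> V}"
proof -
  define R :: "('f, 'v) trm set \<Rightarrow> ('f, 'v) trm set" where
    "R S = Free ` V \<union> range Bound \<union> (\<lambda>(f, ts). App f ts) ` (fsyms L \<times> lists S)" for S
  have cR: "countable ((R ^^ k) {})" for k
  proof (induction k)
    case (Suc k)
    have "countable (fsyms L)" using assms by (simp add: countable_lang_def)
    then show ?case using Suc assms(2) by (auto simp: R_def)
  qed simp
  have mono: "mono R"
  proof (rule monoI)
    fix x y :: "('f, 'v) trm set" assume "x \<subseteq> y"
    then have "lists x \<subseteq> lists y" by (rule lists_mono)
    then show "R x \<subseteq> R y" unfolding R_def by blast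
  qed
  have "\<exists>k. t \<in> (R ^^ k) {}" if "wf_trm L n t" "fv_trm t \<subseteq> V" for t
    using that
  proof (induction t)
    case (Free v)
    then show ?case by (intro exI[of _ 1]) (auto simp: R_def)
  next
    case (Bound k)
    then show ?case by (intro exI[of _ 1]) (auto simp: R_def)
  next
    case (App f ts)
    have "\<forall>t\<in>set ts. \<exists>k. t \<in> (R ^^ k) {}" using App by auto
    then obtain k where k: "\<forall>t\<in>set ts. t \<in> (R ^^ k t) {}" by metis
    obtain K where K: "\<forall>t\<in>set ts. k t \<le> K" by (meson finite_imageI finite_nat_set_iff_bounded_le finite_set imageI)
    have "(R ^^ i) {} \<subseteq> (R ^^ j) {}" if "i \<le> j" for i j
      using funpow_mono2[OF mono that, of "{}" "{}"] by simp
    then have "set ts \<subseteq> (R ^^ K) {}" using k K by blast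
    then have "App f ts \<in> (R ^^ Suc K) {}" using App.prems by (auto simp: R_def)
    then show ?case by blast
  qed
  then have "{t :: ('f, 'v) trm. wf_trm L n t \<and> fv_trm t \<subseteq> V} \<subseteq> (\<Union>k. (R ^^ k) {})" by auto
  then show ?thesis using cR by (meson countable_UN countable_subset countableI_type)
qed

lemma countable_fmls:
  fixes V :: "'v set"
  assumes "countable_lang L" "countable V"
  shows "countable {\<phi> :: ('f, 'r, 'v) fml. \<phi> \<in> fmls L \<and> fv \<phi> \<subseteq> V}"
proof -
  define T where "T = (\<Union>n. {t :: ('f, 'v) trm. wf_trm L n t \<and> fv_trm t \<subseteq> V})"
  have T: "countable T" unfolding T_def using countable_trms[OF assms] by auto
  define R :: "('f, 'r, 'v) fml set \<Rightarrow> ('f, 'r, 'v) fml set" where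
    "R S = (\<lambda>(s, t). Eq s t) ` (T \<times> T) \<union> (\<lambda>(r, ts). Rel r ts) ` (rsyms L \<times> lists T) \<union>
       Neg ` S \<union> (\<lambda>(\<phi>, \<psi>). And \<phi> \<psi>) ` (S \<times> S) \<union> Ex ` S" for S
  have cR: "countable ((R ^^ k) {})" for k
  proof (induction k)
    case (Suc k)
    have "countable (rsyms L)" using assms by (simp add: countable_lang_def)
    then show ?case using Suc T by (auto simp: R_def)
  qed simp
  have mono: "mono R" unfolding R_def mono_def by blast
  have le: "(R ^^ i) {} \<subseteq> (R ^^ j) {}" if "i \<le> j" for i j
    using funpow_mono2[OF mono that, of "{}" "{}"] by simp
  have "\<exists>k. \<phi> \<in> (R ^^ k) {}" if "wf_fml L n \<phi>" "fv \<phi> \<subseteq> V" for n \<phi>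
    using that
  proof (induction \<phi> arbitrary: n)
    case (Eq s t)
    then have "s \<in> T" "t \<in> T" by (auto simp: T_def)
    then show ?case by (intro exI[of _ 1]) (auto simp: R_def)
  next
    case (Rel r ts)
    then have "r \<in> rsyms L" "set ts \<subseteq> T" by (fastforce simp: T_def)+
    then show ?case by (intro exI[of _ 1]) (auto simp: R_def)
  next
    case (Neg \<phi>)
    then obtain k where "\<phi> \<in> (R ^^ k) {}" by auto
    then have "Neg \<phi> \<in> (R ^^ Suc k) {}" by (auto simp: R_def)
    then show ?case by blast
  next
    case (Ex \<phi>)
    then obtain k where "\<phi> \<in> (R ^^ k) {}" by auto
    then have "Ex \<phi> \<in> (R ^^ Suc k) {}" by (auto simp: R_def)
    then show ?case by blast
  next
    case (And \<phi> \<psi>)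
    have "\<exists>i. \<phi> \<in> (R ^^ i) {}" "\<exists>j. \<psi> \<in> (R ^^ j) {}"
      using And.prems by (auto intro!: And.IH[of n])
    then obtain i j where "\<phi> \<in> (R ^^ i) {}" "\<psi> \<in> (R ^^ j) {}" by blast
    then have "\<phi> \<in> (R ^^ max i j) {}" "\<psi> \<in> (R ^^ max i j) {}" using le by (meson max.cobounded1 max.cobounded2 subsetD)+
    then have "And \<phi> \<psi> \<in> (R ^^ Suc (max i j)) {}" by (auto simp: R_def)
    then show ?case by blast
  qed
  then have "{\<phi> :: ('f, 'r, 'v) fml. \<phi> \<in> fmls L \<and> fv \<phi> \<subseteq> V} \<subseteq> (\<Union>k. (R ^^ k) {})" by (auto simp: fmls_def)
  then show ?thesis using cR by (meson countable_UN countable_subset countableI_type)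
qed

lemma countable_pfmls:
  assumes "countable_lang L" "countable A" "countable (UNIV :: 'j set)"
  shows "countable (pfmls L A :: ('f, 'r, 'j + 'c) fml set)"
proof -
  have "(pfmls L A :: ('f, 'r, 'j + 'c) fml set) \<subseteq> {\<phi>. \<phi> \<in> fmls L \<and> fv \<phi> \<subseteq> range Inl \<union> Inr ` A}"
  proof
    fix \<phi> :: "('f, 'r, 'j + 'c) fml" assume \<phi>: "\<phi> \<in> pfmls L A"
    have "x \<in> range Inl \<union> Inr ` A" if "x \<in> fv \<phi>" for x
      using \<phi> that by (cases x) (auto simp: pfmls_def)
    then show "\<phi> \<in> {\<phi>. \<phi> \<in> fmls L \<and> fv \<phi> \<subseteq> range Inl \<union> Inr ` A}" using \<phi> by (auto simp: pfmls_def)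
  qed
  moreover have "countable (range Inl \<union> Inr ` A :: ('j + 'c) set)" using assms by auto
  ultimately show ?thesis using countable_fmls[OF assms(1)] countable_subset by blast
qed

section \<open>Keisler measures\<close>

locale keisler =
  fixes L :: "('f, 'r) lang" and C :: "('f, 'r, 'c) struct" and \<mu> :: "('f, 'r, 'i + 'c) fml \<Rightarrow> real"
  assumes ne: "univ C \<noteq> {}" and keisler: "keisler_measure L C \<mu>"
begin

abbreviation "P \<equiv> (pfmls L (univ C) :: ('f, 'r, 'i + 'c) fml set)"

lemma nonneg: "\<phi> \<in> P \<Longrightarrow> 0 \<le> \<mu> \<phi>"
  using keisler unfolding keisler_measure_def by (elim conjE) (rule bspec)

lemma valid: "\<phi> \<in> P \<Longrightarrow> (\<And>a. range a \<subseteq> univ C \<Longrightarrow> psat C a \<phi>) \<Longrightarrow> \<mu> \<phi> = 1"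
  using keisler by (simp add: keisler_measure_def)

lemma equiv:
  assumes "\<phi> \<in> P" "\<psi> \<in> P" "\<And>a. range a \<subseteq> univ C \<Longrightarrow> psat C a \<phi> \<longleftrightarrow> psat C a \<psi>"
  shows "\<mu> \<phi> = \<mu> \<psi>"
proof -
  have "\<forall>\<phi>\<in>P. \<forall>\<psi>\<in>P. (\<forall>a. range a \<subseteq> univ C \<longrightarrow> (psat C a \<phi> \<longleftrightarrow> psat C a \<psi>)) \<longrightarrow> \<mu> \<phi> = \<mu> \<psi>"
    using keisler unfolding keisler_measure_def by (elim conjE)
  from this[rule_format, OF assms] show ?thesis .
qed

lemma additive:
  assumes "\<phi> \<in> P" "\<psi> \<in> P" "\<And>a. range a \<subseteq> univ C \<Longrightarrow> \<not> (psat C a \<phi> \<and> psat C a \<psi>)"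
  shows "\<mu> (Neg (And (Neg \<phi>) (Neg \<psi>))) = \<mu> \<phi> + \<mu> \<psi>"
proof -
  have "\<forall>\<phi>\<in>P. \<forall>\<psi>\<in>P. (\<forall>a. range a \<subseteq> univ C \<longrightarrow> \<not> (psat C a \<phi> \<and> psat C a \<psi>)) \<longrightarrow>
      \<mu> (Neg (And (Neg \<phi>) (Neg \<psi>))) = \<mu> \<phi> + \<mu> \<psi>"
    using keisler unfolding keisler_measure_def by (elim conjE)
  from this[rule_format, OF assms] show ?thesis .
qed

lemma sum_eq:
  assumes "\<phi> \<in> P" "\<psi> \<in> P" "\<xi> \<in> P" "\<And>a. range a \<subseteq> univ C \<Longrightarrow> \<not> (psat C a \<phi> \<and> psat C a \<psi>)"
    "\<And>a. range a \<subseteq> univ C \<Longrightarrow> psat C a \<xi> \<longleftrightarrow> psat C a \<phi> \<or> psat C a \<psi>"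
  shows "\<mu> \<xi> = \<mu> \<phi> + \<mu> \<psi>"
proof -
  have "\<mu> \<xi> = \<mu> (Neg (And (Neg \<phi>) (Neg \<psi>)))" using assms by (intro equiv) auto
  then show ?thesis using additive[OF assms(1,2,4)] by simp
qed

lemma Neg: "\<phi> \<in> P \<Longrightarrow> \<mu> (Neg \<phi>) = 1 - \<mu> \<phi>"
  using sum_eq[of \<phi> "Neg \<phi>" tt] valid[of tt] by (auto simp: psat_tt[OF ne])

lemma mono:
  assumes "\<phi> \<in> P" "\<psi> \<in> P" "\<And>a. range a \<subseteq> univ C \<Longrightarrow> psat C a \<phi> \<Longrightarrow> psat C a \<psi>"
  shows "\<mu> \<phi> \<le> \<mu> \<psi>"
proof -
  have "\<mu> \<psi> = \<mu> \<phi> + \<mu> (And \<psi> (Neg \<phi>))" using assms by (intro sum_eq) auto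
  then show ?thesis using nonneg[of "And \<psi> (Neg \<phi>)"] assms by simp
qed

lemma le_1: "\<phi> \<in> P \<Longrightarrow> \<mu> \<phi> \<le> 1"
  using Neg[of \<phi>] nonneg[of "Neg \<phi>"] by simp

lemma split: "\<phi> \<in> P \<Longrightarrow> \<psi> \<in> P \<Longrightarrow> \<mu> \<phi> = \<mu> (And \<phi> \<psi>) + \<mu> (And \<phi> (Neg \<psi>))"
  by (intro sum_eq) auto

end

locale keisler_conc = keisler L C \<mu> for L :: "('f, 'r) lang" and C :: "('f, 'r, 'c) struct"
    and \<mu> :: "('f, 'r, 'i + 'c) fml \<Rightarrow> real" +
  fixes m :: "'i \<Rightarrow> 'c"
  assumes m: "range m \<subseteq> univ C" and conc: "\<phi> \<in> tp L C {} m \<Longrightarrow> \<mu> \<phi> = 1"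
begin

text \<open>By compactness \<theta> is inconsistent with some finite part of the type of m. The
  conjunction of that part has measure 1 and \<theta> implies its negation.\<close>

lemma null:
  assumes \<theta>: "\<theta> \<in> P" and no: "\<And>q. q \<in> Sm L C m \<Longrightarrow> \<theta> \<notin> q"
  shows "\<mu> \<theta> = 0"
proof -
  define \<Gamma> where "\<Gamma> = insert \<theta> (tp L C {} m)"
  have \<Gamma>P: "\<Gamma> \<subseteq> P" using \<theta> pfmls_mono[of "{}" "univ C" L] by (auto simp: \<Gamma>_def tp_def)
  have "\<exists>\<Delta>. finite \<Delta> \<and> \<Delta> \<subseteq> \<Gamma> \<and> \<not> (\<exists>a\<in>{a. range a \<subseteq> univ C}. \<forall>\<phi>\<in>\<Delta>. psat C a \<phi>)"
  proof (rule ccontr)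
    assume "\<not> ?thesis"
    then have sat: "\<And>\<Delta>. finite \<Delta> \<Longrightarrow> \<Delta> \<subseteq> \<Gamma> \<Longrightarrow> \<exists>a\<in>{a. range a \<subseteq> univ C}. \<forall>\<phi>\<in>\<Delta>. psat C a \<phi>" by blast
    have "\<exists>q. q \<in> types L C (univ C) \<and> \<Gamma> \<subseteq> q"
    proof (rule complete_type[of \<Gamma> L "univ C" "{a. range a \<subseteq> univ C}" C])
      show "\<Gamma> \<subseteq> P" by (rule \<Gamma>P)
      show "\<exists>a\<in>{a. range a \<subseteq> univ C}. \<forall>\<phi>\<in>\<Delta>. psat C a \<phi>" if "finite \<Delta>" "\<Delta> \<subseteq> \<Gamma>" for \<Delta>
        by (rule sat[OF that])
    qed auto
    then show False using no by (auto simp: Sm_def \<Gamma>_def)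
  qed
  then obtain \<Delta> where \<Delta>: "finite \<Delta>" "\<Delta> \<subseteq> \<Gamma>" "\<And>a. range a \<subseteq> univ C \<Longrightarrow> \<not> (\<forall>\<phi>\<in>\<Delta>. psat C a \<phi>)" by auto
  have "finite (\<Delta> - {\<theta>})" "\<Delta> - {\<theta>} \<subseteq> pfmls L {}" using \<Delta> by (auto simp: \<Gamma>_def tp_def)
  from conj_pformula[OF this] obtain \<xi> where \<xi>: "\<xi> \<in> pfmls L {}"
    "\<And>a. psat C a \<xi> \<longleftrightarrow> (\<forall>\<phi>\<in>\<Delta> - {\<theta>}. psat C a \<phi>)" using ne by metis
  have "\<forall>\<phi>\<in>\<Delta> - {\<theta>}. psat C m \<phi>" using \<Delta>(2) by (auto simp: \<Gamma>_def tp_def)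
  then have "\<mu> \<xi> = 1" using \<xi> by (intro conc) (auto simp: tp_def)
  moreover have \<xi>P: "\<xi> \<in> P" using \<xi> pfmls_mono[of "{}" "univ C" L] by auto
  moreover have "\<mu> \<theta> \<le> \<mu> (Neg \<xi>)"
  proof (intro mono \<theta>)
    fix a assume a: "range a \<subseteq> univ C" "psat C a \<theta>"
    show "psat C a (Neg \<xi>)" using \<Delta>(3)[OF a(1)] a(2) \<xi>(2) by auto
  qed (use \<xi>P in simp)
  ultimately show ?thesis using Neg[OF \<xi>P] nonneg[OF \<theta>] by simp
qed

definition clop :: "('f, 'r, 'i + 'c) fml \<Rightarrow> ('f, 'r, 'i + 'c) fml set set" where
  "clop \<phi> = {q \<in> Sm L C m. \<phi> \<in> q}"

lemma Sm_types: "q \<in> Sm L C m \<Longrightarrow> q \<in> types L C (univ C)"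
  by (simp add: Sm_def)

lemma clop_eq:
  assumes "\<phi> \<in> P" "\<psi> \<in> P" "clop \<phi> = clop \<psi>"
  shows "\<mu> \<phi> = \<mu> \<psi>"
proof -
  have n: "\<mu> (And \<alpha> (Neg \<beta>)) = 0" if "\<alpha> \<in> P" "\<beta> \<in> P" "clop \<alpha> \<subseteq> clop \<beta>" for \<alpha> \<beta>
    by (rule null) (use that in \<open>auto simp: types_And[OF Sm_types] types_Neg[OF Sm_types] clop_def\<close>)
  have "\<mu> \<phi> = \<mu> (And \<phi> \<psi>)" using split[of \<phi> \<psi>] n[of \<phi> \<psi>] assms by simp
  moreover have "\<mu> \<psi> = \<mu> (And \<psi> \<phi>)" using split[of \<psi> \<phi>] n[of \<psi> \<phi>] assms by simp
  moreover have "\<mu> (And \<phi> \<psi>) = \<mu> (And \<psi> \<phi>)" using assms by (intro equiv) auto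
  ultimately show ?thesis by simp
qed

text \<open>One clopen subset of \<open>Sm\<close> can be cut out by formulas that are not
  equivalent in C. The choice is harmless because such formulas differ by a null formula.\<close>

definition content :: "('f, 'r, 'i + 'c) fml set set \<Rightarrow> real" where
  "content B = \<mu> (SOME \<phi>. \<phi> \<in> P \<and> B = clop \<phi>)"

lemma content_clop: "\<phi> \<in> P \<Longrightarrow> content (clop \<phi>) = \<mu> \<phi>"
  unfolding content_def by (rule someI2[of _ \<phi>]) (auto intro: clop_eq[symmetric])

lemma clop_And: "\<phi> \<in> P \<Longrightarrow> \<psi> \<in> P \<Longrightarrow> clop (And \<phi> \<psi>) = clop \<phi> \<inter> clop \<psi>"
  by (auto simp: clop_def types_And[OF Sm_types])

lemma clop_Neg: "\<phi> \<in> P \<Longrightarrow> clop (Neg \<phi>) = Sm L C m - clop \<phi>"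
  by (auto simp: clop_def types_Neg[OF Sm_types])

lemma clop_tt: "clop tt = Sm L C m"
  by (auto simp: clop_def tt_types[OF ne Sm_types])

lemma clop_basic: "clop \<phi> = basic L C (univ C) \<phi> \<inter> Sm L C m"
  by (auto simp: clop_def basic_def Sm_def)

lemma topspace_Sm: "topspace (Sm_topology L C m) = Sm L C m"
  unfolding Sm_topology_def by (simp add: topspace_type_topology[OF ne]) (auto simp: Sm_def)

lemma compact_Sm: "compact_space (Sm_topology L C m)"
proof -
  \<comment> \<open>Inserting \<open>tt\<close> makes the index set visibly nonempty, as an
    intersection of closed sets requires.\<close>
  have *: "Sm L C m = (\<Inter>\<phi>\<in>insert tt (tp L C {} m). basic L C (univ C) \<phi>)"
    by (auto simp: Sm_def basic_def tt_types[OF ne])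
  have tpP: "\<phi> \<in> P" if "\<phi> \<in> tp L C {} m" for \<phi> using that pfmls_mono[of "{}" "univ C" L] by (auto simp: tp_def)
  have "closedin (type_topology L C (univ C)) (Sm L C m)"
    unfolding *
  proof (rule closedin_INT)
    fix \<phi> :: "('f, 'r, 'i + 'c) fml" assume "\<phi> \<in> insert tt (tp L C {} m)"
    then have \<phi>: "\<phi> \<in> P" using tpP by auto
    have "openin (type_topology L C (univ C)) (basic L C (univ C) (Neg \<phi>))" using \<phi> by (intro openin_basic) simp
    then show "closedin (type_topology L C (univ C)) (basic L C (univ C) \<phi>)"
      unfolding closedin_def topspace_type_topology[OF ne] basic_Neg[OF \<phi>] using basic_subset by blast
  qed simp
  then have "compactin (type_topology L C (univ C)) (Sm L C m)"
    by (rule closedin_compact_space[OF compact_type_topology[OF ne]])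
  then show ?thesis unfolding Sm_topology_def by (rule compact_space_subtopology)
qed

sublocale content: clopen_content "Sm_topology L C m" "clop ` P" content
proof (rule clopen_content.intro)
  show "compact_space (Sm_topology L C m)" by (rule compact_Sm)
  show "algebra (topspace (Sm_topology L C m)) (clop ` P)"
    unfolding algebra_iff_Int topspace_Sm
  proof (intro conjI ballI)
    show "clop ` P \<subseteq> Pow (Sm L C m)" by (auto simp: clop_def)
    have "clop (Neg tt) = {}" by (simp add: clop_Neg clop_tt)
    then show "{} \<in> clop ` P" by (intro image_eqI[of _ _ "Neg tt"]) auto
    fix B assume "B \<in> clop ` P"
    then obtain \<phi> where \<phi>: "\<phi> \<in> P" "B = clop \<phi>" by auto
    then show "Sm L C m - B \<in> clop ` P" by (intro image_eqI[of _ _ "Neg \<phi>"]) (auto simp: clop_Neg)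
    fix D assume "D \<in> clop ` P"
    then obtain \<psi> where "\<psi> \<in> P" "D = clop \<psi>" by auto
    with \<phi> show "B \<inter> D \<in> clop ` P" by (intro image_eqI[of _ _ "And \<phi> \<psi>"]) (auto simp: clop_And)
  qed
  show "openin (Sm_topology L C m) B" if "B \<in> clop ` P" for B
    using that unfolding Sm_topology_def openin_subtopology clop_basic by (auto intro: openin_basic)
  show "\<exists>B\<in>clop ` P. x \<in> B \<and> B \<subseteq> U" if U: "openin (Sm_topology L C m) U" "x \<in> U" for U x
  proof -
    obtain V where V: "openin (type_topology L C (univ C)) V" "U = V \<inter> Sm L C m"
      using U unfolding Sm_topology_def openin_subtopology by auto
    then obtain \<phi> where "\<phi> \<in> P" "\<phi> \<in> x" "basic L C (univ C) \<phi> \<subseteq> V" "x \<in> basic L C (univ C) \<phi>"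
      using type_topology_basis[of L C "univ C" V x] U by blast
    then show ?thesis using V U by (intro bexI[of _ "clop \<phi>"]) (auto simp: clop_basic)
  qed
  show "0 \<le> content B" if "B \<in> clop ` P" for B using that nonneg by (auto simp: content_clop)
  have "\<mu> tt = 1" by (intro valid) (auto simp: psat_tt[OF ne])
  then show "content (topspace (Sm_topology L C m)) = 1"
    using content_clop[of tt] by (simp add: clop_tt topspace_Sm)
  show "content (A \<union> B) = content A + content B" if AB: "A \<in> clop ` P" "B \<in> clop ` P" "A \<inter> B = {}" for A B
  proof -
    obtain \<phi> \<psi> where \<phi>: "\<phi> \<in> P" "A = clop \<phi>" "\<psi> \<in> P" "B = clop \<psi>" using AB by auto
    let ?o = "Neg (And (Neg \<phi>) (Neg \<psi>))"
    have "A \<union> B = clop ?o" using \<phi> by (auto simp: clop_Neg clop_And) (auto simp: clop_def)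
    then have "content (A \<union> B) = \<mu> ?o" using \<phi> content_clop[of ?o] by simp
    also have "\<dots> = \<mu> \<phi> + \<mu> (And \<psi> (Neg \<phi>))" using \<phi> by (intro sum_eq) auto
    \<comment> \<open>Disjoint clopen sets need not come from formulas disjoint in C: the
      conjunction may be satisfiable, but it belongs to no type of \<open>Sm\<close> and so is
      null.\<close>
    also have "\<mu> (And \<psi> (Neg \<phi>)) = \<mu> \<psi>"
    proof -
      have "\<mu> (And \<psi> \<phi>) = 0"
        by (rule null) (use \<phi> AB(3) in \<open>auto simp: types_And[OF Sm_types] clop_def\<close>)
      then show ?thesis using split[OF \<phi>(3,1)] by simp
    qed
    finally show ?thesis using \<phi> content_clop by simp
  qed
qed

theorem borel_extension_eq:
  "borel_extension L C m \<mu> = content.ext"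
  unfolding borel_extension_def
proof (rule the_equality)
  have "measure content.ext {q \<in> Sm L C m. \<phi> \<in> q} = \<mu> \<phi>" if "\<phi> \<in> P" for \<phi>
    using content.measure_ext[of "clop \<phi>"] content_clop[OF that] that by (simp add: clop_def)
  then show "regular_borel_prob (Sm_topology L C m) content.ext \<and>
    (\<forall>\<phi>\<in>P. measure content.ext {q \<in> Sm L C m. \<phi> \<in> q} = \<mu> \<phi>)"
    using content.regular_ext by blast
next
  fix N assume N: "regular_borel_prob (Sm_topology L C m) N \<and> (\<forall>\<phi>\<in>P. measure N {q \<in> Sm L C m. \<phi> \<in> q} = \<mu> \<phi>)"
  show "N = content.ext"
    by (rule content.regular_unique) (use N content_clop in \<open>auto simp: clop_def\<close>)
qed

lemma borel_extension:
  "prob_space (borel_extension L C m \<mu>)"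
  "space (borel_extension L C m \<mu>) = Sm L C m"
  "sets (borel_extension L C m \<mu>) = sets (borel_of (Sm_topology L C m))"
  "\<phi> \<in> P \<Longrightarrow> {q \<in> Sm L C m. \<phi> \<in> q} \<in> sets (borel_extension L C m \<mu>)"
  "\<phi> \<in> P \<Longrightarrow> measure (borel_extension L C m \<mu>) {q \<in> Sm L C m. \<phi> \<in> q} = \<mu> \<phi>"
proof -
  show "prob_space (borel_extension L C m \<mu>)"
  "space (borel_extension L C m \<mu>) = Sm L C m"
  "sets (borel_extension L C m \<mu>) = sets (borel_of (Sm_topology L C m))"
    using content.regular_ext unfolding borel_extension_eq regular_borel_prob_def topspace_Sm by blast+
  show "{q \<in> Sm L C m. \<phi> \<in> q} \<in> sets (borel_extension L C m \<mu>)" if "\<phi> \<in> P"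
    unfolding borel_extension_eq using content.open_sets_ext[OF content.clopen, of "clop \<phi>"] that by (simp add: clop_def)
  show "measure (borel_extension L C m \<mu>) {q \<in> Sm L C m. \<phi> \<in> q} = \<mu> \<phi>" if "\<phi> \<in> P"
    unfolding borel_extension_eq using content.measure_ext[of "clop \<phi>"] content_clop[OF that] that by (simp add: clop_def)
qed

end

section \<open>NIP and approximation of Keisler measures by types\<close>

text \<open>Like \<open>inst\<close>, but with its own index type for x. Pairs of parameter tuples,
  indexed by a sum type, are substituted later.\<close>

definition plug :: "('f, 'r, 'j + 'i) fml \<Rightarrow> ('j \<Rightarrow> 'c) \<Rightarrow> ('f, 'r, 'i + 'c) fml" where
  "plug \<phi> b = ren (case_sum (\<lambda>i. Inr (b i)) Inl) \<phi>"

lemma inst_plug: "inst \<phi> b = plug \<phi> b"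
  by (simp add: inst_def plug_def)

lemma plug_pfmls: "\<phi> \<in> fmls L \<Longrightarrow> range b \<subseteq> A \<Longrightarrow> plug \<phi> b \<in> pfmls L A"
  by (auto simp: plug_def pfmls_def fml.set_map split: sum.splits)

lemma psat_plug: "psat N a (plug \<phi> b) \<longleftrightarrow> sat N (case_sum b a) \<phi>"
proof -
  have "case_sum a id \<circ> case_sum (\<lambda>i. Inr (b i)) Inl = case_sum b a"
    by (rule ext) (auto split: sum.splits)
  then show ?thesis by (simp add: plug_def psat_def sat_ren)
qed

lemma ren_ren: "ren f (ren g \<phi>) = ren (f \<circ> g) \<phi>"
  by (simp add: fml.map_comp)

lemma ren_cong_fv: "(\<And>x. x \<in> fv \<phi> \<Longrightarrow> f x = g x) \<Longrightarrow> ren f \<phi> = ren g \<phi>"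
  by (rule fml.map_cong) auto

text \<open>The finitely many parameters of \<psi> are named by distinct x-variables; an infinite
  index type has room for any number of them. The remaining x-variables get an arbitrary value in
  A.\<close>

lemma plug_surj:
  assumes \<psi>: "\<psi> \<in> pfmls L A" and A: "A \<noteq> {}" and inf: "infinite (UNIV :: 'j set)"
  obtains \<phi> :: "('f, 'r, 'j + 'i) fml" and b :: "'j \<Rightarrow> 'c"
  where "\<phi> \<in> fmls L" "range b \<subseteq> A" "\<psi> = plug \<phi> b"
proof -
  define S where "S = {c. Inr c \<in> fv \<psi>}"
  have "finite S" unfolding S_def using finite_vimageI[OF finite_fv, of Inr \<psi>] by (simp add: vimage_def)
  have "\<exists>g :: 'c \<Rightarrow> 'j. inj_on g S"
  proof -
    obtain B :: "'j set" where "card B = card S" "finite B" using infinite_arbitrarily_large[OF inf] by blast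
    then obtain g where "bij_betw g S B" using \<open>finite S\<close> finite_same_card_bij by metis
    then show ?thesis by (auto simp: bij_betw_def)
  qed
  then obtain g :: "'c \<Rightarrow> 'j" where g: "inj_on g S" by blast
  obtain x0 where x0: "x0 \<in> A" using A by auto
  define b where "b j = (if j \<in> g ` S then inv_into S g j else x0)" for j
  define \<phi> :: "('f, 'r, 'j + 'i) fml" where "\<phi> = ren (case_sum Inr (\<lambda>c. Inl (g c))) \<psi>"
  have S: "S \<subseteq> A" using \<psi> by (auto simp: S_def pfmls_def)
  have "range b \<subseteq> A" using S x0 by (auto simp: b_def inv_into_into)
  moreover have "\<phi> \<in> fmls L" using \<psi> by (simp add: \<phi>_def pfmls_def)
  moreover have "\<psi> = plug \<phi> b"
  proof -
    have "plug \<phi> b = ren id \<psi>" unfolding plug_def \<phi>_def ren_ren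
    proof (rule ren_cong_fv)
      fix x assume x: "x \<in> fv \<psi>"
      show "(case_sum (\<lambda>i. Inr (b i)) Inl \<circ> case_sum Inr (\<lambda>c. Inl (g c))) x = id x"
      proof (cases x)
        case (Inr c)
        then have "c \<in> S" using x by (simp add: S_def)
        then show ?thesis using Inr g by (simp add: b_def)
      qed simp
    qed
    then show ?thesis by (simp add: fml.map_id)
  qed
  ultimately show ?thesis using that by blast
qed

lemma act_plug: "act \<sigma> (plug \<phi> b) = plug \<phi> (\<sigma> \<circ> b)"
  unfolding act_def plug_def ren_ren by (rule ren_cong_fv) (auto split: sum.splits)

text \<open>A symmetric difference of two instances of \<phi> is one instance of a formula in
  doubled parameter variables, so the approximation theorem applies to it uniformly.\<close>

lemma plug_Xor:
  "Xor (plug \<phi> b) (plug \<phi> b') = plug (Xor (ren (map_sum Inl id) \<phi>) (ren (map_sum Inr id) \<phi>)) (case_sum b b')"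
proof -
  have eqs: "case_sum (\<lambda>i. Inr (case_sum b b' i)) Inl \<circ> map_sum Inl id = case_sum (\<lambda>i. Inr (b i)) Inl"
    "case_sum (\<lambda>i. Inr (case_sum b b' i)) Inl \<circ> map_sum Inr id = case_sum (\<lambda>i. Inr (b' i)) Inl"
    by (auto simp: fun_eq_iff split: sum.splits)
  show ?thesis by (simp only: plug_def ren_Xor ren_ren eqs)
qed

lemma ultra_limit_of_types:
  fixes q :: "'w \<Rightarrow> ('f, 'r, 'j + 'c) fml set"
  assumes U: "ultra U" and q: "eventually (\<lambda>w. q w \<in> types L N A) U"
  shows "{\<theta> \<in> pfmls L A. eventually (\<lambda>w. \<theta> \<in> q w) U} \<in> types L N A"
  unfolding types_def
proof (intro CollectI conjI allI impI ballI)
  fix \<Gamma> :: "('f, 'r, 'j + 'c) fml set" assume \<Gamma>: "finite \<Gamma>" "\<Gamma> \<subseteq> {\<theta> \<in> pfmls L A. eventually (\<lambda>w. \<theta> \<in> q w) U}"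
  then have "eventually (\<lambda>w. \<forall>\<phi>\<in>\<Gamma>. \<phi> \<in> q w) U" by (intro eventually_ball_finite) auto
  with q have "eventually (\<lambda>w. q w \<in> types L N A \<and> \<Gamma> \<subseteq> q w) U" by eventually_elim auto
  from ultra_ex[OF U this] obtain w where "q w \<in> types L N A" "\<Gamma> \<subseteq> q w" by blast
  then obtain a where "range a \<subseteq> univ N" "\<And>\<phi>. \<phi> \<in> \<Gamma> \<Longrightarrow> psat N a \<phi>"
    using types_finsat[OF _ \<Gamma>(1)] by metis
  then show "\<exists>a. range a \<subseteq> univ N \<and> (\<forall>\<phi>\<in>\<Gamma>. psat N a \<phi>)" by blast
next
  fix \<phi> :: "('f, 'r, 'j + 'c) fml" assume \<phi>: "\<phi> \<in> pfmls L A"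
  have "eventually (\<lambda>w. \<phi> \<in> q w) U \<or> eventually (\<lambda>w. Neg \<phi> \<in> q w) U"
  proof (rule disjCI)
    assume "\<not> eventually (\<lambda>w. Neg \<phi> \<in> q w) U"
    then have "eventually (\<lambda>w. Neg \<phi> \<notin> q w) U" by (simp add: ultra_not[OF U])
    with q show "eventually (\<lambda>w. \<phi> \<in> q w) U" by eventually_elim (simp add: types_Neg[OF _ \<phi>])
  qed
  then show "\<phi> \<in> {\<theta> \<in> pfmls L A. eventually (\<lambda>w. \<theta> \<in> q w) U} \<or> Neg \<phi> \<in> {\<theta> \<in> pfmls L A. eventually (\<lambda>w. \<theta> \<in> q w) U}"
    using \<phi> by simp
qed auto

section \<open>The NIP setting and finite VC dimension\<close>

locale nip_setting =
  fixes L :: "('f, 'r) lang"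
    and T :: "('f, 'r, nat) fml set"
    and \<kappa> :: "'k rel" and \<kappa>' :: "'l rel"
    and C C' M :: "('f, 'r, 'c) struct"
    and m :: "'i \<Rightarrow> 'c"
  assumes countable_lang: "countable_lang L"
    and nip: "NIP L T TYPE('c)"
    and monster_C: "monster_model L T \<kappa> C"
    and monster_C': "monster_model L T \<kappa>' C'" and elem_C': "elem_sub L C C'" and small_C: "small \<kappa>' (univ C)"
    and elem_M: "elem_sub L M C"
    and infinite_M: "infinite (univ M)" and countable_M: "countable (univ M)"
    and m: "bij_betw m UNIV (univ M)"
begin

sublocale C: monster L C \<kappa>
  using monster_C by unfold_locales (auto simp: monster_model_def is_model_def)

sublocale C': monster L C' \<kappa>'
  using monster_C' by unfold_locales (auto simp: monster_model_def is_model_def)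

lemma countable_i: "countable (UNIV :: 'i set)"
  using m countable_M by (metis bij_betw_def countable_image_inj_on)

lemma infinite_i: "infinite (UNIV :: 'i set)"
  using m infinite_M by (metis bij_betw_finite)

lemma M_sub: "univ M \<subseteq> univ C"
  using elem_M by (simp add: elem_sub_def)

lemma C_sub: "univ C \<subseteq> univ C'"
  using elem_C' by (simp add: elem_sub_def)

lemma ne_M: "univ M \<noteq> {}" using infinite_M by auto
lemma ne_C: "univ C \<noteq> {}" using ne_M M_sub by auto

lemma range_m: "range m = univ M"
  using m by (simp add: bij_betw_def)

lemma m_C: "range m \<subseteq> univ C"
  using range_m M_sub by simp

text \<open>If arbitrarily long finite sequences were shattered, compactness would give one infinite
  sequence all of whose finite subsets are cut out, and a second use of compactness would cut out
  every subset of it, against NIP.\<close>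

lemma finite_vc_dim:
  fixes \<phi> :: "('f, 'r, 'j + 'i) fml"
  assumes \<phi>: "\<phi> \<in> fmls L" and cj: "countable (UNIV :: 'j set)"
  shows "\<exists>d. \<not> (\<exists>a :: nat \<Rightarrow> 'i \<Rightarrow> 'c. (\<forall>k<d. range (a k) \<subseteq> univ C) \<and>
     (\<forall>S\<subseteq>{..<d}. \<exists>b. range b \<subseteq> univ C \<and> (\<forall>k<d. sat C (case_sum b (a k)) \<phi> \<longleftrightarrow> k \<in> S)))"
proof (rule ccontr)
  assume "\<not> ?thesis"
  then have sh: "\<exists>a :: nat \<Rightarrow> 'i \<Rightarrow> 'c. (\<forall>k<d. range (a k) \<subseteq> univ C) \<and>
     (\<forall>S\<subseteq>{..<d}. \<exists>b. range b \<subseteq> univ C \<and> (\<forall>k<d. sat C (case_sum b (a k)) \<phi> \<longleftrightarrow> k \<in> S))" for d by blast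
  obtain x0 where x0: "x0 \<in> univ C" using ne_C by auto
  \<comment> \<open>Variables for the sequence are indexed by (k, i), those for the parameter
    attached to a finite set by (l, j). Lists stand for finite sets in order to keep the index type
    visibly countable.\<close>
  define G :: "nat \<Rightarrow> nat list \<Rightarrow> ('f, 'r, (nat \<times> 'i + nat list \<times> 'j) + 'c) fml" where
    "G k l = ren (case_sum (\<lambda>j. Inl (Inr (l, j))) (\<lambda>i. Inl (Inl (k, i)))) \<phi>" for k l
  define H where "H = (\<lambda>(k, l). if k \<in> set l then G k l else Neg (G k l))"
  have psG: "psat C e (G k l) \<longleftrightarrow> sat C (case_sum (\<lambda>j. e (Inr (l, j))) (\<lambda>i. e (Inl (k, i)))) \<phi>" for e k l
  proof -
    have "case_sum e id \<circ> case_sum (\<lambda>j. Inl (Inr (l, j))) (\<lambda>i. Inl (Inl (k, i))) =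
      case_sum (\<lambda>j. e (Inr (l, j))) (\<lambda>i. e (Inl (k, i)))" by (auto simp: fun_eq_iff split: sum.splits)
    then show ?thesis by (simp add: G_def psat_def sat_ren)
  qed
  have "\<exists>e. range e \<subseteq> univ C \<and> (\<forall>\<psi>\<in>range H. psat C e \<psi>)"
  proof (rule C.realize[where A = "{}"])
    show "range H \<subseteq> pfmls L {}"
      using \<phi> by (auto simp: H_def G_def pfmls_def fml.set_map split: sum.splits if_splits)
    show "countable (UNIV :: (nat \<times> 'i + nat list \<times> 'j) set)"
      unfolding UNIV_Plus_UNIV[symmetric] UNIV_Times_UNIV[symmetric] using countable_i cj by (intro countable_Plus countable_SIGMA) auto
    fix \<Delta> assume "finite \<Delta>" "\<Delta> \<subseteq> range H"
    then obtain K where K: "finite K" "\<Delta> = H ` K" by (metis finite_subset_image)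
    obtain d where d: "\<forall>p\<in>K. fst p < d" using K(1) by (meson finite_imageI finite_nat_set_iff_bounded imageI)
    obtain a b where ab: "\<And>k. k < d \<Longrightarrow> range (a k) \<subseteq> univ C"
      "\<And>S. S \<subseteq> {..<d} \<Longrightarrow> range (b S) \<subseteq> univ C \<and> (\<forall>k<d. sat C (case_sum (b S) (a k)) \<phi> \<longleftrightarrow> k \<in> S)"
      using sh[of d] by metis
    define e where "e = case_sum (\<lambda>(k, i). if k < d then a k i else x0) (\<lambda>(l, j). b (set l \<inter> {..<d}) j)"
    have "range e \<subseteq> univ C"
      using ab x0 by (auto simp: e_def split: sum.splits) (meson Int_lower2 range_subsetD)+
    moreover have "psat C e (H p)" if "p \<in> K" for p
    proof -
      obtain k l where p: "p = (k, l)" by (cases p)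
      then have "k < d" using d that by auto
      then have "psat C e (G k l) \<longleftrightarrow> k \<in> set l"
        using ab(2)[of "set l \<inter> {..<d}"] by (simp add: psG e_def)
      then show ?thesis by (simp add: H_def p)
    qed
    ultimately show "\<exists>e. range e \<subseteq> univ C \<and> (\<forall>\<psi>\<in>\<Delta>. psat C e \<psi>)" using K by blast
  qed (auto intro: C.small_countable)
  then obtain e where e: "range e \<subseteq> univ C" "\<forall>\<psi>\<in>range H. psat C e \<psi>" by blast
  define a where "a k i = e (Inl (k, i))" for k i
  have aC: "range (a k) \<subseteq> univ C" for k using e(1) by (auto simp: a_def)
  have eG: "sat C (case_sum (\<lambda>j. e (Inr (l, j))) (a k)) \<phi> \<longleftrightarrow> k \<in> set l" for k l
  proof -
    have "psat C e (H (k, l))" using e(2) by blast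
    then show ?thesis using psG[of e k l] unfolding a_def by (simp add: H_def split: if_splits)
  qed
  \<comment> \<open>The sequence is now fixed and serves as a countable parameter set. Finitely many
    of the conditions on b involve only a finite part of S, which a list describes.\<close>
  have "\<exists>b. range b \<subseteq> univ C \<and> (\<forall>k. sat C (case_sum b (a k)) \<phi> \<longleftrightarrow> k \<in> S)" for S :: "nat set"
  proof -
    define D where "D k = (if k \<in> S then ren (case_sum Inl (\<lambda>i. Inr (a k i))) \<phi> else Neg (ren (case_sum Inl (\<lambda>i. Inr (a k i))) \<phi>))" for k
    have psD: "psat C b (D k) \<longleftrightarrow> (sat C (case_sum b (a k)) \<phi> \<longleftrightarrow> k \<in> S)" for b k
    proof -
      have "case_sum b id \<circ> case_sum Inl (\<lambda>i. Inr (a k i)) = case_sum b (a k)"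
        by (auto simp: fun_eq_iff split: sum.splits)
      then show ?thesis by (simp add: D_def psat_def sat_ren)
    qed
    have "\<exists>b. range b \<subseteq> univ C \<and> (\<forall>\<psi>\<in>range D. psat C b \<psi>)"
    proof (rule C.realize[where A = "\<Union>k. range (a k)"])
      show "range D \<subseteq> pfmls L (\<Union>k. range (a k))"
        using \<phi> by (auto simp: D_def pfmls_def fml.set_map split: sum.splits if_splits) blast+
      show "|\<Union>k. range (a k)| <o \<kappa>" using countable_i by (intro C.small_countable countable_UN) auto
      fix \<Delta> assume "finite \<Delta>" "\<Delta> \<subseteq> range D"
      then obtain K where K: "finite K" "\<Delta> = D ` K" by (metis finite_subset_image)
      define l where "l = sorted_list_of_set (S \<inter> K)"
      have l: "set l = S \<inter> K" using K by (simp add: l_def)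
      define b where "b j = e (Inr (l, j))" for j
      have "psat C b (D k)" if "k \<in> K" for k
        using eG[of l k] that unfolding psD b_def l by simp
      moreover have "range b \<subseteq> univ C" using e(1) by (auto simp: b_def)
      ultimately show "\<exists>b. range b \<subseteq> univ C \<and> (\<forall>\<psi>\<in>\<Delta>. psat C b \<psi>)" using K by blast
    qed (use aC cj in auto)
    then show ?thesis using psD by auto
  qed
  then obtain b where b: "\<And>S. range (b S) \<subseteq> univ C" "\<And>S k. sat C (case_sum (b S) (a k)) \<phi> \<longleftrightarrow> k \<in> S" by metis
  obtain gi :: "'i \<Rightarrow> nat" where gi: "inj gi" using countable_i by (metis countableE)
  obtain gj :: "'j \<Rightarrow> nat" where gj: "inj gj" using cj by (metis countableE)
  \<comment> \<open>The variables are renumbered to fit \<open>has_IP\<close>, where the sequence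
    occupies the left summand; hence the two sides of \<phi> are exchanged.\<close>
  define \<phi>' where "\<phi>' = ren (case_sum (\<lambda>j. Inr (gj j)) (\<lambda>i. Inl (gi i))) \<phi>"
  define a' where "a' k n = (if n \<in> range gi then a k (inv gi n) else x0)" for k n
  define b' where "b' S n = (if n \<in> range gj then b S (inv gj n) else x0)" for S n
  have "case_sum (a' k) (b' S) \<circ> case_sum (\<lambda>j. Inr (gj j)) (\<lambda>i. Inl (gi i)) = case_sum (b S) (a k)" for k S
    using gi gj by (auto simp: fun_eq_iff a'_def b'_def split: sum.splits)
  then have "sat C (case_sum (a' k) (b' S)) \<phi>' \<longleftrightarrow> k \<in> S" for k S
    using b(2) by (simp add: \<phi>'_def sat_ren)
  moreover have "range (a' k) \<subseteq> univ C" for k using aC x0 by (auto simp: a'_def)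
  moreover have "range (b' S) \<subseteq> univ C" for S using b(1) x0 by (auto simp: b'_def)
  ultimately have "has_IP C \<phi>'" unfolding has_IP_def by (intro exI[of _ a'] exI[of _ b']) simp
  moreover have "is_model L T C" using monster_C by (simp add: monster_model_def)
  moreover have "\<phi>' \<in> fmls L" using \<phi> by (simp add: \<phi>'_def)
  ultimately show False using nip unfolding NIP_def by blast
qed

lemma keisler_conc_Mm: "\<mu> \<in> Mm_inv L C M m \<Longrightarrow> keisler_conc L C \<mu> m"
  by unfold_locales (auto simp: Mm_inv_def ne_C m_C[THEN subsetD])

end

section \<open>Approximation of a measure by finitely many types\<close>

locale nip_measure = nip_setting L T \<kappa> \<kappa>' C C' M m + keisler_conc L C \<mu> m
  for L :: "('f, 'r) lang"
    and T :: "('f, 'r, nat) fml set"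
    and \<kappa> :: "'k rel" and \<kappa>' :: "'l rel"
    and C C' M :: "('f, 'r, 'c) struct"
    and m :: "'i \<Rightarrow> 'c" and \<mu> :: "('f, 'r, 'i + 'c) fml \<Rightarrow> real"
begin

abbreviation "\<N> \<equiv> borel_extension L C m \<mu>"

sublocale N: prob_space \<N> by (rule borel_extension(1))

lemma sets_mem: "\<theta> \<in> P \<Longrightarrow> {q \<in> Sm L C m. \<theta> \<in> q} \<in> sets \<N>"
  by (rule borel_extension(4))

lemma pattern_measurable:
  assumes "finite \<Theta>" "\<Theta> \<subseteq> P" "s \<subseteq> \<Theta>"
  shows "{q \<in> Sm L C m. q \<inter> \<Theta> = s} \<in> sets \<N>"
proof -
  have "{q \<in> Sm L C m. q \<inter> \<Theta> = s} = {q \<in> space \<N>. \<forall>\<theta>\<in>\<Theta>. (\<theta> \<in> q) = (\<theta> \<in> s)}"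
    using assms(3) by (auto simp: borel_extension(2))
  also have "\<dots> \<in> sets \<N>"
  proof (rule sets.sets_Collect_finite_All[OF _ assms(1)])
    fix \<theta> assume "\<theta> \<in> \<Theta>"
    then have \<theta>: "{q \<in> space \<N>. \<theta> \<in> q} \<in> sets \<N>" using sets_mem assms(2) by (auto simp: borel_extension(2))
    show "{q \<in> space \<N>. (\<theta> \<in> q) = (\<theta> \<in> s)} \<in> sets \<N>"
      using \<theta> sets.sets_Collect_neg[OF \<theta>] by (cases "\<theta> \<in> s") auto
  qed
  finally show ?thesis .
qed

lemma pattern_sum:
  assumes \<Theta>: "finite \<Theta>" "\<Theta> \<subseteq> P" and R: "R \<subseteq> Pow \<Theta>"
  shows "measure \<N> {q \<in> Sm L C m. q \<inter> \<Theta> \<in> R} = (\<Sum>s\<in>R. measure \<N> {q \<in> Sm L C m. q \<inter> \<Theta> = s})"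
proof -
  have "finite R" using \<Theta>(1) R by (meson finite_Pow_iff finite_subset)
  have eq: "{q \<in> Sm L C m. q \<inter> \<Theta> \<in> R} = (\<Union>s\<in>R. {q \<in> Sm L C m. q \<inter> \<Theta> = s})" by auto
  have "(\<lambda>s. {q \<in> Sm L C m. q \<inter> \<Theta> = s}) ` R \<subseteq> sets \<N>" using pattern_measurable[OF \<Theta>] R by blast
  moreover have "disjoint_family_on (\<lambda>s. {q \<in> Sm L C m. q \<inter> \<Theta> = s}) R" by (auto simp: disjoint_family_on_def)
  ultimately show ?thesis unfolding eq using \<open>finite R\<close> by (intro N.finite_measure_finite_Union)
qed

text \<open>For finite \<Theta> the measure induces a finite probability space on the traces of
  types on \<Theta>. The instances of \<phi> in \<Theta> define a family of subsets with dimension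
  bounded by that of \<phi>, so sampling applies with an n independent of \<Theta>.\<close>

lemma approximation_finite:
  fixes \<phi> :: "('f, 'r, 'j + 'i) fml"
  assumes \<phi>: "\<phi> \<in> fmls L" and cj: "countable (UNIV :: 'j set)" and \<epsilon>: "0 < \<epsilon>"
  shows "\<exists>n::nat. n > 0 \<and> (\<forall>\<Theta>. finite \<Theta> \<longrightarrow> \<Theta> \<subseteq> P \<longrightarrow> (\<exists>q. (\<forall>i<n. q i \<in> Sm L C m \<and> (\<forall>\<theta>\<in>\<Theta> \<inter> q i. 0 < \<mu> \<theta>)) \<and>
     (\<forall>b. range b \<subseteq> univ C \<longrightarrow> plug \<phi> b \<in> \<Theta> \<longrightarrow>
        \<bar>(\<Sum>i<n. of_bool (plug \<phi> b \<in> q i)) / real n - \<mu> (plug \<phi> b)\<bar> \<le> \<epsilon>)))"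
proof -
  obtain d where d: "\<not> (\<exists>a :: nat \<Rightarrow> 'i \<Rightarrow> 'c. (\<forall>k<d. range (a k) \<subseteq> univ C) \<and>
     (\<forall>S\<subseteq>{..<d}. \<exists>b. range b \<subseteq> univ C \<and> (\<forall>k<d. sat C (case_sum b (a k)) \<phi> \<longleftrightarrow> k \<in> S)))"
    using finite_vc_dim[OF \<phi> cj] by blast
  obtain n :: nat where n: "n > 0" and vc: "\<forall>(\<Omega> :: ('f, 'r, 'i + 'c) fml set set) w \<F>.
     finite \<Omega> \<longrightarrow> (\<forall>x\<in>\<Omega>. 0 \<le> w x) \<longrightarrow> sum w \<Omega> = 1 \<longrightarrow> \<F> \<subseteq> Pow \<Omega> \<longrightarrow>
     (\<forall>S\<subseteq>\<Omega>. card S = d \<longrightarrow> \<not> shatters \<F> S) \<longrightarrow>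
     (\<exists>x :: nat \<Rightarrow> _. (\<forall>i<n. x i \<in> \<Omega>) \<and> (\<forall>A\<in>\<F>. \<bar>(\<Sum>i<n. of_bool (x i \<in> A)) / real n - sum w A\<bar> \<le> \<epsilon>))"
    using vc_approximation[OF \<epsilon>, of d] by (elim exE conjE)
  have "\<exists>q. (\<forall>i<n. q i \<in> Sm L C m \<and> (\<forall>\<theta>\<in>\<Theta> \<inter> q i. 0 < \<mu> \<theta>)) \<and>
     (\<forall>b. range b \<subseteq> univ C \<longrightarrow> plug \<phi> b \<in> \<Theta> \<longrightarrow>
        \<bar>(\<Sum>i<n. of_bool (plug \<phi> b \<in> q i)) / real n - \<mu> (plug \<phi> b)\<bar> \<le> \<epsilon>)"
    if \<Theta>: "finite \<Theta>" "\<Theta> \<subseteq> P" for \<Theta>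
  proof -
    define w where "w s = measure \<N> {q \<in> Sm L C m. q \<inter> \<Theta> = s}" for s
    \<comment> \<open>Only traces of positive weight are kept. This ensures that they come from
      types, and that every formula of \<Theta> in a sampled type has positive measure.\<close>
    define \<Omega> where "\<Omega> = {s \<in> Pow \<Theta>. 0 < w s}"
    define \<F> where "\<F> = (\<lambda>b. {s \<in> \<Omega>. plug \<phi> b \<in> s}) ` {b. range b \<subseteq> univ C \<and> plug \<phi> b \<in> \<Theta>}"
    have fin: "finite \<Omega>" using \<Theta> by (simp add: \<Omega>_def)
    have w0: "0 \<le> w s" for s by (simp add: w_def)
    have wsum: "sum w (R \<inter> \<Omega>) = measure \<N> {q \<in> Sm L C m. q \<inter> \<Theta> \<in> R}" if "R \<subseteq> Pow \<Theta>" for R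
    proof -
      have "finite R" using \<Theta>(1) that by (meson finite_Pow_iff finite_subset)
      then have "sum w (R \<inter> \<Omega>) = sum w R"
        using that w0 by (intro sum.mono_neutral_left) (auto simp: \<Omega>_def less_le)
      then show ?thesis using pattern_sum[OF \<Theta> that] by (simp add: w_def)
    qed
    have one: "sum w \<Omega> = 1"
    proof -
      have "sum w (Pow \<Theta> \<inter> \<Omega>) = measure \<N> {q \<in> Sm L C m. q \<inter> \<Theta> \<in> Pow \<Theta>}" by (rule wsum) simp
      also have "{q \<in> Sm L C m. q \<inter> \<Theta> \<in> Pow \<Theta>} = space \<N>" by (auto simp: borel_extension(2))
      also have "Pow \<Theta> \<inter> \<Omega> = \<Omega>" by (auto simp: \<Omega>_def)
      finally show ?thesis by (simp add: N.prob_space)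
    qed
    have ex_q: "\<exists>q\<in>Sm L C m. q \<inter> \<Theta> = s" if "s \<in> \<Omega>" for s
    proof (rule ccontr)
      assume "\<not> ?thesis"
      then have "{q \<in> Sm L C m. q \<inter> \<Theta> = s} = {}" by blast
      then have "w s = measure \<N> {}" unfolding w_def by (rule arg_cong)
      then have "w s = 0" by simp
      then show False using that by (simp add: \<Omega>_def)
    qed
    \<comment> \<open>Each trace is realized by a tuple of C, since a type contains the formulas of
      the trace and the negations of the others. Shattered traces would thus give a shattered
      sequence of tuples of length d.\<close>
    have noshat: "\<not> shatters \<F> S" if S: "S \<subseteq> \<Omega>" "card S = d" for S
    proof
      assume shat: "shatters \<F> S"
      have "finite S" using S fin finite_subset by blast
      then obtain f where f: "bij_betw f {..<d} S" using S(2) ex_bij_betw_nat_finite[of S] by (metis atLeast0LessThan)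
      have "\<exists>a. range a \<subseteq> univ C \<and> (\<forall>\<theta>\<in>\<Theta>. psat C a \<theta> \<longleftrightarrow> \<theta> \<in> s)" if sS: "s \<in> S" for s
      proof -
        obtain q where q: "q \<in> Sm L C m" "q \<inter> \<Theta> = s" using ex_q[of s] sS S(1) by blast
        have qt: "q \<in> types L C (univ C)" using q by (simp add: Sm_def)
        have "finite (s \<union> Neg ` (\<Theta> - s))" using q \<Theta> by auto
        moreover have "s \<union> Neg ` (\<Theta> - s) \<subseteq> q"
          using q \<Theta> by (auto simp: types_Neg[OF qt])
        ultimately obtain a where a: "range a \<subseteq> univ C" "\<And>\<theta>. \<theta> \<in> s \<union> Neg ` (\<Theta> - s) \<Longrightarrow> psat C a \<theta>"
          using types_finsat[OF qt] by metis
        have "psat C a \<theta> \<longleftrightarrow> \<theta> \<in> s" if "\<theta> \<in> \<Theta>" for \<theta>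
          using a(2)[of \<theta>] a(2)[of "Neg \<theta>"] that by (cases "\<theta> \<in> s") auto
        then show ?thesis using a(1) by blast
      qed
      then obtain a where a: "\<And>s. s \<in> S \<Longrightarrow> range (a s) \<subseteq> univ C"
        "\<And>s \<theta>. s \<in> S \<Longrightarrow> \<theta> \<in> \<Theta> \<Longrightarrow> psat C (a s) \<theta> \<longleftrightarrow> \<theta> \<in> s" by metis
      have fS: "f k \<in> S" if "k < d" for k using f that by (auto simp: bij_betw_def)
      have "(\<forall>k<d. range (a (f k)) \<subseteq> univ C) \<and>
        (\<forall>R\<subseteq>{..<d}. \<exists>b. range b \<subseteq> univ C \<and> (\<forall>k<d. sat C (case_sum b (a (f k))) \<phi> \<longleftrightarrow> k \<in> R))"
      proof (intro conjI allI impI)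
        show "range (a (f k)) \<subseteq> univ C" if "k < d" for k using a(1)[OF fS[OF that]] .
        fix R :: "nat set" assume R: "R \<subseteq> {..<d}"
        then have "f ` R \<subseteq> S" using fS by auto
        from shattersD[OF shat this] obtain A where A: "A \<in> \<F>" "A \<inter> S = f ` R" by blast
        then obtain b where b: "range b \<subseteq> univ C" "plug \<phi> b \<in> \<Theta>" "A = {s \<in> \<Omega>. plug \<phi> b \<in> s}" by (auto simp: \<F>_def)
        have "sat C (case_sum b (a (f k))) \<phi> \<longleftrightarrow> k \<in> R" if k: "k < d" for k
        proof -
          have "sat C (case_sum b (a (f k))) \<phi> \<longleftrightarrow> plug \<phi> b \<in> f k"
            using a(2)[OF fS[OF k] b(2)] by (simp add: psat_plug)
          also have "\<dots> \<longleftrightarrow> f k \<in> A \<inter> S" using fS[OF k] S b(3) by auto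
          also have "\<dots> \<longleftrightarrow> k \<in> R" unfolding A(2) using f k R by (auto simp: bij_betw_def dest: inj_onD)
          finally show ?thesis .
        qed
        then show "\<exists>b. range b \<subseteq> univ C \<and> (\<forall>k<d. sat C (case_sum b (a (f k))) \<phi> \<longleftrightarrow> k \<in> R)" using b(1) by blast
      qed
      with d show False by (elim notE) (rule exI[of _ "\<lambda>k. a (f k)"])
    qed
    have "\<F> \<subseteq> Pow \<Omega>" by (auto simp: \<F>_def)
    then have "\<exists>x :: nat \<Rightarrow> _. (\<forall>i<n. x i \<in> \<Omega>) \<and> (\<forall>A\<in>\<F>. \<bar>(\<Sum>i<n. of_bool (x i \<in> A)) / real n - sum w A\<bar> \<le> \<epsilon>)"
      using noshat by (intro vc[THEN spec, THEN spec, THEN spec, THEN mp, THEN mp, THEN mp, THEN mp, THEN mp, of \<Omega> w \<F>])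
        (simp_all add: fin one w0)
    then obtain x where x: "\<And>i. i < n \<Longrightarrow> x i \<in> \<Omega>" "\<And>A. A \<in> \<F> \<Longrightarrow> \<bar>(\<Sum>i<n. of_bool (x i \<in> A)) / real n - sum w A\<bar> \<le> \<epsilon>"
      by blast
    have "\<forall>i\<in>{..<n}. \<exists>q. q \<in> Sm L C m \<and> q \<inter> \<Theta> = x i" using ex_q x(1) by blast
    from bchoice[OF this] obtain q where q: "\<And>i. i < n \<Longrightarrow> q i \<in> Sm L C m" "\<And>i. i < n \<Longrightarrow> q i \<inter> \<Theta> = x i" by auto
    have "0 < \<mu> \<theta>" if i: "i < n" and \<theta>: "\<theta> \<in> \<Theta> \<inter> q i" for i \<theta>
    proof -
      have "0 < w (x i)" using x(1)[OF i] by (simp add: \<Omega>_def)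
      also have "w (x i) \<le> measure \<N> {p \<in> Sm L C m. \<theta> \<in> p}"
        unfolding w_def
      proof (rule N.finite_measure_mono)
        show "{p \<in> Sm L C m. p \<inter> \<Theta> = x i} \<subseteq> {p \<in> Sm L C m. \<theta> \<in> p}" using q(2)[OF i] \<theta> by blast
        show "{p \<in> Sm L C m. \<theta> \<in> p} \<in> sets \<N>" using \<theta> \<Theta> by (intro sets_mem) auto
      qed
      also have "\<dots> = \<mu> \<theta>" using \<theta> \<Theta> by (intro borel_extension(5)) auto
      finally show ?thesis .
    qed
    moreover have "\<bar>(\<Sum>i<n. of_bool (plug \<phi> b \<in> q i)) / real n - \<mu> (plug \<phi> b)\<bar> \<le> \<epsilon>"
      if b: "range b \<subseteq> univ C" "plug \<phi> b \<in> \<Theta>" for b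
    proof -
      let ?A = "{s \<in> \<Omega>. plug \<phi> b \<in> s}"
      have bP: "plug \<phi> b \<in> P" using \<Theta> b by blast
      have "?A \<in> \<F>" using b by (auto simp: \<F>_def)
      moreover have "sum w ?A = \<mu> (plug \<phi> b)"
      proof -
        have A: "?A = {s \<in> Pow \<Theta>. plug \<phi> b \<in> s} \<inter> \<Omega>" by (auto simp: \<Omega>_def)
        have "sum w ?A = measure \<N> {q \<in> Sm L C m. q \<inter> \<Theta> \<in> {s \<in> Pow \<Theta>. plug \<phi> b \<in> s}}"
          unfolding A by (rule wsum) auto
        also have "{q \<in> Sm L C m. q \<inter> \<Theta> \<in> {s \<in> Pow \<Theta>. plug \<phi> b \<in> s}} = {q \<in> Sm L C m. plug \<phi> b \<in> q}" using b by auto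
        finally show ?thesis using borel_extension(5)[OF bP] by simp
      qed
      moreover have "of_bool (x i \<in> ?A) = (of_bool (plug \<phi> b \<in> q i) :: real)" if "i < n" for i
        using q(2)[OF that] x(1)[OF that] b by auto
      ultimately show ?thesis using x(2)[of ?A] by (simp cong: sum.cong_simp)
    qed
    ultimately show ?thesis using q by blast
  qed
  then show ?thesis using n by blast
qed

text \<open>The n-tuples of types obtained for finite \<Theta> all have the same length, so an
  ultralimit can be taken coordinatewise. Each single instance, and each single positivity, is
  already decided at almost every \<Theta>.\<close>

theorem approximation:
  fixes \<phi> :: "('f, 'r, 'j + 'i) fml"
  assumes \<phi>: "\<phi> \<in> fmls L" and cj: "countable (UNIV :: 'j set)" and \<epsilon>: "0 < \<epsilon>"
  obtains n :: nat and q where "n > 0"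
     "\<And>i. i < n \<Longrightarrow> q i \<in> Sm L C m" "\<And>i \<theta>. i < n \<Longrightarrow> \<theta> \<in> q i \<Longrightarrow> 0 < \<mu> \<theta>"
     "\<And>b. range b \<subseteq> univ C \<Longrightarrow>
        \<bar>(\<Sum>i<n. of_bool (plug \<phi> b \<in> q i)) / real n - \<mu> (plug \<phi> b)\<bar> \<le> \<epsilon>"
proof -
  obtain n :: nat where n: "n > 0" and
    ap: "\<And>\<Theta>. finite \<Theta> \<Longrightarrow> \<Theta> \<subseteq> P \<Longrightarrow> (\<exists>q. (\<forall>i<n. q i \<in> Sm L C m \<and> (\<forall>\<theta>\<in>\<Theta> \<inter> q i. 0 < \<mu> \<theta>)) \<and>
     (\<forall>b. range b \<subseteq> univ C \<longrightarrow> plug \<phi> b \<in> \<Theta> \<longrightarrow>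
        \<bar>(\<Sum>i<n. of_bool (plug \<phi> b \<in> q i)) / real n - \<mu> (plug \<phi> b)\<bar> \<le> \<epsilon>))"
    using approximation_finite[OF \<phi> cj \<epsilon>] by blast
  define Q where "Q \<Theta> q \<longleftrightarrow> (\<forall>i<n. q i \<in> Sm L C m \<and> (\<forall>\<theta>\<in>\<Theta> \<inter> q i. 0 < \<mu> \<theta>)) \<and>
     (\<forall>b. range b \<subseteq> univ C \<longrightarrow> plug \<phi> b \<in> \<Theta> \<longrightarrow>
        \<bar>(\<Sum>i<n. of_bool (plug \<phi> b \<in> q i)) / real n - \<mu> (plug \<phi> b)\<bar> \<le> \<epsilon>)" for \<Theta> q
  define q where "q \<Theta> = (SOME q. Q \<Theta> q)" for \<Theta>
  have Qq: "Q \<Theta> (q \<Theta>)" if "finite \<Theta> \<and> \<Theta> \<subseteq> P" for \<Theta>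
  proof -
    have ex: "\<exists>q. Q \<Theta> q" unfolding Q_def using that by (intro ap) auto
    from someI_ex[OF ex] show ?thesis unfolding q_def .
  qed
  obtain U where U: "ultra U" "\<And>\<theta>. \<theta> \<in> P \<Longrightarrow> eventually (\<lambda>S. \<theta> \<in> S) U" "eventually (\<lambda>S. finite S \<and> S \<subseteq> P) U"
    using ultra_finite_subsets[of P] by blast
  have evQ: "eventually (\<lambda>\<Theta>. Q \<Theta> (q \<Theta>)) U" using U(3) by eventually_elim (rule Qq)
  define r where "r i = {\<theta> \<in> P. eventually (\<lambda>\<Theta>. \<theta> \<in> q \<Theta> i) U}" for i
  show ?thesis
  proof (rule that[of n r])
    show "n > 0" by (rule n)
    fix i assume i: "i < n"
    have evi: "eventually (\<lambda>\<Theta>. q \<Theta> i \<in> Sm L C m) U" using evQ by eventually_elim (use i in \<open>simp add: Q_def\<close>)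
    show "r i \<in> Sm L C m"
      unfolding Sm_def
    proof (intro CollectI conjI subsetI)
      show "r i \<in> types L C (univ C)" unfolding r_def
        by (rule ultra_limit_of_types[OF U(1)]) (use evi in \<open>simp add: Sm_def eventually_conj_iff\<close>)
      fix \<theta> assume \<theta>: "\<theta> \<in> tp L C {} m"
      have "eventually (\<lambda>\<Theta>. \<theta> \<in> q \<Theta> i) U" using evi by eventually_elim (use \<theta> in \<open>auto simp: Sm_def\<close>)
      moreover have "\<theta> \<in> P" using \<theta> pfmls_mono[of "{}" "univ C" L] by (auto simp: tp_def)
      ultimately show "\<theta> \<in> r i" by (simp add: r_def)
    qed
    fix \<theta> assume \<theta>: "\<theta> \<in> r i"
    then have "\<theta> \<in> P" "eventually (\<lambda>\<Theta>. \<theta> \<in> q \<Theta> i) U" by (auto simp: r_def)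
    with U(2)[of \<theta>] have "eventually (\<lambda>\<Theta>. \<theta> \<in> q \<Theta> i \<and> \<theta> \<in> \<Theta>) U" by (simp add: eventually_conj_iff)
    with evQ have "eventually (\<lambda>\<Theta>. 0 < \<mu> \<theta>) U" by eventually_elim (use i in \<open>auto simp: Q_def\<close>)
    from ultra_ex[OF U(1) this] show "0 < \<mu> \<theta>" by simp
  next
    fix b :: "'j \<Rightarrow> 'c" assume b: "range b \<subseteq> univ C"
    have bP: "plug \<phi> b \<in> P" by (rule plug_pfmls[OF \<phi> b])
    have "eventually (\<lambda>\<Theta>. (plug \<phi> b \<in> q \<Theta> i) = (plug \<phi> b \<in> r i)) U" for i
    proof (cases "plug \<phi> b \<in> r i")
      case True
      then show ?thesis by (simp add: r_def)
    next
      case False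
      then show ?thesis using bP by (simp add: r_def ultra_not[OF U(1)])
    qed
    then have "eventually (\<lambda>\<Theta>. \<forall>i\<in>{..<n}. (plug \<phi> b \<in> q \<Theta> i) = (plug \<phi> b \<in> r i)) U"
      by (intro eventually_ball_finite) auto
    with evQ U(2)[OF bP] have "eventually (\<lambda>\<Theta>. Q \<Theta> (q \<Theta>) \<and> plug \<phi> b \<in> \<Theta> \<and> (\<forall>i\<in>{..<n}. (plug \<phi> b \<in> q \<Theta> i) = (plug \<phi> b \<in> r i))) U"
      by eventually_elim auto
    from ultra_ex[OF U(1) this] obtain \<Theta> where \<Theta>: "Q \<Theta> (q \<Theta>)" "plug \<phi> b \<in> \<Theta>"
      "\<And>i. i < n \<Longrightarrow> (plug \<phi> b \<in> q \<Theta> i) = (plug \<phi> b \<in> r i)" by auto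
    have "(\<Sum>i<n. of_bool (plug \<phi> b \<in> r i)) = (\<Sum>i<n. of_bool (plug \<phi> b \<in> q \<Theta> i) :: real)"
      using \<Theta>(3) by (intro sum.cong) auto
    then show "\<bar>(\<Sum>i<n. of_bool (plug \<phi> b \<in> r i)) / real n - \<mu> (plug \<phi> b)\<bar> \<le> \<epsilon>"
      using \<Theta>(1,2) b by (simp add: Q_def)
  qed
qed

end

section \<open>Borel definability of invariant measures\<close>

lemma types_restrict:
  fixes p :: "('f, 'r, 'j + 'c) fml set"
  assumes p: "p \<in> types L N B" and AB: "A \<subseteq> B"
  shows "p \<inter> pfmls L A \<in> types L N A"
  unfolding types_def
proof (intro CollectI conjI allI impI ballI)
  fix \<Gamma> :: "('f, 'r, 'j + 'c) fml set" assume "finite \<Gamma>" "\<Gamma> \<subseteq> p \<inter> pfmls L A"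
  then have \<Gamma>: "finite \<Gamma>" "\<Gamma> \<subseteq> p" by auto
  show "\<exists>a. range a \<subseteq> univ N \<and> (\<forall>\<phi>\<in>\<Gamma>. psat N a \<phi>)" using types_finsat[OF p \<Gamma>] by metis
next
  fix \<phi> :: "('f, 'r, 'j + 'c) fml" assume "\<phi> \<in> pfmls L A"
  then show "\<phi> \<in> p \<inter> pfmls L A \<or> Neg \<phi> \<in> p \<inter> pfmls L A"
    using types_Neg[OF p, of \<phi>] pfmls_mono[OF AB, of L] by auto
qed auto

lemma Aut_comp:
  assumes "\<sigma> \<in> Aut L N" "\<tau> \<in> Aut L N"
  shows "\<sigma> \<circ> \<tau> \<in> Aut L N"
  unfolding Aut_def
proof (intro CollectI conjI ballI allI impI)
  show "bij_betw (\<sigma> \<circ> \<tau>) (univ N) (univ N)" using AutD(1)[OF assms(1)] AutD(1)[OF assms(2)] bij_betw_trans by blast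
next
  fix f as assume as: "f \<in> fsyms L" "length as = farity L f" "set as \<subseteq> univ N"
  have "set (map \<tau> as) \<subseteq> univ N" using as AutD(2)[OF assms(2)] by auto
  then show "(\<sigma> \<circ> \<tau>) (fint N f as) = fint N f (map (\<sigma> \<circ> \<tau>) as)"
    using AutD(3)[OF assms(2) as] AutD(3)[OF assms(1) as(1), of "map \<tau> as"] as by simp
next
  fix r as assume as: "r \<in> rsyms L" "length as = rarity L r" "set as \<subseteq> univ N"
  have "set (map \<tau> as) \<subseteq> univ N" using as AutD(2)[OF assms(2)] by auto
  then show "rint N r as \<longleftrightarrow> rint N r (map (\<sigma> \<circ> \<tau>) as)"
    using AutD(4)[OF assms(2) as] AutD(4)[OF assms(1) as(1), of "map \<tau> as"] as by simp
qed

lemma psat_act: "psat N (\<sigma> \<circ> a) (act \<sigma> \<theta>) = sat N (\<sigma> \<circ> case_sum a id) \<theta>"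
proof -
  have "case_sum (\<sigma> \<circ> a) id \<circ> map_sum id \<sigma> = \<sigma> \<circ> case_sum a id"
    by (auto simp: fun_eq_iff split: sum.splits)
  then show ?thesis by (simp add: act_def psat_def sat_ren)
qed

lemma act_pfmls: "\<theta> \<in> pfmls L A \<Longrightarrow> act \<sigma> \<theta> \<in> pfmls L (\<sigma> ` A)"
  by (auto simp: act_def pfmls_def fml.set_map map_sum_def split: sum.splits)

lemma act_surj:
  assumes "\<theta> \<in> pfmls L (\<sigma> ` A)"
  obtains \<theta>' where "\<theta>' \<in> pfmls L A" "act \<sigma> \<theta>' = \<theta>"
proof -
  define \<theta>' where "\<theta>' = ren (map_sum id (inv_into A \<sigma>)) \<theta>"
  have "act \<sigma> \<theta>' = ren id \<theta>" unfolding act_def \<theta>'_def ren_ren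
  proof (rule ren_cong_fv)
    fix x assume x: "x \<in> fv \<theta>"
    show "(map_sum id \<sigma> \<circ> map_sum id (inv_into A \<sigma>)) x = id x"
    proof (cases x)
      case (Inr c)
      then have "c \<in> \<sigma> ` A" using x assms by (auto simp: pfmls_def)
      then show ?thesis using Inr by (simp add: f_inv_into_f)
    qed simp
  qed
  then have "act \<sigma> \<theta>' = \<theta>" by (simp add: fml.map_id)
  moreover have "\<theta>' \<in> pfmls L A"
    using assms by (auto simp: \<theta>'_def pfmls_def fml.set_map map_sum_def inv_into_into split: sum.splits)
  ultimately show ?thesis using that by blast
qed

lemma pfmls_fv: "\<theta> \<in> pfmls L A \<Longrightarrow> A \<subseteq> U \<Longrightarrow> range a \<subseteq> U \<Longrightarrow> v \<in> fv \<theta> \<Longrightarrow> case_sum a id v \<in> U"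
  by (cases v) (auto simp: pfmls_def)

lemma psat_act_Aut:
  assumes "\<sigma> \<in> Aut L N" "is_struct L N" "\<theta> \<in> pfmls L (univ N)" "range a \<subseteq> univ N"
  shows "psat N (\<sigma> \<circ> a) (act \<sigma> \<theta>) = psat N a \<theta>"
proof -
  have "\<theta> \<in> fmls L" using assms(3) by (simp add: pfmls_def)
  then show ?thesis unfolding psat_act psat_def[of N a]
    using assms by (intro sat_Aut) (auto intro: pfmls_fv)
qed

lemma psat_Aut_over:
  assumes \<sigma>: "\<sigma> \<in> Aut_over L N A" and N: "is_struct L N" and A: "A \<subseteq> univ N"
    and \<theta>: "\<theta> \<in> pfmls L A" and a: "range a \<subseteq> univ N"
  shows "psat N (\<sigma> \<circ> a) \<theta> = psat N a \<theta>"
proof -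
  have "act \<sigma> \<theta> = ren id \<theta>" unfolding act_def
  proof (rule ren_cong_fv)
    fix x assume x: "x \<in> fv \<theta>"
    show "map_sum id \<sigma> x = id x"
    proof (cases x)
      case (Inr c)
      then show ?thesis using x \<sigma> \<theta> by (simp add: Aut_over_def pfmls_def)
    qed simp
  qed
  then have "act \<sigma> \<theta> = \<theta>" by (simp add: fml.map_id)
  then show ?thesis using psat_act_Aut[of \<sigma> L N \<theta> a] \<sigma> N \<theta> a pfmls_mono[OF A, of L] by (auto simp: Aut_over_def)
qed

lemma tp_Aut_over:
  assumes "\<sigma> \<in> Aut_over L N A" "is_struct L N" "A \<subseteq> univ N" "range a \<subseteq> univ N"
  shows "tp L N A (\<sigma> \<circ> a) = tp L N A a"
  using psat_Aut_over[OF assms(1-3) _ assms(4)] by (auto simp: tp_def)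

lemma Aut_over_range:
  "\<sigma> \<in> Aut_over L N A \<Longrightarrow> range a \<subseteq> univ N \<Longrightarrow> range (\<sigma> \<circ> a) \<subseteq> univ N"
  by (auto simp: Aut_over_def dest: AutD(2))

lemma sat_Aut_pair:
  assumes "\<sigma> \<in> Aut_over L N A" "is_struct L N" "\<phi> \<in> fmls L" "range a \<subseteq> univ N" "range b \<subseteq> univ N"
  shows "sat N (case_sum (\<sigma> \<circ> a) (\<sigma> \<circ> b)) \<phi> = sat N (case_sum a b) \<phi>"
proof -
  have "case_sum (\<sigma> \<circ> a) (\<sigma> \<circ> b) = \<sigma> \<circ> case_sum a b" by (auto simp: fun_eq_iff split: sum.splits)
  moreover have "sat N (\<sigma> \<circ> case_sum a b) \<phi> = sat N (case_sum a b) \<phi>"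
    using assms by (intro sat_Aut) (auto simp: Aut_over_def split: sum.splits)
  ultimately show ?thesis by simp
qed

text \<open>Closing the finitely many variables of \<xi> existentially gives a formula over M, true
  in C and hence in M. A witness in M is then read again in C.\<close>

lemma elem_sub_witness:
  fixes M :: "('f, 'r, 'c) struct" and b :: "'j \<Rightarrow> 'c"
  assumes elem_M: "elem_sub L M C" and \<xi>: "\<xi> \<in> pfmls L (univ M)" and b: "range b \<subseteq> univ C" "psat C b \<xi>"
  shows "\<exists>a. range a \<subseteq> univ M \<and> psat C a \<xi>"
proof -
  obtain x0 where x0: "x0 \<in> univ M" using elem_M by (auto simp: elem_sub_def is_struct_def)
  define V where "V = fv \<xi> \<inter> range Inl"
  have "\<xi> \<in> fmls L" "finite V" using \<xi> by (auto simp: pfmls_def V_def finite_fv)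
  from exists_formula[OF this] obtain \<zeta> where \<zeta>: "\<zeta> \<in> fmls L" "fv \<zeta> = fv \<xi> - V"
    "\<And>(N :: ('f, 'r, 'c) struct) e. sat N e \<zeta> \<longleftrightarrow>
       (\<exists>e'. (\<forall>v\<in>V. e' v \<in> univ N) \<and> (\<forall>v. v \<notin> V \<longrightarrow> e' v = e v) \<and> sat N e' \<xi>)" by blast
  define e :: "'j + 'c \<Rightarrow> 'c" where "e = case_sum (\<lambda>_. x0) id"
  have fv_M: "c \<in> univ M" if "Inr c \<in> fv \<xi>" for c using \<xi> that by (simp add: pfmls_def)
  have "sat C e \<zeta>" unfolding \<zeta>(3)
  proof (intro exI[of _ "\<lambda>v. if v \<in> V then case_sum b id v else e v"] conjI ballI allI impI)
    have "sat C (\<lambda>v. if v \<in> V then case_sum b id v else e v) \<xi> = sat C (case_sum b id) \<xi>"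
      by (rule sat_cong) (auto simp: V_def e_def split: sum.splits)
    then show "sat C (\<lambda>v. if v \<in> V then case_sum b id v else e v) \<xi>" using b(2) by (simp add: psat_def)
  qed (use b(1) in \<open>auto simp: V_def\<close>)
  moreover have "e v \<in> univ M" if "v \<in> fv \<zeta>" for v
    by (cases v) (use that fv_M in \<open>auto simp: \<zeta>(2) V_def e_def\<close>)
  ultimately have "sat M e \<zeta>" using elem_sub_sat[OF elem_M \<zeta>(1)] by blast
  then obtain e' where e': "\<forall>v\<in>V. e' v \<in> univ M" "\<forall>v. v \<notin> V \<longrightarrow> e' v = e v" "sat M e' \<xi>"
    unfolding \<zeta>(3) by blast
  define a where "a j = (if Inl j \<in> V then e' (Inl j) else x0)" for j
  have aM: "range a \<subseteq> univ M" using e'(1) x0 by (auto simp: a_def)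
  have "sat M e' \<xi> = sat M (case_sum a id) \<xi>"
  proof (rule sat_cong)
    fix v assume v: "v \<in> fv \<xi>"
    show "e' v = case_sum a id v" by (cases v) (use v e'(2) in \<open>auto simp: a_def V_def e_def\<close>)
  qed
  also have "\<dots> = sat C (case_sum a id) \<xi>"
    using \<xi> aM by (intro elem_sub_sat[OF elem_M]) (auto simp: pfmls_def intro: pfmls_fv[OF \<xi>])
  finally show ?thesis using aM e'(3) by (auto simp: psat_def)
qed

section \<open>Morley sequences, coheirs and alternation numbers\<close>

context nip_setting
begin

definition realizes :: "('f, 'r, 'j + 'c) fml set \<Rightarrow> 'c set \<Rightarrow> ('j \<Rightarrow> 'c) \<Rightarrow> bool" where
  "realizes p A a \<longleftrightarrow> range a \<subseteq> univ C \<and> (\<forall>\<theta>\<in>pfmls L A. psat C a \<theta> \<longleftrightarrow> \<theta> \<in> p)"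

definition invariant_type :: "('f, 'r, 'j + 'c) fml set \<Rightarrow> bool" where
  "invariant_type p \<longleftrightarrow> p \<in> types L C (univ C) \<and>
     (\<forall>\<sigma>\<in>Aut_over L C (univ M). \<forall>\<phi>\<in>pfmls L (univ C). act \<sigma> \<phi> \<in> p \<longleftrightarrow> \<phi> \<in> p)"

definition morley :: "('f, 'r, 'j + 'c) fml set \<Rightarrow> 'c set \<Rightarrow> (nat \<Rightarrow> 'j \<Rightarrow> 'c) \<Rightarrow> bool" where
  "morley p A d \<longleftrightarrow> (\<forall>k. realizes p (A \<union> (\<Union>j<k. range (d j))) (d k))"

lemma realizes_mono: "realizes p B a \<Longrightarrow> A \<subseteq> B \<Longrightarrow> realizes p A a"
  using pfmls_mono[of A B L] by (auto simp: realizes_def)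

lemma realizes_tp: "realizes p A a \<Longrightarrow> realizes p A b \<Longrightarrow> tp L C A a = tp L C A b"
  by (auto simp: realizes_def tp_def)

lemma ex_realizes:
  fixes p :: "('f, 'r, 'j + 'c) fml set"
  assumes p: "p \<in> types L C (univ C)" and A: "A \<subseteq> univ C" "countable A" and cj: "countable (UNIV :: 'j set)"
  shows "\<exists>a. realizes p A a"
proof -
  obtain a where "range a \<subseteq> univ C" "tp L C A a = p \<inter> pfmls L A"
    using C.realize_type[OF A(1) C.small_countable[OF A(2)] types_restrict[OF p A(1)] cj] by blast
  then have "realizes p A a" unfolding realizes_def tp_def by blast
  then show ?thesis by blast
qed

lemma ex_morley:
  fixes p :: "('f, 'r, 'j + 'c) fml set"
  assumes p: "p \<in> types L C (univ C)" and A: "A \<subseteq> univ C" "countable A" and cj: "countable (UNIV :: 'j set)"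
  shows "\<exists>d. morley p A d"
  unfolding morley_def
proof (rule dependent_wf_choice[where R = less_than and P = "\<lambda>d k a. realizes p (A \<union> (\<Union>j<k. range (d j))) a"])
  show "\<exists>a. realizes p (A \<union> (\<Union>j<k. range (d j))) a"
    if IH: "\<And>j. (j, k) \<in> less_than \<Longrightarrow> realizes p (A \<union> (\<Union>i<j. range (d i))) (d j)" for k d
  proof (rule ex_realizes[OF p _ _ cj])
    show "A \<union> (\<Union>j<k. range (d j)) \<subseteq> univ C" using A IH by (auto simp: realizes_def)
    have "countable (range (d j))" for j using cj by simp
    then show "countable (A \<union> (\<Union>j<k. range (d j)))" using A(2) by (intro countable_Un countable_UN) auto
  qed
qed auto

lemma morley_range: "morley p A d \<Longrightarrow> range (d k) \<subseteq> univ C"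
  by (simp add: morley_def realizes_def)

text \<open>Indiscernibility in the form needed: an automorphism over M carries a finite increasing
  subsequence onto an initial segment. In the inductive step \<tau> carries the first k entries
  correctly, and \<sigma> corrects the next one while fixing what has been reached.\<close>

lemma morley_indiscernible:
  fixes p :: "('f, 'r, 'j + 'c) fml set"
  assumes p: "invariant_type p" and d: "morley p (univ M) d" and cj: "countable (UNIV :: 'j set)"
  shows "(\<And>s t. s < t \<Longrightarrow> t < k \<Longrightarrow> i s < i t) \<Longrightarrow>
    \<exists>\<tau>\<in>Aut_over L C (univ M). \<forall>j<k. \<tau> \<circ> d (i j) = d j"
proof (induction k)
  case 0
  have "id \<in> Aut_over L C (univ M)" by (auto simp: Aut_over_def Aut_def)
  then show ?case by blast
next
  case (Suc k)
  have "\<exists>\<tau>\<in>Aut_over L C (univ M). \<forall>j<k. \<tau> \<circ> d (i j) = d j"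
  proof (rule Suc.IH)
    fix s t assume "s < t" "t < k"
    then show "i s < i t" using Suc.prems[of s t] by simp
  qed
  then obtain \<tau> where \<tau>: "\<tau> \<in> Aut_over L C (univ M)" "\<forall>j<k. \<tau> \<circ> d (i j) = d j" by blast
  define A where "A = univ M \<union> (\<Union>j<k. range (d j))"
  define B where "B = univ M \<union> (\<Union>j<k. range (d (i j)))"
  have cA: "countable A" unfolding A_def using cj countable_M by (intro countable_Un countable_UN) auto
  have AC: "A \<subseteq> univ C" "B \<subseteq> univ C" using M_sub morley_range[OF d] by (auto simp: A_def B_def)
  have "\<tau> ` univ M = univ M" using \<tau>(1) by (auto simp: Aut_over_def image_iff)
  moreover have "\<tau> ` range (d (i j)) = range (d j)" if "j < k" for j
    using \<tau>(2) that by (metis image_comp)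
  ultimately have \<tau>B: "A = \<tau> ` B" by (simp add: A_def B_def image_Un image_UN)
  have e: "range (\<tau> \<circ> d (i k)) \<subseteq> univ C" by (rule Aut_over_range[OF \<tau>(1) morley_range[OF d]])
  have dk: "realizes p A (d k)" using d by (simp add: morley_def A_def)
  have dik: "realizes p B (d (i k))"
  proof -
    have "i j < i k" if "j < k" for j using Suc.prems that by blast
    then have "B \<subseteq> univ M \<union> (\<Union>j<i k. range (d j))" by (auto simp: B_def)
    then show ?thesis using d realizes_mono unfolding morley_def by blast
  qed
  \<comment> \<open>Invariance of p lets the realization over B be moved by \<tau> to a realization
    over A.\<close>
  have "realizes p A (\<tau> \<circ> d (i k))"
    unfolding realizes_def
  proof (intro conjI ballI e)
    fix \<theta> :: "('f, 'r, 'j + 'c) fml" assume "\<theta> \<in> pfmls L A"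
    then obtain \<theta>' where \<theta>': "\<theta>' \<in> pfmls L B" "act \<tau> \<theta>' = \<theta>" unfolding \<tau>B using act_surj by blast
    have \<theta>'P: "\<theta>' \<in> pfmls L (univ C)" using \<theta>'(1) pfmls_mono[OF AC(2), of L] by blast
    have "psat C (\<tau> \<circ> d (i k)) \<theta> \<longleftrightarrow> psat C (d (i k)) \<theta>'"
      unfolding \<theta>'(2)[symmetric] using \<tau>(1) \<theta>'P morley_range[OF d]
      by (intro psat_act_Aut[OF _ C.struct]) (auto simp: Aut_over_def)
    also have "\<dots> \<longleftrightarrow> \<theta>' \<in> p" using dik \<theta>'(1) by (simp add: realizes_def)
    also have "\<dots> \<longleftrightarrow> \<theta> \<in> p" using p \<tau>(1) \<theta>'P \<theta>'(2) unfolding invariant_type_def by blast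
    finally show "psat C (\<tau> \<circ> d (i k)) \<theta> \<longleftrightarrow> \<theta> \<in> p" .
  qed
  from realizes_tp[OF this dk] obtain \<sigma> where \<sigma>: "\<sigma> \<in> Aut_over L C A" "\<sigma> \<circ> (\<tau> \<circ> d (i k)) = d k"
    using C.tp_eq_Aut[OF AC(1) C.small_countable[OF cA] cj e morley_range[OF d]] by blast
  have "\<sigma> \<circ> \<tau> \<in> Aut_over L C (univ M)"
    using \<sigma>(1) \<tau>(1) Aut_comp by (auto simp: Aut_over_def A_def)
  moreover have "(\<sigma> \<circ> \<tau>) \<circ> d (i j) = d j" if "j < Suc k" for j
  proof (cases "j = k")
    case True
    then show ?thesis using \<sigma>(2) by (simp add: comp_assoc)
  next
    case False
    then have j: "j < k" using that by simp
    have "\<sigma> \<circ> d j = d j" using \<sigma>(1) j by (auto simp: Aut_over_def A_def fun_eq_iff)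
    then show ?thesis using \<tau>(2) j by (metis comp_assoc)
  qed
  ultimately show ?case by blast
qed

text \<open>The extension is a coheir, finitely satisfiable in M, which is possible by elementarity.
  Automorphisms over M fix every tuple of M, so no such tuple distinguishes \<theta> from its image,
  and the symmetric difference cannot lie in q.\<close>

lemma ex_invariant_extension:
  fixes b :: "'j \<Rightarrow> 'c"
  assumes b: "range b \<subseteq> univ C"
  obtains q where "invariant_type q" "tp L C (univ M) b \<subseteq> q"
proof -
  define Z where "Z = {a :: 'j \<Rightarrow> 'c. range a \<subseteq> univ M}"
  have "\<exists>q. q \<in> types L C (univ C) \<and> tp L C (univ M) b \<subseteq> q \<and> (\<forall>\<theta>\<in>q. \<exists>a\<in>Z. psat C a \<theta>)"
  proof (rule complete_type[of "tp L C (univ M) b" L "univ C" Z C])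
    show "tp L C (univ M) b \<subseteq> pfmls L (univ C)" using pfmls_mono[OF M_sub, of L] by (auto simp: tp_def)
    show "range a \<subseteq> univ C" if "a \<in> Z" for a using that M_sub by (auto simp: Z_def)
    fix \<Delta> assume \<Delta>: "finite \<Delta>" "\<Delta> \<subseteq> tp L C (univ M) b"
    then have "\<Delta> \<subseteq> pfmls L (univ M)" by (auto simp: tp_def)
    from C.ex_conj[OF \<Delta>(1) this] obtain \<xi> where \<xi>: "\<xi> \<in> pfmls L (univ M)" "\<And>e. psat C e \<xi> \<longleftrightarrow> (\<forall>\<psi>\<in>\<Delta>. psat C e \<psi>)" by blast
    have "psat C b \<xi>" using \<xi>(2) \<Delta>(2) by (auto simp: tp_def)
    from elem_sub_witness[OF elem_M \<xi>(1) b this] show "\<exists>a\<in>Z. \<forall>\<phi>\<in>\<Delta>. psat C a \<phi>" using \<xi>(2) by (auto simp: Z_def)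
  qed blast
  then obtain q where q: "q \<in> types L C (univ C)" "tp L C (univ M) b \<subseteq> q" "\<And>\<theta>. \<theta> \<in> q \<Longrightarrow> \<exists>a\<in>Z. psat C a \<theta>" by blast
  have "act \<sigma> \<theta> \<in> q \<longleftrightarrow> \<theta> \<in> q" if \<sigma>: "\<sigma> \<in> Aut_over L C (univ M)" and \<theta>: "\<theta> \<in> pfmls L (univ C)" for \<sigma> \<theta>
  proof -
    have a\<theta>: "act \<sigma> \<theta> \<in> pfmls L (univ C)"
    proof -
      have "\<sigma> ` univ C = univ C" using AutD(1)[of \<sigma> L C] \<sigma> by (simp add: Aut_over_def bij_betw_def)
      then show ?thesis using act_pfmls[OF \<theta>, of \<sigma>] by simp
    qed
    have "Xor (act \<sigma> \<theta>) \<theta> \<notin> q"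
    proof
      assume "Xor (act \<sigma> \<theta>) \<theta> \<in> q"
      then obtain a where a: "a \<in> Z" "psat C a (Xor (act \<sigma> \<theta>) \<theta>)" using q(3) by blast
      have aC: "range a \<subseteq> univ C" using a(1) M_sub by (auto simp: Z_def)
      have "\<sigma> \<circ> a = a" using \<sigma> a(1) by (auto simp: Aut_over_def Z_def fun_eq_iff)
      moreover have "psat C (\<sigma> \<circ> a) (act \<sigma> \<theta>) = psat C a \<theta>"
        using \<sigma> \<theta> aC by (intro psat_act_Aut[OF _ C.struct]) (auto simp: Aut_over_def)
      ultimately show False using a(2) by simp
    qed
    then show ?thesis using types_Xor[OF q(1) a\<theta> \<theta>] by blast
  qed
  then have "invariant_type q" using q(1) by (simp add: invariant_type_def)
  then show ?thesis using that q(2) by blast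
qed

text \<open>The condition is on each formula of r separately, which makes the set closed at once.
  That a single realization of r alternates n times is recovered by compactness in
  \<open>alt_setD\<close>. The flag s is the truth value at index 0.\<close>

definition alt_set :: "(nat \<Rightarrow> 'i \<Rightarrow> 'c) \<Rightarrow> ('f, 'r, 'j + 'i) fml \<Rightarrow> nat \<Rightarrow> bool \<Rightarrow> ('f, 'r, 'j + 'c) fml set set" where
  "alt_set d \<phi> n s = {r \<in> types L C (univ M). \<forall>\<theta>\<in>r. \<exists>b. range b \<subseteq> univ C \<and> psat C b \<theta> \<and>
     (\<forall>j<n. sat C (case_sum b (d j)) \<phi> \<longleftrightarrow> even j = s)}"

lemma alt_setI:
  assumes "range b \<subseteq> univ C" "\<forall>j<n. sat C (case_sum b (d j)) \<phi> \<longleftrightarrow> even j = s"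
  shows "tp L C (univ M) b \<in> alt_set d \<phi> n s"
  unfolding alt_set_def using assms tp_types[OF assms(1)] by (auto simp: tp_def)

lemma alt_setD:
  fixes r :: "('f, 'r, 'j + 'c) fml set"
  assumes r: "r \<in> alt_set d \<phi> n s" and cj: "countable (UNIV :: 'j set)"
    and d: "\<And>j. range (d j) \<subseteq> univ C" and \<phi>: "\<phi> \<in> fmls L"
  obtains b where "range b \<subseteq> univ C" "tp L C (univ M) b = r" "\<forall>j<n. sat C (case_sum b (d j)) \<phi> \<longleftrightarrow> even j = s"
proof -
  define D :: "nat \<Rightarrow> ('f, 'r, 'j + 'c) fml" where
    "D k = (if even k = s then ren (case_sum Inl (\<lambda>i. Inr (d k i))) \<phi> else Neg (ren (case_sum Inl (\<lambda>i. Inr (d k i))) \<phi>))" for k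
  have psD: "psat C b (D k) \<longleftrightarrow> (sat C (case_sum b (d k)) \<phi> \<longleftrightarrow> even k = s)" for b k
  proof -
    have "case_sum b id \<circ> case_sum Inl (\<lambda>i. Inr (d k i)) = case_sum b (d k)"
      by (auto simp: fun_eq_iff split: sum.splits)
    then show ?thesis by (simp add: D_def psat_def sat_ren)
  qed
  define A where "A = univ M \<union> (\<Union>k. range (d k))"
  have rt: "r \<in> types L C (univ M)" using r by (simp add: alt_set_def)
  have "\<exists>b. range b \<subseteq> univ C \<and> (\<forall>\<psi>\<in>r \<union> D ` {..<n}. psat C b \<psi>)"
  proof (rule C.realize[where A = A])
    show "A \<subseteq> univ C" using d M_sub by (auto simp: A_def)
    show "|A| <o \<kappa>" unfolding A_def using countable_M countable_i by (intro C.small_countable countable_Un countable_UN) auto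
    have "range (d k) \<subseteq> A" for k by (auto simp: A_def)
    then have "D k \<in> pfmls L A" for k
      using \<phi> by (auto simp: D_def pfmls_def fml.set_map image_subset_iff split: sum.splits if_splits)
    moreover have "r \<subseteq> pfmls L A" using types_pfmls[OF rt] pfmls_mono[of "univ M" A L] by (auto simp: A_def)
    ultimately show "r \<union> D ` {..<n} \<subseteq> pfmls L A" by blast
    fix \<Delta> assume \<Delta>: "finite \<Delta>" "\<Delta> \<subseteq> r \<union> D ` {..<n}"
    define E where "E = \<Delta> \<inter> r"
    have E: "finite E" "E \<subseteq> r" "E \<subseteq> pfmls L (univ M)" using \<Delta> types_pfmls[OF rt] by (auto simp: E_def)
    obtain \<xi> where \<xi>: "\<xi> \<in> pfmls L (univ M)" "\<And>e. psat C e \<xi> \<longleftrightarrow> (\<forall>\<psi>\<in>E. psat C e \<psi>)"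
      using C.ex_conj[OF E(1,3)] by blast
    have "\<xi> \<in> r" using \<xi> by (intro types_closed[OF rt \<xi>(1) E(1,2)]) simp
    then obtain b where b: "range b \<subseteq> univ C" "psat C b \<xi>" "\<forall>j<n. sat C (case_sum b (d j)) \<phi> \<longleftrightarrow> even j = s"
      using r unfolding alt_set_def by blast
    have "psat C b \<psi>" if \<psi>: "\<psi> \<in> \<Delta>" for \<psi>
    proof (cases "\<psi> \<in> r")
      case True
      then show ?thesis using b(2) \<xi>(2) \<psi> by (simp add: E_def)
    next
      case False
      then have "\<psi> \<in> D ` {..<n}" using \<Delta>(2) \<psi> by blast
      then obtain k where "k < n" "\<psi> = D k" by auto
      then show ?thesis using b(3) by (simp add: psD)
    qed
    then show "\<exists>b. range b \<subseteq> univ C \<and> (\<forall>\<psi>\<in>\<Delta>. psat C b \<psi>)" using b(1) by blast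
  qed (use cj in auto)
  then obtain b where b: "range b \<subseteq> univ C" "\<forall>\<psi>\<in>r. psat C b \<psi>" "\<forall>k<n. psat C b (D k)" by auto
  have "r \<subseteq> tp L C (univ M) b" using b(2) types_pfmls[OF rt] by (auto simp: tp_def)
  then have "tp L C (univ M) b = r" using types_eqI[OF rt tp_types[OF b(1)]] by simp
  then show ?thesis using that b by (simp add: psD)
qed

text \<open>From 2 * K alternations any truth pattern of length K can be selected by an increasing
  choice of indices. Moving the selected entries to the first K by an automorphism, together with b,
  shatters the initial segment of length K.\<close>

lemma alt_set_bounded:
  fixes \<phi> :: "('f, 'r, 'j + 'i) fml"
  assumes p: "invariant_type p" and d: "morley p (univ M) d" and \<phi>: "\<phi> \<in> fmls L" and cj: "countable (UNIV :: 'j set)"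
  shows "\<exists>n. r \<notin> alt_set d \<phi> n s"
proof (rule ccontr)
  assume "\<not> ?thesis"
  then have all: "r \<in> alt_set d \<phi> n s" for n by blast
  obtain K where K: "\<not> (\<exists>a :: nat \<Rightarrow> 'i \<Rightarrow> 'c. (\<forall>k<K. range (a k) \<subseteq> univ C) \<and>
     (\<forall>S\<subseteq>{..<K}. \<exists>b. range b \<subseteq> univ C \<and> (\<forall>k<K. sat C (case_sum b (a k)) \<phi> \<longleftrightarrow> k \<in> S)))"
    using finite_vc_dim[OF \<phi> cj] by blast
  obtain b where b: "range b \<subseteq> univ C" "\<forall>j<2*K. sat C (case_sum b (d j)) \<phi> \<longleftrightarrow> even j = s"
    using alt_setD[OF all[of "2*K"] cj morley_range[OF d] \<phi>] by metis
  have "\<exists>b. range b \<subseteq> univ C \<and> (\<forall>k<K. sat C (case_sum b (d k)) \<phi> \<longleftrightarrow> k \<in> S)" for S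
  proof -
    \<comment> \<open>From each pair 2t, 2t + 1 the index is taken whose truth value is that of t
      \<in> S; the value at index j is s for even j and its negation for odd j.\<close>
    define i where "i t = (if s = (t \<in> S) then 2 * t else Suc (2 * t))" for t
    have "i t < i u" if "t < u" for t u using that by (auto simp: i_def)
    then obtain \<tau> where \<tau>: "\<tau> \<in> Aut_over L C (univ M)" "\<forall>j<K. \<tau> \<circ> d (i j) = d j"
      using morley_indiscernible[OF p d countable_i, of K i] by blast
    have "sat C (case_sum (\<tau> \<circ> b) (d k)) \<phi> \<longleftrightarrow> k \<in> S" if k: "k < K" for k
    proof -
      have "sat C (case_sum (\<tau> \<circ> b) (d k)) \<phi> = sat C (case_sum b (d (i k))) \<phi>"
        using sat_Aut_pair[OF \<tau>(1) C.struct \<phi> b(1) morley_range[OF d, of "i k"]] \<tau>(2) k by simp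
      also have "\<dots> \<longleftrightarrow> even (i k) = s" using b(2) k by (auto simp: i_def)
      also have "\<dots> \<longleftrightarrow> k \<in> S" by (auto simp: i_def)
      finally show ?thesis .
    qed
    then show ?thesis using Aut_over_range[OF \<tau>(1) b(1)] by blast
  qed
  then have "(\<forall>k<K. range (d k) \<subseteq> univ C) \<and>
     (\<forall>S\<subseteq>{..<K}. \<exists>b. range b \<subseteq> univ C \<and> (\<forall>k<K. sat C (case_sum b (d k)) \<phi> \<longleftrightarrow> k \<in> S))"
    using morley_range[OF d] by blast
  with K show False by (elim notE) (rule exI[of _ d])
qed

lemma invariant_plug:
  fixes \<phi> :: "('f, 'r, 'j + 'i) fml"
  assumes p: "invariant_type p" and \<phi>: "\<phi> \<in> fmls L" and cj: "countable (UNIV :: 'j set)"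
    and b: "range b \<subseteq> univ C" "range b' \<subseteq> univ C" "tp L C (univ M) b = tp L C (univ M) b'"
  shows "plug \<phi> b \<in> p \<longleftrightarrow> plug \<phi> b' \<in> p"
proof -
  obtain \<sigma> where \<sigma>: "\<sigma> \<in> Aut_over L C (univ M)" "\<sigma> \<circ> b = b'"
    using C.tp_eq_Aut[OF M_sub C.small_countable[OF countable_M] cj b] by blast
  then have "act \<sigma> (plug \<phi> b) = plug \<phi> b'" by (simp add: act_plug)
  moreover have "act \<sigma> (plug \<phi> b) \<in> p \<longleftrightarrow> plug \<phi> b \<in> p"
    using p \<sigma>(1) plug_pfmls[OF \<phi> b(1)] unfolding invariant_type_def by blast
  ultimately show ?thesis by simp
qed

text \<open>A maximal alternation of \<open>\<phi>(b; y)\<close> along a Morley sequence of \<open>p\<close> ends with the truth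
  value that \<open>p\<close> gives to \<open>\<phi>(b; y)\<close>: otherwise a further realization of \<open>p\<close> would prolong it.\<close>

lemma alt_set_maximal:
  fixes \<phi> :: "('f, 'r, 'j + 'i) fml"
  assumes p: "invariant_type p" and d: "morley p (univ M) d" and \<phi>: "\<phi> \<in> fmls L" and cj: "countable (UNIV :: 'j set)"
    and r: "r \<in> alt_set d \<phi> (Suc n) s" "r \<notin> alt_set d \<phi> (Suc (Suc n)) s"
    and b: "range b \<subseteq> univ C" "tp L C (univ M) b = r"
  shows "plug \<phi> b \<in> p \<longleftrightarrow> even n = s"
proof (rule ccontr)
  assume neq: "\<not> ?thesis"
  have pt: "p \<in> types L C (univ C)" using p by (simp add: invariant_type_def)
  obtain c where c: "range c \<subseteq> univ C" "tp L C (univ M) c = r" "\<forall>j<Suc n. sat C (case_sum c (d j)) \<phi> \<longleftrightarrow> even j = s"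
    using alt_setD[OF r(1) cj morley_range[OF d] \<phi>] by metis
  have pc: "plug \<phi> c \<in> p \<longleftrightarrow> \<not> (even n = s)" using neq invariant_plug[OF p \<phi> cj b(1) c(1)] b(2) c(2) by auto
  define A where "A = univ M \<union> (\<Union>j<Suc n. range (d j))"
  have AC: "A \<subseteq> univ C" using M_sub morley_range[OF d] by (auto simp: A_def)
  have cA: "countable A" unfolding A_def using countable_i countable_M by (intro countable_Un countable_UN) auto
  obtain e where e: "realizes p (A \<union> range c) e"
    using ex_realizes[OF pt _ _ countable_i, of "A \<union> range c"] AC c(1) cA cj by auto
  have eC: "range e \<subseteq> univ C" using e by (simp add: realizes_def)
  have "tp L C A e = tp L C A (d (Suc n))"
    using realizes_mono[OF e, of A] d by (intro realizes_tp[of p]) (auto simp: morley_def A_def)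
  \<comment> \<open>The tuple e realizes p also over c, so \<phi>(c; e) has the truth value
    prescribed by p. Since \<sigma> carries e to the next Morley entry and fixes the earlier ones,
    the image of c alternates once more and still has type r.\<close>
  then obtain \<sigma> where \<sigma>: "\<sigma> \<in> Aut_over L C A" "\<sigma> \<circ> e = d (Suc n)"
    using C.tp_eq_Aut[OF AC C.small_countable[OF cA] countable_i eC morley_range[OF d]] by blast
  have \<sigma>M: "\<sigma> \<in> Aut_over L C (univ M)" using \<sigma>(1) by (auto simp: Aut_over_def A_def)
  have "tp L C (univ M) (\<sigma> \<circ> c) = r" using tp_Aut_over[OF \<sigma>M C.struct M_sub c(1)] c(2) by simp
  moreover have "sat C (case_sum (\<sigma> \<circ> c) (d j)) \<phi> \<longleftrightarrow> even j = s" if j: "j < Suc (Suc n)" for j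
  proof (cases "j = Suc n")
    case True
    have "sat C (case_sum (\<sigma> \<circ> c) (d j)) \<phi> = sat C (case_sum c e) \<phi>"
      using sat_Aut_pair[OF \<sigma>(1) C.struct \<phi> c(1) eC] \<sigma>(2) True by simp
    also have "\<dots> \<longleftrightarrow> psat C e (plug \<phi> c)" by (simp add: psat_plug)
    also have "\<dots> \<longleftrightarrow> plug \<phi> c \<in> p" using e plug_pfmls[OF \<phi>, of c "A \<union> range c"] by (simp add: realizes_def)
    also have "\<dots> \<longleftrightarrow> even j = s" using pc True by auto
    finally show ?thesis .
  next
    case False
    then have "j < Suc n" using j by simp
    then have "range (d j) \<subseteq> A" unfolding A_def by blast
    then have "\<sigma> \<circ> d j = d j" using \<sigma>(1) by (auto simp: Aut_over_def fun_eq_iff image_subset_iff)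
    then have "sat C (case_sum (\<sigma> \<circ> c) (d j)) \<phi> = sat C (case_sum c (d j)) \<phi>"
      using sat_Aut_pair[OF \<sigma>(1) C.struct \<phi> c(1) morley_range[OF d, of j]] by simp
    then show ?thesis using c(3) j False by simp
  qed
  ultimately have "r \<in> alt_set d \<phi> (Suc (Suc n)) s"
    using alt_setI[of "\<sigma> \<circ> c" "Suc (Suc n)" d \<phi> s] Aut_over_range[OF \<sigma>M c(1)] by auto
  then show False using r(2) by simp
qed

abbreviation "S\<^sub>M \<equiv> borel_of (type_topology L C (univ M) :: ('f, 'r, 'j + 'c) fml set topology)"

lemma space_S_M: "space S\<^sub>M = types L C (univ M)"
  by (simp add: space_borel_of topspace_type_topology[OF ne_C])

text \<open>The complement is the union of the basic sets of those formulas that cannot be satisfied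
  together with the pattern, hence open.\<close>

lemma alt_set_measurable:
  fixes \<phi> :: "('f, 'r, 'j + 'i) fml"
  shows "alt_set d \<phi> n s \<in> sets S\<^sub>M"
proof -
  define Q where "Q \<theta> \<longleftrightarrow> (\<exists>b. range b \<subseteq> univ C \<and> psat C b \<theta> \<and>
     (\<forall>j<n. sat C (case_sum b (d j)) \<phi> \<longleftrightarrow> even j = s))" for \<theta>
  define B where "B = {\<theta> \<in> pfmls L (univ M). \<not> Q \<theta>}"
  have "alt_set d \<phi> n s = {r \<in> types L C (univ M). \<forall>\<theta>\<in>r. Q \<theta>}"
    by (simp add: alt_set_def Q_def)
  also have "\<dots> = types L C (univ M) - (\<Union>\<theta>\<in>B. basic L C (univ M) \<theta>)"
    by (auto simp: B_def basic_def dest: types_pfmls)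
  finally have "alt_set d \<phi> n s = types L C (univ M) - (\<Union>\<theta>\<in>B. basic L C (univ M) \<theta>)" .
  moreover have "openin (type_topology L C (univ M)) (\<Union>\<theta>\<in>B. basic L C (univ M) \<theta>)"
    by (intro openin_Union) (auto simp: B_def intro: openin_basic)
  then have "(\<Union>\<theta>\<in>B. basic L C (univ M) \<theta>) \<in> sets S\<^sub>M"
    unfolding sets_borel_of by (auto intro: sigma_sets.Basic)
  ultimately show ?thesis using sets.compl_sets[of _ S\<^sub>M] by (simp add: space_S_M)
qed

theorem type_borel_definable:
  fixes \<phi> :: "('f, 'r, 'j + 'i) fml"
  assumes p: "invariant_type p" and \<phi>: "\<phi> \<in> fmls L" and cj: "countable (UNIV :: 'j set)"
  shows "\<exists>B\<in>sets S\<^sub>M. \<forall>b. range b \<subseteq> univ C \<longrightarrow> (tp L C (univ M) b \<in> B \<longleftrightarrow> plug \<phi> b \<in> p)"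
proof -
  have pt: "p \<in> types L C (univ C)" using p by (simp add: invariant_type_def)
  obtain d where d: "morley p (univ M) d" using ex_morley[OF pt M_sub countable_M countable_i] by blast
  \<comment> \<open>An alternation with start value s and last index n ends with the value even n =
    s. It ends with truth exactly for s = even n, which is why the start value is tied to n
    here.\<close>
  define B where "B = (\<Union>n. alt_set d \<phi> (Suc n) (even n) - alt_set d \<phi> (Suc (Suc n)) (even n))"
  have "B \<in> sets S\<^sub>M" unfolding B_def
    by (rule sets.countable_UN) (use sets.Diff[OF alt_set_measurable alt_set_measurable] in blast)
  moreover have "tp L C (univ M) b \<in> B \<longleftrightarrow> plug \<phi> b \<in> p" if b: "range b \<subseteq> univ C" for b
  proof
    assume "tp L C (univ M) b \<in> B"
    then obtain n where "tp L C (univ M) b \<in> alt_set d \<phi> (Suc n) (even n)" "tp L C (univ M) b \<notin> alt_set d \<phi> (Suc (Suc n)) (even n)"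
      by (auto simp: B_def)
    from alt_set_maximal[OF p d \<phi> cj this b refl] show "plug \<phi> b \<in> p" by simp
  next
    assume bp: "plug \<phi> b \<in> p"
    define s where "s = sat C (case_sum b (d 0)) \<phi>"
    have 1: "tp L C (univ M) b \<in> alt_set d \<phi> (Suc 0) s" by (rule alt_setI[OF b]) (simp add: s_def)
    have "\<exists>n. tp L C (univ M) b \<in> alt_set d \<phi> (Suc n) s \<and> tp L C (univ M) b \<notin> alt_set d \<phi> (Suc (Suc n)) s"
    proof (rule ccontr)
      assume "\<not> ?thesis"
      then have step: "tp L C (univ M) b \<in> alt_set d \<phi> (Suc n) s \<Longrightarrow> tp L C (univ M) b \<in> alt_set d \<phi> (Suc (Suc n)) s" for n by blast
      have S: "tp L C (univ M) b \<in> alt_set d \<phi> (Suc n) s" for n by (induction n) (use 1 step in auto)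
      \<comment> \<open>Length 0 imposes no pattern; it only completes the claim to all n, as the
        bound on alternations requires.\<close>
      have "tp L C (univ M) b \<in> alt_set d \<phi> 0 s" by (rule alt_setI[OF b]) simp
      with S have "tp L C (univ M) b \<in> alt_set d \<phi> n s" for n by (cases n) auto
      then show False using alt_set_bounded[OF p d \<phi> cj] by blast
    qed
    then obtain n where n: "tp L C (univ M) b \<in> alt_set d \<phi> (Suc n) s" "tp L C (univ M) b \<notin> alt_set d \<phi> (Suc (Suc n)) s" by blast
    have "even n = s" using alt_set_maximal[OF p d \<phi> cj n b refl] bp by simp
    then show "tp L C (univ M) b \<in> B" using n by (auto simp: B_def)
  qed
  ultimately show ?thesis by blast
qed

end

section \<open>Invariant measures: null differences and Borel definability\<close>

locale nip_invariant_measure = nip_measure L T \<kappa> \<kappa>' C C' M m \<mu>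
  for L :: "('f, 'r) lang"
    and T :: "('f, 'r, nat) fml set"
    and \<kappa> :: "'k rel" and \<kappa>' :: "'l rel"
    and C C' M :: "('f, 'r, 'c) struct"
    and m :: "'i \<Rightarrow> 'c" and \<mu> :: "('f, 'r, 'i + 'c) fml \<Rightarrow> real" +
  assumes inv: "\<sigma> \<in> Aut_over L C (univ M) \<Longrightarrow> \<phi> \<in> pfmls L (univ C) \<Longrightarrow> \<mu> (act \<sigma> \<phi>) = \<mu> \<phi>"
begin

lemma act_Xor: "act \<sigma> (Xor \<phi> \<psi>) = Xor (act \<sigma> \<phi>) (act \<sigma> \<psi>)"
  by (simp add: act_def)

lemma measure_plug:
  fixes \<phi> :: "('f, 'r, 'j + 'i) fml"
  assumes \<phi>: "\<phi> \<in> fmls L" and cj: "countable (UNIV :: 'j set)"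
    and b: "range b \<subseteq> univ C" "range b' \<subseteq> univ C" "tp L C (univ M) b = tp L C (univ M) b'"
  shows "\<mu> (plug \<phi> b) = \<mu> (plug \<phi> b')"
proof -
  obtain \<sigma> where \<sigma>: "\<sigma> \<in> Aut_over L C (univ M)" "\<sigma> \<circ> b = b'"
    using C.tp_eq_Aut[OF M_sub C.small_countable[OF countable_M] cj b] by blast
  then have "act \<sigma> (plug \<phi> b) = plug \<phi> b'" by (simp add: act_plug)
  then show ?thesis using inv[OF \<sigma>(1) plug_pfmls[OF \<phi> b(1)]] by simp
qed

lemma subadditive:
  assumes "\<alpha> \<in> P" "\<beta> \<in> P" "\<gamma> \<in> P" "\<And>a. range a \<subseteq> univ C \<Longrightarrow> psat C a \<alpha> \<Longrightarrow> psat C a \<beta> \<or> psat C a \<gamma>"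
  shows "\<mu> \<alpha> \<le> \<mu> \<beta> + \<mu> \<gamma>"
proof -
  have "\<mu> (And \<alpha> \<beta>) \<le> \<mu> \<beta>" using assms by (intro mono) auto
  moreover have "\<mu> (And \<alpha> (Neg \<beta>)) \<le> \<mu> \<gamma>" using assms by (intro mono) auto
  ultimately show ?thesis using split[OF assms(1,2)] by simp
qed

text \<open>All differences of \<open>\<phi>(d\<^sub>i; y)\<close> and \<open>\<phi>(d\<^sub>j; y)\<close> have the same measure; were it positive,
  then finitely many types approximating \<open>\<mu>\<close> would separate infinitely many \<open>\<phi>(d\<^sub>i; y)\<close>.\<close>

lemma morley_null:
  fixes \<phi> :: "('f, 'r, 'j + 'i) fml"
  assumes q: "invariant_type q" and d: "morley q (univ M) d" and \<phi>: "\<phi> \<in> fmls L" and cj: "countable (UNIV :: 'j set)"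
  shows "\<mu> (Xor (plug \<phi> (d 0)) (plug \<phi> (d 1))) = 0"
proof (rule ccontr)
  define \<delta> where "\<delta> = \<mu> (Xor (plug \<phi> (d 0)) (plug \<phi> (d 1)))"
  assume "\<mu> (Xor (plug \<phi> (d 0)) (plug \<phi> (d 1))) \<noteq> 0"
  have pP: "plug \<phi> (d k) \<in> P" for k by (rule plug_pfmls[OF \<phi> morley_range[OF d]])
  then have "\<delta> > 0" using \<open>_ \<noteq> 0\<close> nonneg[of "Xor (plug \<phi> (d 0)) (plug \<phi> (d 1))"] by (simp add: \<delta>_def)
  have \<delta>: "\<mu> (Xor (plug \<phi> (d k)) (plug \<phi> (d l))) = \<delta>" if kl: "k < l" for k l
  proof -
    define i where "i = (\<lambda>t::nat. if t = 0 then k else l)"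
    have "\<exists>\<tau>\<in>Aut_over L C (univ M). \<forall>j<2. \<tau> \<circ> d (i j) = d j"
      by (rule morley_indiscernible[OF q d cj]) (use kl in \<open>auto simp: i_def\<close>)
    then obtain \<tau> where \<tau>: "\<tau> \<in> Aut_over L C (univ M)" "\<forall>j<2. \<tau> \<circ> d (i j) = d j" by blast
    have "\<tau> \<circ> d k = d 0" "\<tau> \<circ> d l = d 1" using \<tau>(2)[rule_format, of 0] \<tau>(2)[rule_format, of 1] by (auto simp: i_def)
    then have "act \<tau> (Xor (plug \<phi> (d k)) (plug \<phi> (d l))) = Xor (plug \<phi> (d 0)) (plug \<phi> (d 1))"
      by (simp add: act_Xor act_plug)
    then show ?thesis using inv[OF \<tau>(1), of "Xor (plug \<phi> (d k)) (plug \<phi> (d l))"] pP by (simp add: \<delta>_def)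
  qed
  define \<psi> :: "('f, 'r, ('j + 'j) + 'i) fml" where "\<psi> = Xor (ren (map_sum Inl id) \<phi>) (ren (map_sum Inr id) \<phi>)"
  have \<psi>: "\<psi> \<in> fmls L" using \<phi> by (simp add: \<psi>_def)
  have cjj: "countable (UNIV :: ('j + 'j) set)" unfolding UNIV_Plus_UNIV[symmetric] using cj by (intro countable_Plus) auto
  obtain n :: nat and r where nr: "n > 0" "\<And>i. i < n \<Longrightarrow> r i \<in> Sm L C m"
     "\<And>b. range b \<subseteq> univ C \<Longrightarrow> \<bar>(\<Sum>i<n. of_bool (plug \<psi> b \<in> r i)) / real n - \<mu> (plug \<psi> b)\<bar> \<le> \<delta> / 2"
    using approximation[OF \<psi> cjj, of "\<delta> / 2"] \<open>\<delta> > 0\<close> by (metis half_gt_zero)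
  \<comment> \<open>Each k is assigned the set of approximating types that contain \<phi>(d k; y).
    There are finitely many such sets, so two indices share one; their symmetric difference is then
    in none of the types, and its measure \<delta> would be at most \<delta> / 2.\<close>
  define f where "f k = {i. i < n \<and> plug \<phi> (d k) \<in> r i}" for k
  have "finite (range f)" by (rule finite_subset[of _ "Pow {..<n}"]) (auto simp: f_def)
  then have "\<not> inj f" using range_inj_infinite by blast
  then obtain k l where kl: "k < l" "f k = f l" by (metis injI linorder_neqE_nat)
  define b where "b = case_sum (d k) (d l)"
  have bC: "range b \<subseteq> univ C" using morley_range[OF d, of k] morley_range[OF d, of l] by (auto simp: b_def image_subset_iff split: sum.splits)
  have X: "plug \<psi> b = Xor (plug \<phi> (d k)) (plug \<phi> (d l))" unfolding b_def \<psi>_def by (rule plug_Xor[symmetric])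
  have "plug \<psi> b \<notin> r i" if "i < n" for i
  proof -
    have "(plug \<phi> (d k) \<in> r i) = (plug \<phi> (d l) \<in> r i)" using kl(2) that by (auto simp: f_def)
    then show ?thesis unfolding X using types_Xor[OF Sm_types[OF nr(2)[OF that]] pP pP] by simp
  qed
  then have "(\<Sum>i<n. of_bool (plug \<psi> b \<in> r i)) = (0::real)" by simp
  then show False using nr(3)[OF bC] \<delta>[OF kl(1)] \<open>\<delta> > 0\<close> by (simp add: X)
qed

text \<open>Both b and b' realize the same coheir over M. A Morley sequence taken over M, b and b'
  together stays a Morley sequence over M when either tuple is put in front, so both instances
  differ from that of its first entry by a null formula.\<close>

lemma Xor_null:
  fixes \<phi> :: "('f, 'r, 'j + 'i) fml"
  assumes \<phi>: "\<phi> \<in> fmls L" and cj: "countable (UNIV :: 'j set)"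
    and b: "range b \<subseteq> univ C" "range b' \<subseteq> univ C" "tp L C (univ M) b = tp L C (univ M) b'"
  shows "\<mu> (Xor (plug \<phi> b) (plug \<phi> b')) = 0"
proof -
  obtain q where q: "invariant_type q" "tp L C (univ M) b \<subseteq> q" using ex_invariant_extension[OF b(1)] by blast
  have qt: "q \<in> types L C (univ C)" using q(1) by (simp add: invariant_type_def)
  have real: "realizes q (univ M) x" if "range x \<subseteq> univ C" "tp L C (univ M) x = tp L C (univ M) b" for x
    unfolding realizes_def
  proof (intro conjI ballI that(1))
    fix \<theta> :: "('f, 'r, 'j + 'c) fml" assume \<theta>: "\<theta> \<in> pfmls L (univ M)"
    have \<theta>C: "\<theta> \<in> pfmls L (univ C)" using \<theta> pfmls_mono[OF M_sub, of L] by blast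
    have "psat C x \<theta> \<longleftrightarrow> \<theta> \<in> tp L C (univ M) b" unfolding that(2)[symmetric] using \<theta> by (simp add: tp_def)
    also have "\<dots> \<longleftrightarrow> \<theta> \<in> q"
    proof
      assume "\<theta> \<in> q"
      then have "Neg \<theta> \<notin> tp L C (univ M) b" using types_Neg[OF qt \<theta>C] q(2) by blast
      then show "\<theta> \<in> tp L C (univ M) b" using \<theta> by (simp add: tp_def)
    qed (use q(2) in blast)
    finally show "psat C x \<theta> \<longleftrightarrow> \<theta> \<in> q" .
  qed
  define A where "A = univ M \<union> (range b \<union> range b')"
  have "A \<subseteq> univ C" "countable A" using M_sub b countable_M cj by (auto simp: A_def)
  then obtain c where c: "morley q A c" using ex_morley[OF qt _ _ cj] by blast
  have null: "\<mu> (Xor (plug \<phi> x) (plug \<phi> (c 0))) = 0"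
    if x: "range x \<subseteq> univ C" "tp L C (univ M) x = tp L C (univ M) b" "range x \<subseteq> A" for x
  proof -
    \<comment> \<open>The tuple x is put at index 0, so the entries 0 and 1 that
      \<open>morley_null\<close> compares are x and c 0.\<close>
    define d where "d k = (case k of 0 \<Rightarrow> x | Suc k \<Rightarrow> c k)" for k
    have "morley q (univ M) d" unfolding morley_def
    proof
      fix k show "realizes q (univ M \<union> (\<Union>j<k. range (d j))) (d k)"
      proof (cases k)
        case 0
        then show ?thesis using real[OF x(1,2)] by (simp add: d_def)
      next
        case (Suc l)
        have sub: "univ M \<union> (\<Union>j<k. range (d j)) \<subseteq> A \<union> (\<Union>j<l. range (c j))"
        proof -
          have "range (d j) \<subseteq> A \<union> (\<Union>j<l. range (c j))" if "j < k" for j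
          proof (cases j)
            case 0
            then show ?thesis using x(3) by (auto simp: d_def)
          next
            case (Suc i)
            then have "range (d j) = range (c i)" "i < l" using that \<open>k = Suc l\<close> by (auto simp: d_def)
            then show ?thesis by blast
          qed
          then show ?thesis by (auto simp: A_def)
        qed
        have "d k = c l" using Suc by (simp add: d_def)
        moreover have "realizes q (A \<union> (\<Union>j<l. range (c j))) (c l)" using c by (simp add: morley_def)
        ultimately show ?thesis using realizes_mono[OF _ sub] by simp
      qed
    qed
    from morley_null[OF q(1) this \<phi> cj] show ?thesis by (simp add: d_def)
  qed
  have c0: "plug \<phi> (c 0) \<in> P" by (rule plug_pfmls[OF \<phi> morley_range[OF c]])
  have bP: "plug \<phi> b \<in> P" "plug \<phi> b' \<in> P" using plug_pfmls[OF \<phi>] b by auto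
  have "\<mu> (Xor (plug \<phi> b) (plug \<phi> b')) \<le> \<mu> (Xor (plug \<phi> b) (plug \<phi> (c 0))) + \<mu> (Xor (plug \<phi> b') (plug \<phi> (c 0)))"
    using bP c0 by (intro subadditive) auto
  also have "\<dots> = 0"
  proof -
    have "range b \<subseteq> A" "range b' \<subseteq> A" by (auto simp: A_def)
    then show ?thesis using null[OF b(1) refl] null[OF b(2) b(3)[symmetric]] by simp
  qed
  finally show ?thesis using nonneg[of "Xor (plug \<phi> b) (plug \<phi> b')"] bP by simp
qed

text \<open>A formula and its image under \<sigma> are instances of one \<phi> at tuples with the
  same type over M. Their difference is null and so lies outside q, which forces q to decide them
  alike.\<close>

lemma support_invariant:
  assumes q: "q \<in> Sm L C m" and pos: "\<And>\<theta>. \<theta> \<in> q \<Longrightarrow> 0 < \<mu> \<theta>"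
  shows "invariant_type q"
  unfolding invariant_type_def
proof (intro conjI ballI Sm_types[OF q])
  fix \<sigma> and \<theta> :: "('f, 'r, 'i + 'c) fml"
  assume \<sigma>: "\<sigma> \<in> Aut_over L C (univ M)" and \<theta>: "\<theta> \<in> pfmls L (univ C)"
  obtain \<phi> :: "('f, 'r, 'i + 'i) fml" and b :: "'i \<Rightarrow> 'c" where \<phi>: "\<phi> \<in> fmls L" "range b \<subseteq> univ C" "\<theta> = plug \<phi> b"
    using plug_surj[OF \<theta> ne_C infinite_i] by metis
  have \<sigma>b: "range (\<sigma> \<circ> b) \<subseteq> univ C" by (rule Aut_over_range[OF \<sigma> \<phi>(2)])
  have "\<mu> (Xor (plug \<phi> b) (plug \<phi> (\<sigma> \<circ> b))) = 0"
    by (rule Xor_null[OF \<phi>(1) countable_i \<phi>(2) \<sigma>b]) (rule tp_Aut_over[OF \<sigma> C.struct M_sub \<phi>(2), symmetric])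
  then have "Xor (plug \<phi> b) (plug \<phi> (\<sigma> \<circ> b)) \<notin> q" using pos by force
  then show "act \<sigma> \<theta> \<in> q \<longleftrightarrow> \<theta> \<in> q"
    using types_Xor[OF Sm_types[OF q] plug_pfmls[OF \<phi>(1,2)] plug_pfmls[OF \<phi>(1) \<sigma>b]] \<phi>(3) by (simp add: act_plug)
qed

text \<open>On types over M, averages of finitely many indicators of Borel sets approximate G
  uniformly, since every such type is realized in C and the approximation holds for all b at once. A
  limit of Borel functions is Borel.\<close>

lemma measure_Borel:
  fixes \<phi> :: "('f, 'r, 'j + 'i) fml"
  assumes \<phi>: "\<phi> \<in> fmls L" and cj: "countable (UNIV :: 'j set)"
    and G: "\<And>b. range b \<subseteq> univ C \<Longrightarrow> G (tp L C (univ M) b) = \<mu> (plug \<phi> b)"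
  shows "G \<in> borel_measurable S\<^sub>M"
proof -
  have "\<exists>g. g \<in> borel_measurable S\<^sub>M \<and> (\<forall>r\<in>types L C (univ M). \<bar>g r - G r\<bar> \<le> \<epsilon>)" if \<epsilon>: "0 < \<epsilon>" for \<epsilon>
  proof (rule approximation[OF \<phi> cj \<epsilon>])
    fix n :: nat and q
    assume n: "n > 0" and q: "\<And>i. i < n \<Longrightarrow> q i \<in> Sm L C m" "\<And>i \<theta>. i < n \<Longrightarrow> \<theta> \<in> q i \<Longrightarrow> 0 < \<mu> \<theta>"
     "\<And>b. range b \<subseteq> univ C \<Longrightarrow> \<bar>(\<Sum>i<n. of_bool (plug \<phi> b \<in> q i)) / real n - \<mu> (plug \<phi> b)\<bar> \<le> \<epsilon>"
    have "\<exists>B\<in>sets S\<^sub>M. \<forall>b. range b \<subseteq> univ C \<longrightarrow> (tp L C (univ M) b \<in> B \<longleftrightarrow> plug \<phi> b \<in> q i)" if i: "i < n" for i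
      by (rule type_borel_definable[OF support_invariant[OF q(1)[OF i] q(2)[OF i]] \<phi> cj])
    then have "\<forall>i\<in>{..<n}. \<exists>B. B \<in> sets S\<^sub>M \<and> (\<forall>b. range b \<subseteq> univ C \<longrightarrow> (tp L C (univ M) b \<in> B \<longleftrightarrow> plug \<phi> b \<in> q i))" by blast
    from bchoice[OF this] obtain B where B: "\<And>i. i < n \<Longrightarrow> B i \<in> sets S\<^sub>M"
      "\<And>i b. i < n \<Longrightarrow> range b \<subseteq> univ C \<Longrightarrow> tp L C (univ M) b \<in> B i \<longleftrightarrow> plug \<phi> b \<in> q i" by auto
    define g where "g r = (\<Sum>i<n. indicator (B i) r) / real n" for r
    have "g \<in> borel_measurable S\<^sub>M" unfolding g_def using B(1) by (intro borel_measurable_divide borel_measurable_sum borel_measurable_indicator) auto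
    moreover have "\<bar>g r - G r\<bar> \<le> \<epsilon>" if r: "r \<in> types L C (univ M)" for r
    proof -
      obtain b where b: "range b \<subseteq> univ C" "tp L C (univ M) b = r"
        using C.realize_type[OF M_sub C.small_countable[OF countable_M] r cj] by blast
      have "g r = (\<Sum>i<n. of_bool (plug \<phi> b \<in> q i)) / real n"
        unfolding g_def b(2)[symmetric] using B(2)[OF _ b(1)]
        by (intro arg_cong2[where f = "(/)"] sum.cong refl) (auto simp: indicator_def)
      then show ?thesis using q(3)[OF b(1)] G[OF b(1)] b(2) by simp
    qed
    ultimately show ?thesis by blast
  qed
  then have "\<exists>g. g \<in> borel_measurable S\<^sub>M \<and> (\<forall>r\<in>types L C (univ M). \<bar>g r - G r\<bar> \<le> inverse (real (Suc k)))" for k by simp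
  then obtain g where g: "\<And>k. g k \<in> borel_measurable S\<^sub>M"
    "\<And>k r. r \<in> types L C (univ M) \<Longrightarrow> \<bar>g k r - G r\<bar> \<le> inverse (real (Suc k))" by metis
  show ?thesis
  proof (rule borel_measurable_LIMSEQ_real[OF _ g(1)])
    fix r :: "('f, 'r, 'j + 'c) fml set" assume "r \<in> space S\<^sub>M"
    then have r: "r \<in> types L C (univ M)" by (simp add: space_S_M)
    have "(\<lambda>k. g k r - G r) \<longlonglongrightarrow> 0"
      by (rule Lim_null_comparison[OF _ LIMSEQ_inverse_real_of_nat]) (use g(2)[OF r] in auto)
    then show "(\<lambda>k. g k r) \<longlonglongrightarrow> G r" by (simp add: LIM_zero_iff)
  qed
qed

end

section \<open>Convolution\<close>

text \<open>The bounds 0 and 1 reduce the integral against a mixture to the case of nonnegative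
  integrands, with values in the extended reals, and make every integral finite on the way
  back.\<close>

lemma integral_bind_bounded:
  assumes M: "M \<in> space (prob_algebra B)" and K: "K \<in> measurable B (prob_algebra B)"
    and f: "f \<in> borel_measurable B" "\<And>x. x \<in> space B \<Longrightarrow> 0 \<le> f x" "\<And>x. x \<in> space B \<Longrightarrow> f x \<le> (1::real)"
  shows "(\<integral>x. f x \<partial>(M \<bind> K)) = (\<integral>x. \<integral>y. f y \<partial>K x \<partial>M)"
proof -
  have M': "sets M = sets B" "prob_space M" using M by (auto simp: space_prob_algebra)
  have spM: "space M = space B" using sets_eq_imp_space_eq[OF M'(1)] .
  have Ks: "K \<in> measurable M (subprob_algebra B)" using measurable_prob_algebraD[OF K] M'(1) by (simp cong: measurable_cong_sets)
  have Kx: "sets (K x) = sets B" "prob_space (K x)" "space (K x) = space B" if "x \<in> space B" for x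
    using measurable_space[OF K that] by (auto simp: space_prob_algebra dest: sets_eq_imp_space_eq)
  have "sets (M \<bind> K) = sets B" by (rule sets_bind'[OF M K])
  then have fb: "f \<in> borel_measurable (M \<bind> K)" "space (M \<bind> K) = space B"
    using f(1) by (auto cong: measurable_cong_sets dest: sets_eq_imp_space_eq)
  have inner: "(\<integral>\<^sup>+y. ennreal (f y) \<partial>K x) = ennreal (\<integral>y. f y \<partial>K x)" if x: "x \<in> space B" for x
  proof (rule nn_integral_eq_integral)
    interpret Kx: prob_space "K x" by (rule Kx(2)[OF x])
    show "integrable (K x) f"
      using f Kx[OF x] by (intro Kx.integrable_const_bound[where B = 1]) (auto intro!: AE_I2 cong: measurable_cong_sets)
    show "AE y in K x. 0 \<le> f y" using f Kx[OF x] by (auto intro!: AE_I2)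
  qed
  have "(\<integral>x. f x \<partial>(M \<bind> K)) = enn2real (\<integral>\<^sup>+x. ennreal (f x) \<partial>(M \<bind> K))"
    using fb f(2) by (intro integral_eq_nn_integral) (auto intro!: AE_I2)
  also have "(\<integral>\<^sup>+x. ennreal (f x) \<partial>(M \<bind> K)) = (\<integral>\<^sup>+x. \<integral>\<^sup>+y. ennreal (f y) \<partial>K x \<partial>M)"
    using f(1) by (intro nn_integral_bind[OF _ Ks]) simp
  also have "\<dots> = (\<integral>\<^sup>+x. ennreal (\<integral>y. f y \<partial>K x) \<partial>M)"
    using inner spM by (intro nn_integral_cong) simp
  also have "enn2real \<dots> = (\<integral>x. \<integral>y. f y \<partial>K x \<partial>M)"
  proof (rule integral_eq_nn_integral[symmetric])
    show "(\<lambda>x. \<integral>y. f y \<partial>K x) \<in> borel_measurable M"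
      by (rule measurable_compose[OF Ks integral_measurable_subprob_algebra[OF f(1)]])
    show "AE x in M. 0 \<le> (\<integral>y. f y \<partial>K x)"
      using f(2) Kx spM by (intro AE_I2 Bochner_Integration.integral_nonneg) auto
  qed
  finally show ?thesis .
qed

section \<open>The map h through automorphisms of the bigger monster\<close>

context nip_setting
begin

abbreviation "types\<^sub>M \<equiv> (types L C (univ M) :: ('f, 'r, 'i + 'c) fml set set)"

text \<open>Reads an L(M)-formula in x as \<theta>(x; m): each parameter is replaced by the
  y-variable that enumerates it. Substituting b for x then gives \<theta>(b; y).\<close>

definition split_params :: "('f, 'r, 'i + 'c) fml \<Rightarrow> ('f, 'r, 'i + 'i) fml" where
  "split_params \<theta> = ren (case_sum Inl (\<lambda>c. Inr (inv m c))) \<theta>"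

lemma split_params_fmls: "\<theta> \<in> pfmls L A \<Longrightarrow> split_params \<theta> \<in> fmls L"
  by (simp add: split_params_def pfmls_def)

lemma m_inv: "c \<in> univ M \<Longrightarrow> m (inv m c) = c"
  using range_m by (simp add: f_inv_into_f)

lemma tp_C_C': "range a \<subseteq> univ C \<Longrightarrow> A \<subseteq> univ C \<Longrightarrow> tp L C A a = tp L C' A a"
  unfolding tp_def psat_def
  by (rule Collect_cong, rule conj_cong, rule refl, rule elem_sub_sat[OF elem_C'])
    (auto simp: pfmls_def intro: pfmls_fv[where A = A and L = L])

text \<open>The universe of C is small for \<open>C'\<close>, so q is realized there, and the
  realization has the type of m over the empty set; homogeneity carries m to it. Hence
  \<open>h\<close> is defined on all of \<open>Sm\<close>.\<close>

lemma ex_automorphism: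
  assumes q: "q \<in> Sm L C m"
  shows "\<exists>\<sigma>\<in>Aut L C'. tp L C' (univ C) (\<sigma> \<circ> m) = q"
proof -
  have qt: "q \<in> types L C (univ C)" and qm: "tp L C {} m \<subseteq> q" using q by (auto simp: Sm_def)
  have "q \<in> types L C' (univ C)"
    unfolding types_def
  proof (intro CollectI conjI allI impI ballI)
    fix \<Gamma> assume \<Gamma>: "finite \<Gamma>" "\<Gamma> \<subseteq> q"
    obtain a where a: "range a \<subseteq> univ C" "\<And>\<phi>. \<phi> \<in> \<Gamma> \<Longrightarrow> psat C a \<phi>" using types_finsat[OF qt \<Gamma>] by metis
    have "\<phi> \<in> tp L C' (univ C) a" if "\<phi> \<in> \<Gamma>" for \<phi>
      using tp_C_C'[OF a(1) order_refl] a(2)[OF that] types_pfmls[OF qt, of \<phi>] that \<Gamma>(2) by (auto simp: tp_def)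
    then show "\<exists>a. range a \<subseteq> univ C' \<and> (\<forall>\<phi>\<in>\<Gamma>. psat C' a \<phi>)" using a(1) C_sub by (auto simp: tp_def)
  qed (use qt in \<open>auto simp: types_def\<close>)
  then obtain a where a: "range a \<subseteq> univ C'" "tp L C' (univ C) a = q"
    using C'.realize_type[OF C_sub _ _ countable_i] small_C unfolding small_def by metis
  have mC': "range m \<subseteq> univ C'" using m_C C_sub by blast
  have "tp L C' {} m \<subseteq> tp L C' {} a"
    using tp_C_C'[OF m_C, of "{}"] qm unfolding a(2)[symmetric] by (auto simp: tp_def)
  then have "tp L C' {} m = tp L C' {} a" using types_eqI[OF tp_types[OF mC'] tp_types[OF a(1)]] by simp
  then obtain \<sigma> where "\<sigma> \<in> Aut_over L C' {}" "\<sigma> \<circ> m = a"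
    using C'.tp_eq_Aut[OF _ C'.small_countable countable_i mC' a(1)] by blast
  then show ?thesis using a(2) by (auto simp: Aut_over_def)
qed

lemma inv_Aut:
  assumes "\<sigma> \<in> Aut L C'" "range b \<subseteq> univ C"
  shows "range (inv_into (univ C') \<sigma> \<circ> b) \<subseteq> univ C'" "\<sigma> \<circ> (inv_into (univ C') \<sigma> \<circ> b) = b"
proof -
  have \<sigma>: "\<sigma> ` univ C' = univ C'" using AutD(1)[OF assms(1)] by (simp add: bij_betw_def)
  have b: "b x \<in> \<sigma> ` univ C'" for x using assms(2) C_sub \<sigma> by auto
  show "range (inv_into (univ C') \<sigma> \<circ> b) \<subseteq> univ C'" using inv_into_into[OF b] by auto
  show "\<sigma> \<circ> (inv_into (univ C') \<sigma> \<circ> b) = b" using f_inv_into_f[OF b] by (simp add: fun_eq_iff)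
qed

text \<open>Applying \<sigma> to \<theta>, evaluated at the preimage of b and at m, gives \<theta>
  at b and the image of m, which asks whether \<theta>(b; y) is in q. The right side does not
  mention \<sigma>, so \<open>h\<close> is well defined.\<close>

lemma h_unfold:
  assumes \<sigma>: "\<sigma> \<in> Aut L C'" "tp L C' (univ C) (\<sigma> \<circ> m) = q" and b: "range b \<subseteq> univ C"
  shows "tp L C' (univ M) (inv_into (univ C') \<sigma> \<circ> b) = {\<theta> \<in> pfmls L (univ M). plug (split_params \<theta>) b \<in> q}"
proof -
  define b0 where "b0 = inv_into (univ C') \<sigma> \<circ> b"
  have b0: "range b0 \<subseteq> univ C'" "\<sigma> \<circ> b0 = b" using inv_Aut[OF \<sigma>(1) b] by (auto simp: b0_def)
  have MC': "univ M \<subseteq> univ C'" using M_sub C_sub by blast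
  have "psat C' b0 \<theta> \<longleftrightarrow> plug (split_params \<theta>) b \<in> q" if \<theta>: "\<theta> \<in> pfmls L (univ M)" for \<theta>
  proof -
    have "\<theta> \<in> fmls L" using \<theta> by (simp add: pfmls_def)
    then have "psat C' b0 \<theta> = sat C' (\<sigma> \<circ> case_sum b0 id) \<theta>"
      unfolding psat_def using b0(1) by (intro sat_Aut[OF \<sigma>(1) C'.struct, symmetric]) (auto intro: pfmls_fv[OF \<theta> MC'])
    also have "\<dots> = sat C' (case_sum b (\<sigma> \<circ> m) \<circ> case_sum Inl (\<lambda>c. Inr (inv m c))) \<theta>"
    proof (rule sat_cong)
      fix v assume v: "v \<in> fv \<theta>"
      show "(\<sigma> \<circ> case_sum b0 id) v = (case_sum b (\<sigma> \<circ> m) \<circ> case_sum Inl (\<lambda>c. Inr (inv m c))) v"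
      proof (cases v)
        case (Inl i)
        then show ?thesis using b0(2) by (simp add: fun_eq_iff)
      next
        case (Inr c)
        then have "c \<in> univ M" using v \<theta> by (simp add: pfmls_def)
        then show ?thesis using Inr m_inv by simp
      qed
    qed
    also have "\<dots> = psat C' (\<sigma> \<circ> m) (plug (split_params \<theta>) b)"
      by (simp add: psat_plug split_params_def sat_ren)
    also have "\<dots> \<longleftrightarrow> plug (split_params \<theta>) b \<in> q"
      unfolding \<sigma>(2)[symmetric] using plug_pfmls[OF split_params_fmls[OF \<theta>] b] by (simp add: tp_def)
    finally show ?thesis .
  qed
  then show ?thesis unfolding b0_def[symmetric] by (auto simp: tp_def)
qed

lemma h_eq:
  assumes q: "q \<in> Sm L C m" and b: "range b \<subseteq> univ C"
  shows "h L C C' M m b q = {\<theta> \<in> pfmls L (univ M). plug (split_params \<theta>) b \<in> q}"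
  unfolding h_def
proof (rule the_equality)
  obtain \<sigma> where "\<sigma> \<in> Aut L C'" "tp L C' (univ C) (\<sigma> \<circ> m) = q" using ex_automorphism[OF q] by blast
  with h_unfold[OF this b] show "\<exists>\<sigma>\<in>Aut L C'. tp L C' (univ C) (\<sigma> \<circ> m) = q \<and>
     {\<theta> \<in> pfmls L (univ M). plug (split_params \<theta>) b \<in> q} = tp L C' (univ M) (inv_into (univ C') \<sigma> \<circ> b)" by blast
qed (use h_unfold[OF _ _ b] in blast)

text \<open>The automorphism of \<open>C\<close> is found by realizing in \<open>C\<close> the type over \<open>M\<close> of the preimage of \<open>B\<close>.\<close>

lemma h_transfer:
  fixes B :: "'j \<Rightarrow> 'c"
  assumes q: "q \<in> Sm L C m" and B: "range B \<subseteq> univ C" and cj: "countable (UNIV :: 'j set)"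
  shows "\<exists>\<tau>\<in>Aut L C. \<forall>u. h L C C' M m (B \<circ> u) q = tp L C (univ M) (\<tau> \<circ> (B \<circ> u))"
proof -
  obtain \<sigma> where \<sigma>: "\<sigma> \<in> Aut L C'" "tp L C' (univ C) (\<sigma> \<circ> m) = q" using ex_automorphism[OF q] by blast
  define B0 where "B0 = inv_into (univ C') \<sigma> \<circ> B"
  have B0: "range B0 \<subseteq> univ C'" "\<sigma> \<circ> B0 = B" using inv_Aut[OF \<sigma>(1) B] by (auto simp: B0_def)
  have MC': "univ M \<subseteq> univ C'" using M_sub C_sub by blast
  \<comment> \<open>By elementarity a type over M realized in \<open>C'\<close> is finitely
    satisfiable in C, so saturation realizes it in C.\<close>
  have "tp L C' (univ M) B0 \<in> types L C (univ M)"
    unfolding types_def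
  proof (intro CollectI conjI allI impI ballI)
    fix \<Gamma> assume \<Gamma>: "finite \<Gamma>" "\<Gamma> \<subseteq> tp L C' (univ M) B0"
    then have "\<Gamma> \<subseteq> pfmls L (univ M)" by (auto simp: tp_def)
    from C'.ex_conj[OF \<Gamma>(1) this] obtain \<xi> where \<xi>: "\<xi> \<in> pfmls L (univ M)" "\<And>e. psat C' e \<xi> \<longleftrightarrow> (\<forall>\<psi>\<in>\<Gamma>. psat C' e \<psi>)" by blast
    have "psat C' B0 \<xi>" using \<xi>(2) \<Gamma>(2) by (auto simp: tp_def)
    moreover have "\<xi> \<in> pfmls L (univ C)" using \<xi>(1) pfmls_mono[OF M_sub, of L] by blast
    ultimately obtain a where a: "range a \<subseteq> univ C" "psat C' a \<xi>"
      using elem_sub_witness[OF elem_C' _ B0(1)] by blast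
    have "psat C a \<psi>" if "\<psi> \<in> \<Gamma>" for \<psi>
    proof -
      have "\<psi> \<in> tp L C' (univ M) a" using a(2) \<xi>(2) \<open>\<Gamma> \<subseteq> pfmls L (univ M)\<close> that by (auto simp: tp_def)
      then show ?thesis unfolding tp_C_C'[OF a(1) M_sub, symmetric] by (simp add: tp_def)
    qed
    then show "\<exists>a. range a \<subseteq> univ C \<and> (\<forall>\<phi>\<in>\<Gamma>. psat C a \<phi>)" using a(1) by blast
  qed (auto simp: tp_def)
  then obtain e where e: "range e \<subseteq> univ C" "tp L C (univ M) e = tp L C' (univ M) B0"
    using C.realize_type[OF M_sub C.small_countable[OF countable_M] _ cj] by blast
  have empty: "tp L N {} a = tp L N (univ M) a \<inter> pfmls L {}" for N :: "('f, 'r, 'c) struct" and a :: "'j \<Rightarrow> 'c"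
    using pfmls_mono[of "{}" "univ M" L] by (auto simp: tp_def)
  \<comment> \<open>Since \<sigma> may move M, only the type over the empty set survives the passage
    from the preimage to B. Hence \<tau> is an automorphism of C that need not fix M.\<close>
  have "tp L C {} e = tp L C' {} B0" using e(2) by (simp add: empty)
  also have "\<dots> = tp L C' {} B"
    using tp_Aut_over[of \<sigma> L C' "{}" B0] \<sigma>(1) C'.struct B0 by (simp add: Aut_over_def)
  also have "\<dots> = tp L C {} B" using tp_C_C'[OF B, of "{}"] by simp
  finally obtain \<tau> where \<tau>: "\<tau> \<in> Aut_over L C {}" "\<tau> \<circ> B = e"
    using C.tp_eq_Aut[OF _ C.small_countable cj B e(1), of "{}"] by auto
  have "h L C C' M m (B \<circ> u) q = tp L C (univ M) (\<tau> \<circ> (B \<circ> u))" for u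
  proof -
    have Bu: "range (B \<circ> u) \<subseteq> univ C" using B by auto
    have sub: "tp L N (univ M) (a \<circ> u) = {\<theta> \<in> pfmls L (univ M). ren (map_sum u id) \<theta> \<in> tp L N (univ M) a}"
      for N :: "('f, 'r, 'c) struct" and a :: "'j \<Rightarrow> 'c"
    proof -
      have "case_sum a id \<circ> map_sum u id = case_sum (a \<circ> u) id" by (auto simp: fun_eq_iff split: sum.splits)
      then have "psat N a (ren (map_sum u id) \<theta>) = psat N (a \<circ> u) \<theta>" for \<theta> by (simp add: psat_def sat_ren)
      moreover have "ren (map_sum u id) \<theta> \<in> pfmls L (univ M)" if "\<theta> \<in> pfmls L (univ M)" for \<theta> :: "('f, 'r, 'i + 'c) fml"
        using that by (auto simp: pfmls_def fml.set_map map_sum_def split: sum.splits)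
      ultimately show ?thesis by (auto simp: tp_def)
    qed
    have "h L C C' M m (B \<circ> u) q = tp L C' (univ M) (B0 \<circ> u)"
      unfolding h_eq[OF q Bu] h_unfold[OF \<sigma> Bu, symmetric] by (simp add: B0_def comp_assoc)
    also have "\<dots> = tp L C (univ M) (e \<circ> u)" unfolding sub e(2) ..
    finally show ?thesis using \<tau>(2) by (simp add: comp_assoc[symmetric])
  qed
  then show ?thesis using \<tau>(1) by (auto simp: Aut_over_def)
qed

lemma h_types:
  assumes q: "q \<in> Sm L C m" and b: "range b \<subseteq> univ C"
  shows "h L C C' M m b q \<in> types\<^sub>M"
proof -
  obtain \<tau> where \<tau>: "\<tau> \<in> Aut L C" "h L C C' M m (b \<circ> id) q = tp L C (univ M) (\<tau> \<circ> (b \<circ> id))"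
    using h_transfer[OF q b countable_i] by blast
  have "range (\<tau> \<circ> b) \<subseteq> univ C" using b AutD(2)[OF \<tau>(1)] by auto
  then show ?thesis using \<tau>(2) tp_types[of "\<tau> \<circ> b"] by simp
qed

section \<open>Pushforwards of measures to the types over M\<close>

abbreviation "SM \<equiv> borel_of (type_topology L C (univ M) :: ('f, 'r, 'i + 'c) fml set topology)"

abbreviation "basics \<equiv> basic L C (univ M) ` (pfmls L (univ M) :: ('f, 'r, 'i + 'c) fml set)"

lemma sets_SM: "sets SM = sigma_sets types\<^sub>M basics"
  by (rule sets_borel_type_topology[OF ne_C countable_pfmls[OF countable_lang countable_M countable_i]])

lemma basics_Pow: "basics \<subseteq> Pow types\<^sub>M"
  by (auto simp: basic_def)

lemma basics_sets: "\<theta> \<in> pfmls L (univ M) \<Longrightarrow> basic L C (univ M) \<theta> \<in> sets SM"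
  unfolding sets_SM by (auto intro: sigma_sets.Basic)

lemma Int_stable_basics: "Int_stable basics"
proof (rule Int_stableI)
  fix a b assume "a \<in> basics" "b \<in> basics"
  then obtain \<phi> \<psi> where "\<phi> \<in> pfmls L (univ M)" "a = basic L C (univ M) \<phi>" "\<psi> \<in> pfmls L (univ M)" "b = basic L C (univ M) \<psi>" by auto
  then show "a \<inter> b \<in> basics" by (intro image_eqI[of _ _ "And \<phi> \<psi>"]) (auto simp: basic_And)
qed

lemma measure_SM_eqI:
  assumes "prob_space N1" "prob_space N2" "sets N1 = sets SM" "sets N2 = sets SM"
    and "\<And>\<theta>. \<theta> \<in> pfmls L (univ M) \<Longrightarrow> measure N1 (basic L C (univ M) \<theta>) = measure N2 (basic L C (univ M) \<theta>)"
  shows "N1 = N2"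
proof (rule measure_eqI_generator_eq[OF Int_stable_basics basics_Pow, where A = "\<lambda>_. types\<^sub>M"])
  interpret N1: prob_space N1 by fact
  interpret N2: prob_space N2 by fact
  show "emeasure N1 X = emeasure N2 X" if "X \<in> basics" for X
    using that assms(5) by (auto simp: N1.emeasure_eq_measure N2.emeasure_eq_measure)
  show "sets N1 = sigma_sets types\<^sub>M basics" "sets N2 = sigma_sets types\<^sub>M basics" using assms sets_SM by auto
  show "range (\<lambda>_. types\<^sub>M) \<subseteq> basics" using basic_tt[OF ne_C, of L "univ M"] tt_pfmls by (metis image_eqI image_subsetI)
  show "emeasure N1 types\<^sub>M \<noteq> \<infinity>" for i :: nat by simp
qed simp

abbreviation \<kappa>\<^sub>h :: "(('f, 'r, 'i + 'c) fml \<Rightarrow> real) \<Rightarrow> ('i \<Rightarrow> 'c) \<Rightarrow> ('f, 'r, 'i + 'c) fml set measure" where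
  "\<kappa>\<^sub>h \<beta> b \<equiv> distr (borel_extension L C m \<beta>) SM (h L C C' M m b)"

lemma h_vimage:
  assumes "range b \<subseteq> univ C" "\<theta> \<in> pfmls L (univ M)"
  shows "h L C C' M m b -` basic L C (univ M) \<theta> \<inter> Sm L C m = {q \<in> Sm L C m. plug (split_params \<theta>) b \<in> q}"
  using assms h_types[OF _ assms(1)] by (auto simp: basic_def h_eq)

lemma h_measurable:
  assumes \<beta>: "keisler_conc L C \<beta> m" and b: "range b \<subseteq> univ C"
  shows "h L C C' M m b \<in> measurable (borel_extension L C m \<beta>) SM"
proof (rule measurable_sigma_sets[OF sets_SM basics_Pow])
  interpret \<beta>: keisler_conc L C \<beta> m by (rule \<beta>)
  show "h L C C' M m b \<in> space (borel_extension L C m \<beta>) \<rightarrow> types\<^sub>M"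
    using h_types[OF _ b] by (auto simp: \<beta>.borel_extension(2))
  fix y assume "y \<in> basics"
  then obtain \<theta> where \<theta>: "\<theta> \<in> pfmls L (univ M)" "y = basic L C (univ M) \<theta>" by blast
  show "h L C C' M m b -` y \<inter> space (borel_extension L C m \<beta>) \<in> sets (borel_extension L C m \<beta>)"
    unfolding \<beta>.borel_extension(2) \<theta>(2) h_vimage[OF b \<theta>(1)]
    by (rule \<beta>.borel_extension(4)[OF plug_pfmls[OF split_params_fmls[OF \<theta>(1)] b]])
qed

lemma prob_space_kernel:
  assumes \<beta>: "keisler_conc L C \<beta> m" and b: "range b \<subseteq> univ C"
  shows "prob_space (\<kappa>\<^sub>h \<beta> b)"
  using keisler_conc.borel_extension(1)[OF \<beta>] h_measurable[OF \<beta> b] by (rule prob_space.prob_space_distr)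

lemma measure_kernel:
  assumes \<beta>: "keisler_conc L C \<beta> m" and b: "range b \<subseteq> univ C" and \<theta>: "\<theta> \<in> pfmls L (univ M)"
  shows "measure (\<kappa>\<^sub>h \<beta> b) (basic L C (univ M) \<theta>) = \<beta> (plug (split_params \<theta>) b)"
proof -
  interpret \<beta>: keisler_conc L C \<beta> m by (rule \<beta>)
  show ?thesis
    unfolding measure_distr[OF h_measurable[OF \<beta> b] basics_sets[OF \<theta>]] \<beta>.borel_extension(2) h_vimage[OF b \<theta>]
    by (rule \<beta>.borel_extension(5)[OF plug_pfmls[OF split_params_fmls[OF \<theta>] b]])
qed

text \<open>The requirements on a left factor of a convolution.\<close>

definition definable :: "(('f, 'r, 'i + 'c) fml \<Rightarrow> real) \<Rightarrow> bool" where
  "definable \<alpha> \<longleftrightarrow> (\<forall>\<psi>\<in>pfmls L (univ C). 0 \<le> \<alpha> \<psi> \<and> \<alpha> \<psi> \<le> 1) \<and> (\<forall>\<phi>\<in>fmls L.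
     (\<forall>b b'. range b \<subseteq> univ C \<longrightarrow> range b' \<subseteq> univ C \<longrightarrow> tp L C (univ M) b = tp L C (univ M) b' \<longrightarrow>
        \<alpha> (plug \<phi> b) = \<alpha> (plug \<phi> b')) \<and> F L C M \<alpha> \<phi> \<in> borel_measurable SM)"

lemma F_tp:
  assumes dep: "\<And>b'. range b' \<subseteq> univ C \<Longrightarrow> tp L C (univ M) b' = tp L C (univ M) b \<Longrightarrow> \<alpha> (plug \<phi> b') = \<alpha> (plug \<phi> b)"
    and b: "range b \<subseteq> univ C"
  shows "F L C M \<alpha> \<phi> (tp L C (univ M) b) = \<alpha> (plug \<phi> b)"
  unfolding F_def inst_plug
proof (rule the_equality)
  show "\<exists>b'. range b' \<subseteq> univ C \<and> tp L C (univ M) b' = tp L C (univ M) b \<and> \<alpha> (plug \<phi> b) = \<alpha> (plug \<phi> b')"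
    using b by (intro exI[of _ b]) simp
  fix v assume "\<exists>b'. range b' \<subseteq> univ C \<and> tp L C (univ M) b' = tp L C (univ M) b \<and> v = \<alpha> (plug \<phi> b')"
  then show "v = \<alpha> (plug \<phi> b)" by (elim exE conjE) (simp only: dep)
qed

lemma definable_dep:
  fixes b b' :: "'i \<Rightarrow> 'c"
  assumes \<alpha>: "definable \<alpha>" and \<phi>: "\<phi> \<in> fmls L"
    and b: "range b \<subseteq> univ C" "range b' \<subseteq> univ C" "tp L C (univ M) b = tp L C (univ M) b'"
  shows "\<alpha> (plug \<phi> b) = \<alpha> (plug \<phi> b')"
proof -
  have "\<forall>\<phi>\<in>fmls L.
     (\<forall>b b'. range b \<subseteq> univ C \<longrightarrow> range b' \<subseteq> univ C \<longrightarrow> tp L C (univ M) b = tp L C (univ M) b' \<longrightarrow>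
        \<alpha> (plug \<phi> b) = \<alpha> (plug \<phi> b')) \<and> F L C M \<alpha> \<phi> \<in> borel_measurable SM"
    using \<alpha> unfolding definable_def by (elim conjE)
  from bspec[OF this \<phi>] have "\<forall>b b'. range b \<subseteq> univ C \<longrightarrow> range b' \<subseteq> univ C \<longrightarrow>
      tp L C (univ M) b = tp L C (univ M) b' \<longrightarrow> \<alpha> (plug \<phi> b) = \<alpha> (plug \<phi> b')"
    by (elim conjE)
  from this[rule_format, OF b] show ?thesis .
qed

lemma definable_F:
  assumes "definable \<alpha>" "\<phi> \<in> fmls L" "range b \<subseteq> univ C"
  shows "F L C M \<alpha> \<phi> (tp L C (univ M) b) = \<alpha> (plug \<phi> b)"
  by (rule F_tp[where \<alpha> = \<alpha> and \<phi> = \<phi>, OF definable_dep[OF assms(1,2) _ assms(3)] assms(3)])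

lemma definable_F_bounds:
  assumes \<alpha>: "definable \<alpha>" and \<phi>: "\<phi> \<in> fmls L" and r: "r \<in> types\<^sub>M"
  shows "0 \<le> F L C M \<alpha> \<phi> r" "F L C M \<alpha> \<phi> r \<le> 1"
proof -
  obtain b where b: "range b \<subseteq> univ C" "tp L C (univ M) b = r"
    using C.realize_type[OF M_sub C.small_countable[OF countable_M] r countable_i] by blast
  have "F L C M \<alpha> \<phi> r = \<alpha> (plug \<phi> b)" using definable_F[OF \<alpha> \<phi> b(1)] b(2) by simp
  then show "0 \<le> F L C M \<alpha> \<phi> r" "F L C M \<alpha> \<phi> r \<le> 1"
    using \<alpha> plug_pfmls[OF \<phi> b(1)] unfolding definable_def by auto
qed

lemma definable_measurable: "definable \<alpha> \<Longrightarrow> \<phi> \<in> fmls L \<Longrightarrow> F L C M \<alpha> \<phi> \<in> borel_measurable SM"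
  by (simp add: definable_def)

lemma definable_Mm:
  assumes \<mu>: "\<mu> \<in> Mm_inv L C M m"
  shows "definable \<mu>"
proof -
  interpret \<mu>: nip_invariant_measure L T \<kappa> \<kappa>' C C' M m \<mu>
    by (intro nip_invariant_measure.intro nip_measure.intro nip_setting_axioms keisler_conc_Mm[OF \<mu>]
        nip_invariant_measure_axioms.intro) (use \<mu> in \<open>auto simp: Mm_inv_def\<close>)
  have dep: "\<mu> (plug \<phi> b) = \<mu> (plug \<phi> b')"
    if "\<phi> \<in> fmls L" "range b \<subseteq> univ C" "range b' \<subseteq> univ C" "tp L C (univ M) b = tp L C (univ M) b'"
    for \<phi> :: "('f, 'r, 'i + 'i) fml" and b b' using that by (intro \<mu>.measure_plug countable_i)
  have "F L C M \<mu> \<phi> \<in> borel_measurable SM" if \<phi>: "\<phi> \<in> fmls L" for \<phi>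
  proof (rule \<mu>.measure_Borel[OF \<phi> countable_i])
    fix b :: "'i \<Rightarrow> 'c" assume b: "range b \<subseteq> univ C"
    show "F L C M \<mu> \<phi> (tp L C (univ M) b) = \<mu> (plug \<phi> b)" by (rule F_tp[where \<alpha> = \<mu> and \<phi> = \<phi>, OF dep[OF \<phi> _ b] b])
  qed
  then show ?thesis unfolding definable_def using dep \<mu>.nonneg \<mu>.le_1 by blast
qed

text \<open>The value that the defining equation of \<open>conv\<close> assigns to \<phi>(b; y). It
  is a function of \<phi> and b as long as independence of this representation has not been
  shown.\<close>

definition ev :: "(('f, 'r, 'i + 'c) fml \<Rightarrow> real) \<Rightarrow> (('f, 'r, 'i + 'c) fml \<Rightarrow> real) \<Rightarrow> ('f, 'r, 'i + 'i) fml \<Rightarrow> ('i \<Rightarrow> 'c) \<Rightarrow> real" where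
  "ev \<alpha> \<beta> \<phi> b = (\<integral>r. F L C M \<alpha> \<phi> r \<partial>\<kappa>\<^sub>h \<beta> b)"

lemma ev_eq:
  assumes \<alpha>: "definable \<alpha>" and \<beta>: "keisler_conc L C \<beta> m" and \<phi>: "\<phi> \<in> fmls L" and b: "range b \<subseteq> univ C"
  shows "ev \<alpha> \<beta> \<phi> b = (\<integral>q. F L C M \<alpha> \<phi> (h L C C' M m b q) \<partial>borel_extension L C m \<beta>)"
  unfolding ev_def by (rule integral_distr[OF h_measurable[OF \<beta> b] definable_measurable[OF \<alpha> \<phi>]])

text \<open>For fixed q a single automorphism serves all \<phi> and all subtuples of B
  simultaneously. The integrand of a convolution at q is then \<alpha> at formulas moved by one
  \<tau>, so relations between several instances can be checked in \<alpha>.\<close>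

lemma F_h_transfer:
  fixes B :: "'j \<Rightarrow> 'c"
  assumes \<alpha>: "definable \<alpha>" and q: "q \<in> Sm L C m" and B: "range B \<subseteq> univ C" and cj: "countable (UNIV :: 'j set)"
  shows "\<exists>\<tau>\<in>Aut L C. \<forall>u. \<forall>\<phi>\<in>fmls L. F L C M \<alpha> \<phi> (h L C C' M m (B \<circ> u) q) = \<alpha> (act \<tau> (plug \<phi> (B \<circ> u)))"
proof -
  obtain \<tau> where \<tau>: "\<tau> \<in> Aut L C" "\<And>u. h L C C' M m (B \<circ> u) q = tp L C (univ M) (\<tau> \<circ> (B \<circ> u))"
    using h_transfer[OF q B cj] by blast
  have "F L C M \<alpha> \<phi> (h L C C' M m (B \<circ> u) q) = \<alpha> (act \<tau> (plug \<phi> (B \<circ> u)))" if \<phi>: "\<phi> \<in> fmls L" for u \<phi>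
  proof -
    have "range (\<tau> \<circ> (B \<circ> u)) \<subseteq> univ C" using B AutD(2)[OF \<tau>(1)] by auto
    from definable_F[OF \<alpha> \<phi> this] show ?thesis unfolding \<tau>(2) act_plug .
  qed
  then show ?thesis using \<tau>(1) by blast
qed

text \<open>The integrands agree at every q: both tuples are combined into one B, and the
  automorphism for B turns both sides into values of \<alpha> at the moved formulas.\<close>

lemma ev_cong:
  assumes \<alpha>: "definable \<alpha>" and \<beta>: "keisler_conc L C \<beta> m"
    and \<phi>: "\<phi> \<in> fmls L" "range b \<subseteq> univ C" "\<phi>' \<in> fmls L" "range b' \<subseteq> univ C"
    and eq: "\<And>\<tau>. \<tau> \<in> Aut L C \<Longrightarrow> \<alpha> (act \<tau> (plug \<phi> b)) = \<alpha> (act \<tau> (plug \<phi>' b'))"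
  shows "ev \<alpha> \<beta> \<phi> b = ev \<alpha> \<beta> \<phi>' b'"
proof -
  interpret \<beta>: keisler_conc L C \<beta> m by (rule \<beta>)
  show ?thesis
    unfolding ev_eq[OF \<alpha> \<beta> \<phi>(1,2)] ev_eq[OF \<alpha> \<beta> \<phi>(3,4)]
  proof (rule Bochner_Integration.integral_cong[OF refl])
    fix q assume "q \<in> space (borel_extension L C m \<beta>)"
    then have q: "q \<in> Sm L C m" by (simp add: \<beta>.borel_extension(2))
    define B where "B = case_sum b b'"
    have B: "range B \<subseteq> univ C" using \<phi> by (auto simp: B_def image_subset_iff split: sum.splits)
    have Bb: "B \<circ> Inl = b" "B \<circ> Inr = b'" by (auto simp: B_def)
    have "countable (UNIV :: ('i + 'i) set)" unfolding UNIV_Plus_UNIV[symmetric] using countable_i by (intro countable_Plus) auto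
    from F_h_transfer[OF \<alpha> q B this] obtain \<tau> where \<tau>: "\<tau> \<in> Aut L C"
      "\<And>u \<phi>. \<phi> \<in> fmls L \<Longrightarrow> F L C M \<alpha> \<phi> (h L C C' M m (B \<circ> u) q) = \<alpha> (act \<tau> (plug \<phi> (B \<circ> u)))" by blast
    show "F L C M \<alpha> \<phi> (h L C C' M m b q) = F L C M \<alpha> \<phi>' (h L C C' M m b' q)"
      using \<tau>(2)[OF \<phi>(1), of Inl] \<tau>(2)[OF \<phi>(3), of Inr] eq[OF \<tau>(1)] by (simp add: Bb)
  qed
qed

lemma plug_represent:
  assumes "\<psi> \<in> pfmls L (univ C)"
  shows "\<exists>(\<phi> :: ('f, 'r, 'i + 'i) fml) (b :: 'i \<Rightarrow> 'c). \<phi> \<in> fmls L \<and> range b \<subseteq> univ C \<and> \<psi> = plug \<phi> b"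
  by (rule plug_surj[OF assms ne_C infinite_i]) (intro exI conjI)

text \<open>The description in \<open>conv\<close> is satisfied because \<open>ev_cong\<close> makes
  the value depend on the formula \<phi>(b; y) only. It is unique because every L(C)-formula is such
  an instance and the other values are fixed at 0.\<close>

theorem conv_plug:
  assumes \<alpha>: "definable \<alpha>" and \<beta>: "keisler_conc L C \<beta> m"
  shows "\<phi> \<in> fmls L \<Longrightarrow> range b \<subseteq> univ C \<Longrightarrow> conv L C C' M m \<alpha> \<beta> (plug \<phi> b) = ev \<alpha> \<beta> \<phi> b"
    and "\<psi> \<notin> pfmls L (univ C) \<Longrightarrow> conv L C C' M m \<alpha> \<beta> \<psi> = 0"
proof -
  define Q where "Q \<rho> \<longleftrightarrow> (\<forall>\<phi>\<in>fmls L. \<forall>b. range b \<subseteq> univ C \<longrightarrow> \<rho> (plug \<phi> b) = ev \<alpha> \<beta> \<phi> b) \<and>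
     (\<forall>\<psi>. \<psi> \<notin> pfmls L (univ C) \<longrightarrow> \<rho> \<psi> = 0)" for \<rho> :: "('f, 'r, 'i + 'c) fml \<Rightarrow> real"
  define R where "R \<psi> v \<longleftrightarrow> (\<exists>\<phi> b. \<phi> \<in> fmls L \<and> range b \<subseteq> univ C \<and> \<psi> = plug \<phi> b \<and> v = ev \<alpha> \<beta> \<phi> b)" for \<psi> v
  define \<rho> where "\<rho> \<psi> = (if \<psi> \<in> pfmls L (univ C) then (SOME v. R \<psi> v) else 0)" for \<psi>
  have R: "R (plug \<phi> b) v \<longleftrightarrow> v = ev \<alpha> \<beta> \<phi> b" if "\<phi> \<in> fmls L" "range b \<subseteq> univ C" for \<phi> b v
  proof
    assume "R (plug \<phi> b) v"
    then obtain \<phi>' b' where "\<phi>' \<in> fmls L" "range b' \<subseteq> univ C" "plug \<phi> b = plug \<phi>' b'" "v = ev \<alpha> \<beta> \<phi>' b'"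
      unfolding R_def by blast
    then show "v = ev \<alpha> \<beta> \<phi> b" using ev_cong[OF \<alpha> \<beta> that, of \<phi>' b'] by simp
  qed (use that in \<open>auto simp: R_def\<close>)
  have Q\<rho>: "Q \<rho>" unfolding Q_def \<rho>_def using plug_pfmls R by auto
  have uniq: "\<rho>' = \<rho>" if "Q \<rho>'" for \<rho>'
  proof
    fix \<psi> show "\<rho>' \<psi> = \<rho> \<psi>"
    proof (cases "\<psi> \<in> pfmls L (univ C)")
      case True
      obtain \<phi> :: "('f, 'r, 'i + 'i) fml" and b :: "'i \<Rightarrow> 'c" where "\<phi> \<in> fmls L" "range b \<subseteq> univ C" "\<psi> = plug \<phi> b" using plug_represent[OF True] by blast
      then show ?thesis using that Q\<rho> by (simp add: Q_def)
    next
      case False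
      then show ?thesis using that Q\<rho> by (simp add: Q_def)
    qed
  qed
  have "conv L C C' M m \<alpha> \<beta> = (THE \<rho>. Q \<rho>)"
    unfolding conv_def Q_def inst_plug ev_def ..
  also have "\<dots> = \<rho>" using Q\<rho> uniq by (rule the_equality)
  finally have "Q (conv L C C' M m \<alpha> \<beta>)" using Q\<rho> by simp
  then show "\<phi> \<in> fmls L \<Longrightarrow> range b \<subseteq> univ C \<Longrightarrow> conv L C C' M m \<alpha> \<beta> (plug \<phi> b) = ev \<alpha> \<beta> \<phi> b"
    and "\<psi> \<notin> pfmls L (univ C) \<Longrightarrow> conv L C C' M m \<alpha> \<beta> \<psi> = 0" by (auto simp: Q_def)
qed

lemma act_Aut_pfmls:
  assumes "\<tau> \<in> Aut L C" "\<psi> \<in> pfmls L (univ C)"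
  shows "act \<tau> \<psi> \<in> pfmls L (univ C)"
proof -
  have "\<tau> ` univ C = univ C" using AutD(1)[OF assms(1)] by (simp add: bij_betw_def)
  then show ?thesis using act_pfmls[OF assms(2), of \<tau>] by simp
qed

lemma act_Aut_sat:
  assumes \<tau>: "\<tau> \<in> Aut L C" and a: "range a \<subseteq> univ C"
  obtains a' where "range a' \<subseteq> univ C" "\<And>\<psi>. \<psi> \<in> pfmls L (univ C) \<Longrightarrow> psat C a (act \<tau> \<psi>) \<longleftrightarrow> psat C a' \<psi>"
proof -
  have im: "\<tau> ` univ C = univ C" using AutD(1)[OF \<tau>] by (simp add: bij_betw_def)
  define a' where "a' = inv_into (univ C) \<tau> \<circ> a"
  have "a x \<in> \<tau> ` univ C" for x using a im by auto
  then have a': "range a' \<subseteq> univ C" "\<tau> \<circ> a' = a" by (auto simp: a'_def fun_eq_iff inv_into_into f_inv_into_f)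
  then show ?thesis using that[of a'] psat_act_Aut[OF \<tau> C.struct _ a'(1)] by simp
qed

text \<open>Each axiom is an identity or inequality valid pointwise under the integral, because at
  each q the integrand is \<alpha> composed with an automorphism of C, and automorphisms preserve
  validity, equivalence and disjointness of formulas.\<close>

theorem conv_keisler_conc:
  assumes \<alpha>: "definable \<alpha>" and \<alpha>k: "keisler_conc L C \<alpha> m" and \<beta>: "keisler_conc L C \<beta> m"
  shows "keisler_conc L C (conv L C C' M m \<alpha> \<beta>) m"
proof -
  interpret \<alpha>: keisler_conc L C \<alpha> m by (rule \<alpha>k)
  interpret \<beta>: keisler_conc L C \<beta> m by (rule \<beta>)
  let ?N = "borel_extension L C m \<beta>"
  let ?\<gamma> = "conv L C C' M m \<alpha> \<beta>"
  interpret N: prob_space ?N by (rule \<beta>.borel_extension(1))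
  have integrable: "integrable ?N (\<lambda>q. F L C M \<alpha> \<phi> (h L C C' M m b q))" if "\<phi> \<in> fmls L" "range b \<subseteq> univ C" for \<phi> b
  proof (rule N.integrable_const_bound[where B = 1])
    show "(\<lambda>q. F L C M \<alpha> \<phi> (h L C C' M m b q)) \<in> borel_measurable ?N"
      using h_measurable[OF \<beta> that(2)] definable_measurable[OF \<alpha> that(1)] by (rule measurable_compose)
    show "AE q in ?N. norm (F L C M \<alpha> \<phi> (h L C C' M m b q)) \<le> 1"
      using definable_F_bounds[OF \<alpha> that(1) h_types[OF _ that(2)]] by (intro AE_I2) (auto simp: \<beta>.borel_extension(2))
  qed
  have \<gamma>: "?\<gamma> (plug \<phi> b) = (\<integral>q. F L C M \<alpha> \<phi> (h L C C' M m b q) \<partial>?N)" if "\<phi> \<in> fmls L" "range b \<subseteq> univ C" for \<phi> b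
    using conv_plug(1)[OF \<alpha> \<beta> that] ev_eq[OF \<alpha> \<beta> that] by simp
  have one: "?\<gamma> \<psi> = 1" if \<psi>: "\<psi> \<in> pfmls L (univ C)" and 1: "\<And>\<tau>. \<tau> \<in> Aut L C \<Longrightarrow> \<alpha> (act \<tau> \<psi>) = 1" for \<psi>
  proof -
    obtain \<phi> :: "('f, 'r, 'i + 'i) fml" and b :: "'i \<Rightarrow> 'c" where \<phi>: "\<phi> \<in> fmls L" "range b \<subseteq> univ C" "\<psi> = plug \<phi> b" using plug_represent[OF \<psi>] by blast
    have "F L C M \<alpha> \<phi> (h L C C' M m b q) = 1" if "q \<in> space ?N" for q
    proof -
      have q: "q \<in> Sm L C m" using that by (simp add: \<beta>.borel_extension(2))
      obtain \<tau> where \<tau>: "\<tau> \<in> Aut L C" "F L C M \<alpha> \<phi> (h L C C' M m (b \<circ> id) q) = \<alpha> (act \<tau> (plug \<phi> (b \<circ> id)))"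
        using F_h_transfer[OF \<alpha> q \<phi>(2) countable_i] \<phi>(1) by blast
      then show ?thesis using 1[OF \<tau>(1)] \<phi>(3) by simp
    qed
    then have "?\<gamma> \<psi> = (\<integral>q. 1 \<partial>?N)" unfolding \<phi>(3) \<gamma>[OF \<phi>(1,2)] by (intro Bochner_Integration.integral_cong) auto
    then show ?thesis by (simp add: N.prob_space)
  qed
  have "keisler_measure L C ?\<gamma>"
    unfolding keisler_measure_def
  proof (intro conjI ballI impI)
    fix \<psi> :: "('f, 'r, 'i + 'c) fml" assume \<psi>: "\<psi> \<in> pfmls L (univ C)"
    obtain \<phi> :: "('f, 'r, 'i + 'i) fml" and b :: "'i \<Rightarrow> 'c" where \<phi>: "\<phi> \<in> fmls L" "range b \<subseteq> univ C" "\<psi> = plug \<phi> b" using plug_represent[OF \<psi>] by blast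
    show "0 \<le> ?\<gamma> \<psi>" unfolding \<phi>(3) \<gamma>[OF \<phi>(1,2)]
      using definable_F_bounds(1)[OF \<alpha> \<phi>(1) h_types[OF _ \<phi>(2)]] by (intro Bochner_Integration.integral_nonneg) (auto simp: \<beta>.borel_extension(2))
  next
    fix \<psi> :: "('f, 'r, 'i + 'c) fml" assume \<psi>: "\<psi> \<in> pfmls L (univ C)" and v: "\<forall>a. range a \<subseteq> univ C \<longrightarrow> psat C a \<psi>"
    show "?\<gamma> \<psi> = 1"
    proof (rule one[OF \<psi>])
      fix \<tau> assume \<tau>: "\<tau> \<in> Aut L C"
      show "\<alpha> (act \<tau> \<psi>) = 1"
      proof (rule \<alpha>.valid[OF act_Aut_pfmls[OF \<tau> \<psi>]])
        fix a :: "'i \<Rightarrow> 'c" assume "range a \<subseteq> univ C"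
        then show "psat C a (act \<tau> \<psi>)" using act_Aut_sat[OF \<tau>] v \<psi> by metis
      qed
    qed
  next
    fix \<psi> \<psi>' :: "('f, 'r, 'i + 'c) fml" assume \<psi>: "\<psi> \<in> pfmls L (univ C)" "\<psi>' \<in> pfmls L (univ C)"
      and eq: "\<forall>a. range a \<subseteq> univ C \<longrightarrow> (psat C a \<psi> \<longleftrightarrow> psat C a \<psi>')"
    obtain \<phi> :: "('f, 'r, 'i + 'i) fml" and b :: "'i \<Rightarrow> 'c" where \<phi>: "\<phi> \<in> fmls L" "range b \<subseteq> univ C" "\<psi> = plug \<phi> b" using plug_represent[OF \<psi>(1)] by blast
    obtain \<phi>' :: "('f, 'r, 'i + 'i) fml" and b' :: "'i \<Rightarrow> 'c" where \<phi>': "\<phi>' \<in> fmls L" "range b' \<subseteq> univ C" "\<psi>' = plug \<phi>' b'" using plug_represent[OF \<psi>(2)] by blast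
    have "ev \<alpha> \<beta> \<phi> b = ev \<alpha> \<beta> \<phi>' b'"
    proof (rule ev_cong[OF \<alpha> \<beta> \<phi>(1,2) \<phi>'(1,2)])
      fix \<tau> assume \<tau>: "\<tau> \<in> Aut L C"
      show "\<alpha> (act \<tau> (plug \<phi> b)) = \<alpha> (act \<tau> (plug \<phi>' b'))"
        unfolding \<phi>(3)[symmetric] \<phi>'(3)[symmetric]
      proof (rule \<alpha>.equiv[OF act_Aut_pfmls[OF \<tau> \<psi>(1)] act_Aut_pfmls[OF \<tau> \<psi>(2)]])
        fix a :: "'i \<Rightarrow> 'c" assume "range a \<subseteq> univ C"
        then show "psat C a (act \<tau> \<psi>) \<longleftrightarrow> psat C a (act \<tau> \<psi>')" using act_Aut_sat[OF \<tau>] eq \<psi> by metis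
      qed
    qed
    then show "?\<gamma> \<psi> = ?\<gamma> \<psi>'" using conv_plug(1)[OF \<alpha> \<beta> \<phi>(1,2)] conv_plug(1)[OF \<alpha> \<beta> \<phi>'(1,2)] \<phi>(3) \<phi>'(3) by simp
  next
    fix \<psi> \<psi>' :: "('f, 'r, 'i + 'c) fml" assume \<psi>: "\<psi> \<in> pfmls L (univ C)" "\<psi>' \<in> pfmls L (univ C)"
      and dis: "\<forall>a. range a \<subseteq> univ C \<longrightarrow> \<not> (psat C a \<psi> \<and> psat C a \<psi>')"
    let ?o = "Neg (And (Neg \<psi>) (Neg \<psi>'))"
    have o: "?o \<in> pfmls L (univ C)" using \<psi> by simp
    obtain \<phi> :: "('f, 'r, 'i + 'i) fml" and b :: "'i \<Rightarrow> 'c" where \<phi>: "\<phi> \<in> fmls L" "range b \<subseteq> univ C" "\<psi> = plug \<phi> b" using plug_represent[OF \<psi>(1)] by blast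
    obtain \<phi>' :: "('f, 'r, 'i + 'i) fml" and b' :: "'i \<Rightarrow> 'c" where \<phi>': "\<phi>' \<in> fmls L" "range b' \<subseteq> univ C" "\<psi>' = plug \<phi>' b'" using plug_represent[OF \<psi>(2)] by blast
    obtain \<phi>'' :: "('f, 'r, 'i + 'i) fml" and b'' :: "'i \<Rightarrow> 'c" where \<phi>'': "\<phi>'' \<in> fmls L" "range b'' \<subseteq> univ C" "?o = plug \<phi>'' b''" using plug_represent[OF o] by blast
    have "?\<gamma> ?o = (\<integral>q. F L C M \<alpha> \<phi> (h L C C' M m b q) + F L C M \<alpha> \<phi>' (h L C C' M m b' q) \<partial>?N)"
      unfolding \<phi>''(3) \<gamma>[OF \<phi>''(1,2)]
    proof (rule Bochner_Integration.integral_cong[OF refl])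
      fix q assume "q \<in> space ?N"
      then have q: "q \<in> Sm L C m" by (simp add: \<beta>.borel_extension(2))
      \<comment> \<open>Three representations are involved, chosen independently; joining their
        tuples lets one automorphism treat all of them.\<close>
      define B where "B = case_sum b (case_sum b' b'')"
      have B: "range B \<subseteq> univ C" using \<phi> \<phi>' \<phi>'' by (auto simp: B_def image_subset_iff split: sum.splits)
      have Bb: "B \<circ> Inl = b" "B \<circ> (Inr \<circ> Inl) = b'" "B \<circ> (Inr \<circ> Inr) = b''" by (auto simp: B_def)
      have "countable (UNIV :: ('i + 'i + 'i) set)" unfolding UNIV_Plus_UNIV[symmetric] using countable_i by (intro countable_Plus) auto
      from F_h_transfer[OF \<alpha> q B this] obtain \<tau> where \<tau>: "\<tau> \<in> Aut L C"
        "\<And>u \<phi>. \<phi> \<in> fmls L \<Longrightarrow> F L C M \<alpha> \<phi> (h L C C' M m (B \<circ> u) q) = \<alpha> (act \<tau> (plug \<phi> (B \<circ> u)))" by blast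
      have "\<alpha> (act \<tau> ?o) = \<alpha> (act \<tau> \<psi>) + \<alpha> (act \<tau> \<psi>')"
      proof (rule \<alpha>.sum_eq[OF act_Aut_pfmls[OF \<tau>(1) \<psi>(1)] act_Aut_pfmls[OF \<tau>(1) \<psi>(2)] act_Aut_pfmls[OF \<tau>(1) o]])
        fix a :: "'i \<Rightarrow> 'c" assume "range a \<subseteq> univ C"
        then obtain a' where a': "range a' \<subseteq> univ C" "\<And>\<psi>. \<psi> \<in> pfmls L (univ C) \<Longrightarrow> psat C a (act \<tau> \<psi>) \<longleftrightarrow> psat C a' \<psi>"
          using act_Aut_sat[OF \<tau>(1)] by metis
        show "\<not> (psat C a (act \<tau> \<psi>) \<and> psat C a (act \<tau> \<psi>'))" using dis a' \<psi> by simp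
        show "psat C a (act \<tau> ?o) \<longleftrightarrow> psat C a (act \<tau> \<psi>) \<or> psat C a (act \<tau> \<psi>')" using a' \<psi> o by simp
      qed
      then show "F L C M \<alpha> \<phi>'' (h L C C' M m b'' q) = F L C M \<alpha> \<phi> (h L C C' M m b q) + F L C M \<alpha> \<phi>' (h L C C' M m b' q)"
        using \<tau>(2)[OF \<phi>(1), of Inl] \<tau>(2)[OF \<phi>'(1), of "Inr \<circ> Inl"] \<tau>(2)[OF \<phi>''(1), of "Inr \<circ> Inr"]
        unfolding Bb \<phi>(3)[symmetric] \<phi>'(3)[symmetric] \<phi>''(3)[symmetric] by simp
    qed
    also have "\<dots> = ?\<gamma> \<psi> + ?\<gamma> \<psi>'"
      unfolding \<phi>(3) \<phi>'(3) \<gamma>[OF \<phi>(1,2)] \<gamma>[OF \<phi>'(1,2)]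
      by (rule Bochner_Integration.integral_add[OF integrable[OF \<phi>(1,2)] integrable[OF \<phi>'(1,2)]])
    finally show "?\<gamma> ?o = ?\<gamma> \<psi> + ?\<gamma> \<psi>'" .
  qed
  moreover have "?\<gamma> \<psi> = 1" if \<psi>: "\<psi> \<in> tp L C {} m" for \<psi>
  proof (rule one)
    have \<psi>0: "\<psi> \<in> pfmls L {}" using \<psi> by (simp add: tp_def)
    then show "\<psi> \<in> pfmls L (univ C)" using pfmls_mono[of "{}" "univ C" L] by blast
    fix \<tau>
    \<comment> \<open>A formula without parameters is fixed by every automorphism, so the
      concentration of \<alpha> passes to the convolution.\<close>
    have "act \<tau> \<psi> = ren id \<psi>" unfolding act_def
    proof (rule ren_cong_fv)
      fix x assume x: "x \<in> fv \<psi>"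
      show "map_sum id \<tau> x = id x" by (cases x) (use x \<psi>0 in \<open>auto simp: pfmls_def\<close>)
    qed
    then show "\<alpha> (act \<tau> \<psi>) = 1" using \<alpha>.conc[OF \<psi>] by (simp add: fml.map_id)
  qed
  ultimately show ?thesis using ne_C m_C by unfold_locales auto
qed

section \<open>The pushforwards as a measurable kernel on types over M\<close>

lemma kernel_cong:
  assumes \<mu>: "definable \<mu>" "keisler_conc L C \<mu> m"
    and b: "range b \<subseteq> univ C" "range b' \<subseteq> univ C" "tp L C (univ M) b = tp L C (univ M) b'"
  shows "\<kappa>\<^sub>h \<mu> b = \<kappa>\<^sub>h \<mu> b'"
proof (rule measure_SM_eqI)
  fix \<theta> :: "('f, 'r, 'i + 'c) fml" assume \<theta>: "\<theta> \<in> pfmls L (univ M)"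
  have "\<mu> (plug (split_params \<theta>) b) = \<mu> (plug (split_params \<theta>) b')"
    by (rule definable_dep[OF \<mu>(1) split_params_fmls[OF \<theta>] b])
  then show "measure (\<kappa>\<^sub>h \<mu> b) (basic L C (univ M) \<theta>) = measure (\<kappa>\<^sub>h \<mu> b') (basic L C (univ M) \<theta>)"
    using measure_kernel[OF \<mu>(2) b(1) \<theta>] measure_kernel[OF \<mu>(2) b(2) \<theta>] by simp
qed (use prob_space_kernel[OF \<mu>(2)] b in auto)

text \<open>A choice of representatives that makes the pushforward a function of the type r. By
  \<open>kernel_cong\<close> the measure does not depend on the chosen tuple.\<close>

definition realization :: "('f, 'r, 'i + 'c) fml set \<Rightarrow> 'i \<Rightarrow> 'c" where
  "realization r = (SOME b. range b \<subseteq> univ C \<and> tp L C (univ M) b = r)"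

lemma realization:
  assumes "r \<in> types\<^sub>M"
  shows "range (realization r) \<subseteq> univ C" "tp L C (univ M) (realization r) = r"
proof -
  have "\<exists>b. range b \<subseteq> univ C \<and> tp L C (univ M) b = r"
    using C.realize_type[OF M_sub C.small_countable[OF countable_M] assms countable_i] by blast
  from someI_ex[OF this] show "range (realization r) \<subseteq> univ C" "tp L C (univ M) (realization r) = r"
    by (simp_all add: realization_def)
qed

text \<open>Measurability has to be checked only on the countable intersection-stable base, where
  the value of the kernel is the function \<open>F\<close> of the formula with its parameters split
  off.\<close>

lemma kernel_measurable:
  assumes \<mu>: "definable \<mu>" "keisler_conc L C \<mu> m"
  shows "(\<lambda>r. \<kappa>\<^sub>h \<mu> (realization r)) \<in> measurable SM (prob_algebra SM)"
proof (rule measurable_prob_algebra_generated[OF sets_SM Int_stable_basics basics_Pow])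
  fix r assume "r \<in> space SM"
  then have r: "r \<in> types\<^sub>M" by (simp add: space_S_M)
  show "prob_space (\<kappa>\<^sub>h \<mu> (realization r))" by (rule prob_space_kernel[OF \<mu>(2) realization(1)[OF r]])
  show "sets (\<kappa>\<^sub>h \<mu> (realization r)) = sets SM" by simp
next
  fix A assume "A \<in> basics"
  then obtain \<theta> where \<theta>: "\<theta> \<in> pfmls L (univ M)" "A = basic L C (univ M) \<theta>" by blast
  have "emeasure (\<kappa>\<^sub>h \<mu> (realization r)) A = ennreal (F L C M \<mu> (split_params \<theta>) r)" if "r \<in> space SM" for r
  proof -
    have r: "r \<in> types\<^sub>M" using that by (simp add: space_S_M)
    interpret K: prob_space "\<kappa>\<^sub>h \<mu> (realization r)" by (rule prob_space_kernel[OF \<mu>(2) realization(1)[OF r]])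
    have "measure (\<kappa>\<^sub>h \<mu> (realization r)) A = \<mu> (plug (split_params \<theta>) (realization r))"
      unfolding \<theta>(2) by (rule measure_kernel[OF \<mu>(2) realization(1)[OF r] \<theta>(1)])
    also have "\<dots> = F L C M \<mu> (split_params \<theta>) r"
      using definable_F[OF \<mu>(1) split_params_fmls[OF \<theta>(1)] realization(1)[OF r]] realization(2)[OF r] by simp
    finally show ?thesis by (simp add: K.emeasure_eq_measure)
  qed
  moreover have "(\<lambda>r. ennreal (F L C M \<mu> (split_params \<theta>) r)) \<in> borel_measurable SM"
    using definable_measurable[OF \<mu>(1) split_params_fmls[OF \<theta>(1)]] by simp
  ultimately show "(\<lambda>r. emeasure (\<kappa>\<^sub>h \<mu> (realization r)) A) \<in> borel_measurable SM"
    by (simp cong: measurable_cong)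
qed

lemma F_conv:
  assumes \<pi>: "definable \<pi>" and \<mu>: "definable \<mu>" "keisler_conc L C \<mu> m" and \<phi>: "\<phi> \<in> fmls L" and r: "r \<in> types\<^sub>M"
  shows "F L C M (conv L C C' M m \<pi> \<mu>) \<phi> r = (\<integral>s. F L C M \<pi> \<phi> s \<partial>\<kappa>\<^sub>h \<mu> (realization r))"
proof -
  note b = realization[OF r]
  have "F L C M (conv L C C' M m \<pi> \<mu>) \<phi> (tp L C (univ M) (realization r)) = conv L C C' M m \<pi> \<mu> (plug \<phi> (realization r))"
  proof (rule F_tp[OF _ b(1)])
    fix b' :: "'i \<Rightarrow> 'c" assume b': "range b' \<subseteq> univ C" "tp L C (univ M) b' = tp L C (univ M) (realization r)"
    show "conv L C C' M m \<pi> \<mu> (plug \<phi> b') = conv L C C' M m \<pi> \<mu> (plug \<phi> (realization r))"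
      unfolding conv_plug(1)[OF \<pi> \<mu>(2) \<phi> b'(1)] conv_plug(1)[OF \<pi> \<mu>(2) \<phi> b(1)] ev_def
      using kernel_cong[OF \<mu> b'(1) b(1) b'(2)] by simp
  qed
  then show ?thesis unfolding b(2) conv_plug(1)[OF \<pi> \<mu>(2) \<phi> b(1)] ev_def .
qed

text \<open>As a function of r, \<open>F\<close> of the convolution is the integral of the Borel
  function \<open>F\<close> of \<pi> against the measurable kernel of \<mu>, hence Borel. Dependence
  on the type over M alone comes from the kernel.\<close>

theorem definable_conv:
  assumes \<pi>: "definable \<pi>" "keisler_conc L C \<pi> m" and \<mu>: "definable \<mu>" "keisler_conc L C \<mu> m"
  shows "definable (conv L C C' M m \<pi> \<mu>)"
  unfolding definable_def
proof (intro conjI ballI allI impI)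
  interpret \<gamma>: keisler_conc L C "conv L C C' M m \<pi> \<mu>" m by (rule conv_keisler_conc[OF \<pi> \<mu>(2)])
  show "0 \<le> conv L C C' M m \<pi> \<mu> \<psi>" "conv L C C' M m \<pi> \<mu> \<psi> \<le> 1" if "\<psi> \<in> pfmls L (univ C)" for \<psi>
    using that by (auto intro: \<gamma>.nonneg \<gamma>.le_1)
next
  fix \<phi> :: "('f, 'r, 'i + 'i) fml" and b b' :: "'i \<Rightarrow> 'c"
  assume \<phi>: "\<phi> \<in> fmls L" and b: "range b \<subseteq> univ C" "range b' \<subseteq> univ C" "tp L C (univ M) b = tp L C (univ M) b'"
  show "conv L C C' M m \<pi> \<mu> (plug \<phi> b) = conv L C C' M m \<pi> \<mu> (plug \<phi> b')"
    unfolding conv_plug(1)[OF \<pi>(1) \<mu>(2) \<phi> b(1)] conv_plug(1)[OF \<pi>(1) \<mu>(2) \<phi> b(2)] ev_def kernel_cong[OF \<mu> b] ..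
next
  fix \<phi> :: "('f, 'r, 'i + 'i) fml" assume \<phi>: "\<phi> \<in> fmls L"
  have "(\<lambda>r. \<integral>s. F L C M \<pi> \<phi> s \<partial>\<kappa>\<^sub>h \<mu> (realization r)) \<in> borel_measurable SM"
    by (rule measurable_compose[OF measurable_prob_algebraD[OF kernel_measurable[OF \<mu>]]
        integral_measurable_subprob_algebra[OF definable_measurable[OF \<pi>(1) \<phi>]]])
  moreover have "r \<in> types\<^sub>M" if "r \<in> space SM" for r using that by (simp add: space_S_M)
  ultimately show "F L C M (conv L C C' M m \<pi> \<mu>) \<phi> \<in> borel_measurable SM"
    by (subst measurable_cong[OF F_conv[OF \<pi>(1) \<mu> \<phi>]]) auto
qed

text \<open>Both sides are probability measures over M, so the basic sets suffice. On the set of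
  \<theta> both give the integral of \<open>F\<close> of \<mu> at the split formula: the left side
  by the definition of the convolution, the right side by that of a mixture.\<close>

lemma kernel_conv:
  assumes \<mu>: "definable \<mu>" "keisler_conc L C \<mu> m" and \<nu>: "keisler_conc L C \<nu> m" and b: "range b \<subseteq> univ C"
  shows "\<kappa>\<^sub>h (conv L C C' M m \<mu> \<nu>) b = \<kappa>\<^sub>h \<nu> b \<bind> (\<lambda>r. \<kappa>\<^sub>h \<mu> (realization r))"
proof -
  let ?K = "\<lambda>r. \<kappa>\<^sub>h \<mu> (realization r)"
  note \<gamma> = conv_keisler_conc[OF \<mu> \<nu>]
  interpret N: prob_space "\<kappa>\<^sub>h \<nu> b" by (rule prob_space_kernel[OF \<nu> b])
  have N: "\<kappa>\<^sub>h \<nu> b \<in> space (prob_algebra SM)" by (simp add: space_prob_algebra N.prob_space_axioms)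
  have K: "?K \<in> measurable (\<kappa>\<^sub>h \<nu> b) (subprob_algebra SM)" using measurable_prob_algebraD[OF kernel_measurable[OF \<mu>]] by simp
  interpret B: prob_space "\<kappa>\<^sub>h \<nu> b \<bind> ?K" by (rule prob_space_bind'[OF N kernel_measurable[OF \<mu>]])
  show ?thesis
  proof (rule measure_SM_eqI[OF prob_space_kernel[OF \<gamma> b] B.prob_space_axioms])
    show "sets (\<kappa>\<^sub>h \<nu> b \<bind> ?K) = sets SM" by (rule sets_bind'[OF N kernel_measurable[OF \<mu>]])
    fix \<theta> :: "('f, 'r, 'i + 'c) fml" assume \<theta>: "\<theta> \<in> pfmls L (univ M)"
    note s = split_params_fmls[OF \<theta>]
    have "emeasure (\<kappa>\<^sub>h \<nu> b \<bind> ?K) (basic L C (univ M) \<theta>) = (\<integral>\<^sup>+r. emeasure (?K r) (basic L C (univ M) \<theta>) \<partial>\<kappa>\<^sub>h \<nu> b)"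
      by (rule emeasure_bind[OF N.not_empty K basics_sets[OF \<theta>]])
    also have "\<dots> = (\<integral>\<^sup>+r. ennreal (F L C M \<mu> (split_params \<theta>) r) \<partial>\<kappa>\<^sub>h \<nu> b)"
    proof (rule nn_integral_cong)
      fix r assume "r \<in> space (\<kappa>\<^sub>h \<nu> b)"
      then have r: "r \<in> types\<^sub>M" by (simp add: space_S_M)
      interpret Kr: prob_space "?K r" by (rule prob_space_kernel[OF \<mu>(2) realization(1)[OF r]])
      have "measure (?K r) (basic L C (univ M) \<theta>) = F L C M \<mu> (split_params \<theta>) r"
        unfolding measure_kernel[OF \<mu>(2) realization(1)[OF r] \<theta>]
        using definable_F[OF \<mu>(1) s realization(1)[OF r]] realization(2)[OF r] by simp
      then show "emeasure (?K r) (basic L C (univ M) \<theta>) = ennreal (F L C M \<mu> (split_params \<theta>) r)"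
        by (simp add: Kr.emeasure_eq_measure)
    qed
    also have "\<dots> = ennreal (\<integral>r. F L C M \<mu> (split_params \<theta>) r \<partial>\<kappa>\<^sub>h \<nu> b)"
    proof (rule nn_integral_eq_integral)
      show "integrable (\<kappa>\<^sub>h \<nu> b) (F L C M \<mu> (split_params \<theta>))"
        using definable_F_bounds[OF \<mu>(1) s] definable_measurable[OF \<mu>(1) s]
        by (intro N.integrable_const_bound[where B = 1]) (auto simp: space_S_M intro!: AE_I2)
      show "AE r in \<kappa>\<^sub>h \<nu> b. 0 \<le> F L C M \<mu> (split_params \<theta>) r"
        using definable_F_bounds[OF \<mu>(1) s] by (auto simp: space_S_M intro!: AE_I2)
    qed
    also have "(\<integral>r. F L C M \<mu> (split_params \<theta>) r \<partial>\<kappa>\<^sub>h \<nu> b) = conv L C C' M m \<mu> \<nu> (plug (split_params \<theta>) b)"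
      unfolding conv_plug(1)[OF \<mu>(1) \<nu> s b] ev_def ..
    finally have "measure (\<kappa>\<^sub>h \<nu> b \<bind> ?K) (basic L C (univ M) \<theta>) = conv L C C' M m \<mu> \<nu> (plug (split_params \<theta>) b)"
      using keisler.nonneg[OF keisler_conc.axioms(1)[OF \<gamma>] plug_pfmls[OF s b]]
      by (simp add: measure_def)
    then show "measure (\<kappa>\<^sub>h (conv L C C' M m \<mu> \<nu>) b) (basic L C (univ M) \<theta>) = measure (\<kappa>\<^sub>h \<nu> b \<bind> ?K) (basic L C (univ M) \<theta>)"
      unfolding measure_kernel[OF \<gamma> b \<theta>] by simp
  qed simp
qed

theorem conv_assoc:
  assumes \<pi>: "definable \<pi>" "keisler_conc L C \<pi> m" and \<mu>: "definable \<mu>" "keisler_conc L C \<mu> m"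
    and \<nu>: "keisler_conc L C \<nu> m"
  shows "conv L C C' M m \<pi> (conv L C C' M m \<mu> \<nu>) = conv L C C' M m (conv L C C' M m \<pi> \<mu>) \<nu>"
proof
  fix \<psi> :: "('f, 'r, 'i + 'c) fml"
  note \<mu>\<nu> = conv_keisler_conc[OF \<mu> \<nu>] and \<pi>\<mu> = definable_conv[OF \<pi> \<mu>]
  show "conv L C C' M m \<pi> (conv L C C' M m \<mu> \<nu>) \<psi> = conv L C C' M m (conv L C C' M m \<pi> \<mu>) \<nu> \<psi>"
  proof (cases "\<psi> \<in> pfmls L (univ C)")
    case False
    \<comment> \<open>The equation is between functions on all formulas; outside the L(C)-formulas
      both sides have the conventional value 0.\<close>
    then show ?thesis using conv_plug(2)[OF \<pi>(1) \<mu>\<nu>] conv_plug(2)[OF \<pi>\<mu> \<nu>] by simp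
  next
    case True
    obtain \<phi> :: "('f, 'r, 'i + 'i) fml" and b :: "'i \<Rightarrow> 'c" where \<phi>: "\<phi> \<in> fmls L" "range b \<subseteq> univ C" "\<psi> = plug \<phi> b" using plug_represent[OF True] by blast
    interpret N: prob_space "\<kappa>\<^sub>h \<nu> b" by (rule prob_space_kernel[OF \<nu> \<phi>(2)])
    have "conv L C C' M m \<pi> (conv L C C' M m \<mu> \<nu>) \<psi> = (\<integral>r. F L C M \<pi> \<phi> r \<partial>(\<kappa>\<^sub>h \<nu> b \<bind> (\<lambda>r. \<kappa>\<^sub>h \<mu> (realization r))))"
      unfolding \<phi>(3) conv_plug(1)[OF \<pi>(1) \<mu>\<nu> \<phi>(1,2)] ev_def kernel_conv[OF \<mu> \<nu> \<phi>(2)] ..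
    also have "\<dots> = (\<integral>r. \<integral>s. F L C M \<pi> \<phi> s \<partial>\<kappa>\<^sub>h \<mu> (realization r) \<partial>\<kappa>\<^sub>h \<nu> b)"
      by (rule integral_bind_bounded[OF _ kernel_measurable[OF \<mu>] definable_measurable[OF \<pi>(1) \<phi>(1)]])
        (auto simp: space_prob_algebra N.prob_space_axioms space_S_M definable_F_bounds[OF \<pi>(1) \<phi>(1)])
    also have "\<dots> = (\<integral>r. F L C M (conv L C C' M m \<pi> \<mu>) \<phi> r \<partial>\<kappa>\<^sub>h \<nu> b)"
      by (rule Bochner_Integration.integral_cong) (auto simp: space_S_M F_conv[OF \<pi>(1) \<mu> \<phi>(1)])
    also have "\<dots> = conv L C C' M m (conv L C C' M m \<pi> \<mu>) \<nu> \<psi>"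
      unfolding \<phi>(3) conv_plug(1)[OF \<pi>\<mu> \<nu> \<phi>(1,2)] ev_def ..
    finally show ?thesis .
  qed
qed

text \<open>Additivity is completeness of p: exactly one of a formula and its negation lies in p,
  and two disjoint formulas cannot both lie in it, as a type is finitely satisfiable.\<close>

lemma dirac_Mm:
  assumes p: "p \<in> Sm_inv L C M m"
  shows "dirac p \<in> Mm_inv L C M m"
proof -
  have pt: "p \<in> types L C (univ C)" and pm: "tp L C {} m \<subseteq> p" using p by (auto simp: Sm_inv_def Sm_def)
  have sat: "\<exists>a. range a \<subseteq> univ C \<and> psat C a \<psi>" if \<psi>: "\<psi> \<in> p" for \<psi>
  proof (rule types_finsat[OF pt, of "{\<psi>}"])
    show "{\<psi>} \<subseteq> p" using \<psi> by simp
  qed auto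
  have "keisler_measure L C (dirac p)"
    unfolding keisler_measure_def
  proof (intro conjI ballI impI)
    fix \<phi> :: "('f, 'r, 'i + 'c) fml" assume \<phi>: "\<phi> \<in> pfmls L (univ C)"
    show "0 \<le> dirac p \<phi>" by (simp add: dirac_def)
    assume "\<forall>a. range a \<subseteq> univ C \<longrightarrow> psat C a \<phi>"
    then have "\<phi> \<in> p" using types_closed[OF pt \<phi>, of "{}"] by simp
    then show "dirac p \<phi> = 1" by (simp add: dirac_def)
  next
    fix \<phi> \<psi> :: "('f, 'r, 'i + 'c) fml" assume \<phi>: "\<phi> \<in> pfmls L (univ C)" "\<psi> \<in> pfmls L (univ C)"
      and "\<forall>a. range a \<subseteq> univ C \<longrightarrow> (psat C a \<phi> \<longleftrightarrow> psat C a \<psi>)"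
    then have "\<phi> \<in> p \<longleftrightarrow> \<psi> \<in> p"
      using types_closed[OF pt \<phi>(1), of "{\<psi>}"] types_closed[OF pt \<phi>(2), of "{\<phi>}"] by auto
    then show "dirac p \<phi> = dirac p \<psi>" by (simp add: dirac_def)
  next
    fix \<phi> \<psi> :: "('f, 'r, 'i + 'c) fml" assume \<phi>: "\<phi> \<in> pfmls L (univ C)" "\<psi> \<in> pfmls L (univ C)"
      and dis: "\<forall>a. range a \<subseteq> univ C \<longrightarrow> \<not> (psat C a \<phi> \<and> psat C a \<psi>)"
    have "And \<phi> \<psi> \<notin> p" using sat[of "And \<phi> \<psi>"] dis by auto
    then show "dirac p (Neg (And (Neg \<phi>) (Neg \<psi>))) = dirac p \<phi> + dirac p \<psi>"
      using \<phi> by (auto simp: dirac_def types_Neg[OF pt] types_And[OF pt])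
  qed
  moreover have "dirac p (act \<sigma> \<phi>) = dirac p \<phi>" if "\<sigma> \<in> Aut_over L C (univ M)" "\<phi> \<in> pfmls L (univ C)" for \<sigma> \<phi>
    using p that by (simp add: Sm_inv_def dirac_def)
  ultimately show ?thesis using pm by (auto simp: Mm_inv_def dirac_def)
qed

end

theorem theorem4p40:
  fixes L :: "('f, 'r) lang"
    and T :: "('f, 'r, nat) fml set"
    and \<kappa> :: "'k rel" and \<kappa>' :: "'l rel"
    and C C' M :: "('f, 'r, 'c) struct"
    and m :: "'i \<Rightarrow> 'c"
    and \<mu> \<nu> :: "('f, 'r, 'i + 'c) fml \<Rightarrow> real"
    and p :: "('f, 'r, 'i + 'c) fml set"
  assumes "countable_lang L"
    and "T \<subseteq> sentences L"
    and "NIP L T TYPE('c)"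
    and "monster_model L T \<kappa> C"
    and "monster_model L T \<kappa>' C'" and "elem_sub L C C'" and "small \<kappa>' (univ C)"
    and "elem_sub L M C" and "small \<kappa> (univ M)"
    and "infinite (univ M)" and "countable (univ M)"
    and "bij_betw m UNIV (univ M)"
    and "\<mu> \<in> Mm_inv L C M m" and "\<nu> \<in> Mm_inv L C M m"
    and "p \<in> Sm_inv L C M m"
  shows "conv L C C' M m (dirac p) (conv L C C' M m \<mu> \<nu>) =
         conv L C C' M m (conv L C C' M m (dirac p) \<mu>) \<nu>"
proof -
  interpret nip_setting L T \<kappa> \<kappa>' C C' M m
    using assms by unfold_locales
  note p = dirac_Mm[OF assms(15)]
  show ?thesis
    using assms(13,14) p by (intro conv_assoc definable_Mm keisler_conc_Mm)
qed

end
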